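(* Let $X$ be a smooth projective curve over a field $K\supseteq\mathbb{C}$, and let $M_1,M_2$ be line bundles on $X$ with a fixed isomorphism $M_1\otimes_XM_2\simeq K_X^{-1}$. Let $(r,e)\in\mathbb{Z}_{\geq2}\times\mathbb{Z}$, let $\delta_1<\delta_2<\cdots$ be the numerically critical parameters of type $(r,e)$, and set $\delta_0=0$. Then: (i) For any $n\in\mathbb{Z}_{\geq0}$ and any $\delta\in(\delta_n,\delta_{n+1})$, an ADHM sheaf of type $(r,e)$ is $\delta$-semistable if and only if it is $\delta$-stable. (ii) For any $n\in\mathbb{Z}_{\geq0}$, the set of $\delta$-stable ADHM sheaves of type $(r,e)$ is constant for $\delta\in(\delta_n,\delta_{n+1})$.
   Context: Put $M=M_1\otimes_XM_2$. An ADHM sheaf on $X$ is a tuple $\mathcal{E}=(E,\Phi_1,\Phi_2,\phi,\psi)$ with $E$ a coherent $\mathcal{O}_X$-module and morphisms $\Phi_i:E\otimes_XM_i\to E$ ($i=1,2$), $\phi:E\otimes_XM\to\mathcal{O}_X$, $\psi:\mathcal{O}_X\to E$ satisfying $\Phi_1\circ(\Phi_2\otimes1_{M_1})-\Phi_2\circ(\Phi_1\otimes1_{M_2})+\psi\circ\phi=0$. It is locally free if $E$ is; its type is $(\mathrm{rank}\,E,\deg E)$. A subsheaf $E'\subset E$ is $\Phi$-invariant if $\Phi_i(E'\otimes M_i)\subseteq E'$ for $i=1,2$. Let $\mu(E)=\deg E/\mathrm{rank}\,E$, $r(E)=\mathrm{rank}\,E$, $\mu_\delta(\mathcal{E})=\mu(E)+\delta/r(E)$.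 For $\delta>0$, a nontrivial locally free ADHM sheaf is $\delta$-semistable (resp. $\delta$-stable) if: (i) $\psi\neq0$; (ii) every $\Phi$-invariant nontrivial proper saturated $E'\subset E$ with $\mathrm{Im}(\psi)\subseteq E'$ satisfies $\mu(E')+\delta/r(E')\leq\mu_\delta(\mathcal{E})$ (resp. $<$); (iii) every $\Phi$-invariant nontrivial proper saturated $E'\subset E$ with $E'\otimes_XM\subseteq\mathrm{Ker}(\phi)$ satisfies $\mu(E')\leq\mu_\delta(\mathcal{E})$ (resp. $<$). A parameter $\delta\in\mathbb{R}_{>0}$ is numerically critical of type $(r,e)$, $r\geq2$, if $\delta=\frac{re'-er'}{r'}$ or $\delta=\frac{er'-re'}{r-r'}$ for some $1\leq r'\leq r-1$, $e'\in\mathbb{Z}$. These form a discrete infinite set $\Delta_{(r,e)}\subset\mathbb{R}_{>0}$, enumerated in increasing order. *)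

theory Defs
  imports
    "HOL-Analysis.Abstract_Topology"
    "HOL-Analysis.Function_Topology"
    "HOL-Algebra.Free_Abelian_Groups"
    "HOL-Algebra.Generated_Groups"
    "HOL-Algebra.QuotRing"
    "HOL-Computational_Algebra.Fraction_Field"
    "Jordan_Normal_Form.VS_Connect"
begin

section \<open>Sheaves of sets and germs\<close>

text \<open>Sections over \<open>U\<close> are \<open>F U\<close>, and \<open>\<rho> U V\<close> restricts from \<open>U\<close> to \<open>V \<subseteq> U\<close>.
  Values at non-open sets are irrelevant throughout.\<close>

definition presheaf ::
  "'x topology \<Rightarrow> ('x set \<Rightarrow> 'a set) \<Rightarrow> ('x set \<Rightarrow> 'x set \<Rightarrow> 'a \<Rightarrow> 'a) \<Rightarrow> bool" where
  "presheaf T F \<rho> \<longleftrightarrow>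
     (\<forall>U V. openin T U \<and> openin T V \<and> V \<subseteq> U \<longrightarrow> \<rho> U V \<in> F U \<rightarrow> F V) \<and>
     (\<forall>U. openin T U \<longrightarrow> (\<forall>s\<in>F U. \<rho> U U s = s)) \<and>
     (\<forall>U V W. openin T U \<and> openin T V \<and> openin T W \<and> W \<subseteq> V \<and> V \<subseteq> U \<longrightarrow>
        (\<forall>s\<in>F U. \<rho> V W (\<rho> U V s) = \<rho> U W s))"

text \<open>The empty covering is included, so \<open>F {}\<close> is a singleton.\<close>

definition sheaf ::
  "'x topology \<Rightarrow> ('x set \<Rightarrow> 'a set) \<Rightarrow> ('x set \<Rightarrow> 'x set \<Rightarrow> 'a \<Rightarrow> 'a) \<Rightarrow> bool" where
  "sheaf T F \<rho> \<longleftrightarrow> presheaf T F \<rho> \<and>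
     (\<forall>\<U> s. (\<forall>U\<in>\<U>. openin T U \<and> s U \<in> F U) \<and>
        (\<forall>U\<in>\<U>. \<forall>V\<in>\<U>. \<rho> U (U \<inter> V) (s U) = \<rho> V (U \<inter> V) (s V)) \<longrightarrow>
        (\<exists>!t. t \<in> F (\<Union>\<U>) \<and> (\<forall>U\<in>\<U>. \<rho> (\<Union>\<U>) U t = s U)))"

definition germ ::
  "'x topology \<Rightarrow> ('x set \<Rightarrow> 'a set) \<Rightarrow> ('x set \<Rightarrow> 'x set \<Rightarrow> 'a \<Rightarrow> 'a) \<Rightarrow> 'x \<Rightarrow> 'x set \<Rightarrow> 'a
    \<Rightarrow> ('x set \<times> 'a) set" where
  "germ T F \<rho> x U s =
     {(V, t). openin T V \<and> x \<in> V \<and> t \<in> F V \<and>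
        (\<exists>W. openin T W \<and> x \<in> W \<and> W \<subseteq> U \<inter> V \<and> \<rho> U W s = \<rho> V W t)}"

definition germs ::
  "'x topology \<Rightarrow> ('x set \<Rightarrow> 'a set) \<Rightarrow> ('x set \<Rightarrow> 'x set \<Rightarrow> 'a \<Rightarrow> 'a) \<Rightarrow> 'x
    \<Rightarrow> ('x set \<times> 'a) set set" where
  "germs T F \<rho> x = {germ T F \<rho> x U s | U s. openin T U \<and> x \<in> U \<and> s \<in> F U}"

text \<open>The operation on germs induced by operations \<open>F U \<Rightarrow> G U \<Rightarrow> H U\<close> compatible with restriction.
  All members of the union are equal.\<close>

definition germ_lift2 ::
  "'x topology \<Rightarrow> ('x set \<Rightarrow> 'x set \<Rightarrow> 'a \<Rightarrow> 'a) \<Rightarrow> ('x set \<Rightarrow> 'x set \<Rightarrow> 'b \<Rightarrow> 'b)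
    \<Rightarrow> ('x set \<Rightarrow> 'c set) \<Rightarrow> ('x set \<Rightarrow> 'x set \<Rightarrow> 'c \<Rightarrow> 'c) \<Rightarrow> ('x set \<Rightarrow> 'a \<Rightarrow> 'b \<Rightarrow> 'c)
    \<Rightarrow> 'x \<Rightarrow> ('x set \<times> 'a) set \<Rightarrow> ('x set \<times> 'b) set \<Rightarrow> ('x set \<times> 'c) set" where
  "germ_lift2 T \<rho> \<sigma> H \<tau> f x A B =
     (\<Union>(U, s)\<in>A. \<Union>(V, t)\<in>B. germ T H \<tau> x (U \<inter> V) (f (U \<inter> V) (\<rho> U (U \<inter> V) s) (\<sigma> V (U \<inter> V) t)))"


section \<open>Ringed spaces\<close>

record ('x, 'r) rspace =
  topo :: "'x topology"
  rsec :: "'x set \<Rightarrow> 'r ring"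
  rres :: "'x set \<Rightarrow> 'x set \<Rightarrow> 'r \<Rightarrow> 'r"

text \<open>A morphism to \<open>Spec K\<close> is given by a ring homomorphism from \<open>K\<close> to the global functions.\<close>

record ('x, 'r, 'k) krspace = "('x, 'r) rspace" +
  scal :: "'k \<Rightarrow> 'r"

abbreviation pts :: "('x, 'r, 'z) rspace_scheme \<Rightarrow> 'x set" where
  "pts X \<equiv> topspace (topo X)"

abbreviation opn :: "('x, 'r, 'z) rspace_scheme \<Rightarrow> 'x set \<Rightarrow> bool" where
  "opn X U \<equiv> openin (topo X) U"

definition ringed_space :: "('x, 'r, 'z) rspace_scheme \<Rightarrow> bool" where
  "ringed_space X \<longleftrightarrow>
     sheaf (topo X) (\<lambda>U. carrier (rsec X U)) (rres X) \<and>
     (\<forall>U. opn X U \<longrightarrow> cring (rsec X U)) \<and>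
     (\<forall>U V. opn X U \<and> opn X V \<and> V \<subseteq> U \<longrightarrow> rres X U V \<in> Ring.ring_hom (rsec X U) (rsec X V))"

definition rgerm :: "('x, 'r, 'z) rspace_scheme \<Rightarrow> 'x \<Rightarrow> 'x set \<Rightarrow> 'r \<Rightarrow> ('x set \<times> 'r) set" where
  "rgerm X = germ (topo X) (\<lambda>U. carrier (rsec X U)) (rres X)"

definition stalk :: "('x, 'r, 'z) rspace_scheme \<Rightarrow> 'x \<Rightarrow> ('x set \<times> 'r) set ring" where
  "stalk X x =
     \<lparr>carrier = germs (topo X) (\<lambda>U. carrier (rsec X U)) (rres X) x,
      mult = germ_lift2 (topo X) (rres X) (rres X) (\<lambda>U. carrier (rsec X U)) (rres X)
               (\<lambda>U a b. a \<otimes>\<^bsub>rsec X U\<^esub> b) x,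
      one = rgerm X x (pts X) \<one>\<^bsub>rsec X (pts X)\<^esub>,
      zero = rgerm X x (pts X) \<zero>\<^bsub>rsec X (pts X)\<^esub>,
      add = germ_lift2 (topo X) (rres X) (rres X) (\<lambda>U. carrier (rsec X U)) (rres X)
               (\<lambda>U a b. a \<oplus>\<^bsub>rsec X U\<^esub> b) x\<rparr>"

definition open_subspace :: "('x, 'r, 'z) rspace_scheme \<Rightarrow> 'x set \<Rightarrow> ('x, 'r) rspace" where
  "open_subspace X U = \<lparr>topo = subtopology (topo X) U, rsec = rsec X, rres = rres X\<rparr>"

definition preim :: "('x, 'r, 'z) rspace_scheme \<Rightarrow> ('x \<Rightarrow> 'y) \<Rightarrow> 'y set \<Rightarrow> 'x set" where
  "preim X h V = {x \<in> pts X. h x \<in> V}"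

definition rspace_morphism ::
  "('x, 'r, 'z) rspace_scheme \<Rightarrow> ('y, 's, 'w) rspace_scheme \<Rightarrow> ('x \<Rightarrow> 'y)
    \<Rightarrow> ('y set \<Rightarrow> 's \<Rightarrow> 'r) \<Rightarrow> bool" where
  "rspace_morphism X Y h \<phi> \<longleftrightarrow>
     continuous_map (topo X) (topo Y) h \<and>
     (\<forall>V. opn Y V \<longrightarrow> \<phi> V \<in> Ring.ring_hom (rsec Y V) (rsec X (preim X h V))) \<and>
     (\<forall>V W. opn Y V \<and> opn Y W \<and> W \<subseteq> V \<longrightarrow>
        (\<forall>f\<in>carrier (rsec Y V). rres X (preim X h V) (preim X h W) (\<phi> V f) = \<phi> W (rres Y V W f)))"

definition rspace_iso ::
  "('x, 'r, 'z) rspace_scheme \<Rightarrow> ('y, 's, 'w) rspace_scheme \<Rightarrow> ('x \<Rightarrow> 'y)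
    \<Rightarrow> ('y set \<Rightarrow> 's \<Rightarrow> 'r) \<Rightarrow> bool" where
  "rspace_iso X Y h \<phi> \<longleftrightarrow>
     rspace_morphism X Y h \<phi> \<and> homeomorphic_map (topo X) (topo Y) h \<and>
     (\<forall>V. opn Y V \<longrightarrow> \<phi> V \<in> ring_iso (rsec Y V) (rsec X (preim X h V)))"

definition local_morphism ::
  "('x, 'r, 'z) rspace_scheme \<Rightarrow> ('y, 's, 'w) rspace_scheme \<Rightarrow> ('x \<Rightarrow> 'y)
    \<Rightarrow> ('y set \<Rightarrow> 's \<Rightarrow> 'r) \<Rightarrow> bool" where
  "local_morphism X Y h \<phi> \<longleftrightarrow>
     rspace_morphism X Y h \<phi> \<and>
     (\<forall>x V f. x \<in> pts X \<and> opn Y V \<and> h x \<in> V \<and> f \<in> carrier (rsec Y V) \<and>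
        rgerm X x (preim X h V) (\<phi> V f) \<in> Units (stalk X x) \<longrightarrow>
        rgerm Y (h x) V f \<in> Units (stalk Y (h x)))"

definition function_ring ::
  "'p set \<Rightarrow> ('p \<Rightarrow> 'c ring) \<Rightarrow> ('p \<Rightarrow> 'c) set \<Rightarrow> ('p \<Rightarrow> 'c) ring" where
  "function_ring U R C =
     \<lparr>carrier = C,
      mult = (\<lambda>f g. \<lambda>p\<in>U. f p \<otimes>\<^bsub>R p\<^esub> g p),
      one = (\<lambda>p\<in>U. \<one>\<^bsub>R p\<^esub>),
      zero = (\<lambda>p\<in>U. \<zero>\<^bsub>R p\<^esub>),
      add = (\<lambda>f g. \<lambda>p\<in>U. f p \<oplus>\<^bsub>R p\<^esub> g p)\<rparr>"


section \<open>Affine schemes and schemes\<close>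

text \<open>The fraction \<open>a / s\<close> in the localization of \<open>A\<close> at the prime \<open>P\<close>, as the class of all pairs
  representing it.\<close>

definition loc_frac :: "'r ring \<Rightarrow> 'r set \<Rightarrow> 'r \<Rightarrow> 'r \<Rightarrow> ('r \<times> 'r) set" where
  "loc_frac A P a s =
     {(b, t). b \<in> carrier A \<and> t \<in> carrier A - P \<and>
        (\<exists>u\<in>carrier A - P. u \<otimes>\<^bsub>A\<^esub> (a \<otimes>\<^bsub>A\<^esub> t \<ominus>\<^bsub>A\<^esub> b \<otimes>\<^bsub>A\<^esub> s) = \<zero>\<^bsub>A\<^esub>)}"

definition localization :: "'r ring \<Rightarrow> 'r set \<Rightarrow> ('r \<times> 'r) set ring" where
  "localization A P =
     \<lparr>carrier = {loc_frac A P a s | a s. a \<in> carrier A \<and> s \<in> carrier A - P},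
      mult = (\<lambda>x y. \<Union>(a, s)\<in>x. \<Union>(b, t)\<in>y. loc_frac A P (a \<otimes>\<^bsub>A\<^esub> b) (s \<otimes>\<^bsub>A\<^esub> t)),
      one = loc_frac A P \<one>\<^bsub>A\<^esub> \<one>\<^bsub>A\<^esub>,
      zero = loc_frac A P \<zero>\<^bsub>A\<^esub> \<one>\<^bsub>A\<^esub>,
      add = (\<lambda>x y. \<Union>(a, s)\<in>x. \<Union>(b, t)\<in>y.
               loc_frac A P (a \<otimes>\<^bsub>A\<^esub> t \<oplus>\<^bsub>A\<^esub> b \<otimes>\<^bsub>A\<^esub> s) (s \<otimes>\<^bsub>A\<^esub> t))\<rparr>"

definition zariski :: "'r ring \<Rightarrow> 'r set topology" where
  "zariski A = topology_generated_by {{P. primeideal P A \<and> f \<notin> P} | f. f \<in> carrier A}"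

definition Spec :: "'r ring \<Rightarrow> ('r set, 'r set \<Rightarrow> ('r \<times> 'r) set) rspace" where
  "Spec A =
     \<lparr>topo = zariski A,
      rsec = (\<lambda>U. function_ring U (localization A)
        {f \<in> (\<Pi>\<^sub>E P\<in>U. carrier (localization A P)).
           \<forall>P\<in>U. \<exists>V a s. openin (zariski A) V \<and> P \<in> V \<and> V \<subseteq> U \<and> a \<in> carrier A \<and> s \<in> carrier A \<and>
             (\<forall>Q\<in>V. s \<notin> Q \<and> f Q = loc_frac A Q a s)}),
      rres = (\<lambda>U V f. restrict f V)\<rparr>"

definition affine_open :: "('x, 'r, 'z) rspace_scheme \<Rightarrow> 'x set \<Rightarrow> bool" where
  "affine_open X U \<longleftrightarrow>
     opn X U \<and> (\<exists>h \<phi>. rspace_iso (open_subspace X U) (Spec (rsec X U)) h \<phi>)"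

definition is_scheme :: "('x, 'r, 'z) rspace_scheme \<Rightarrow> bool" where
  "is_scheme X \<longleftrightarrow> ringed_space X \<and> (\<forall>x\<in>pts X. \<exists>U. affine_open X U \<and> x \<in> U)"

definition integral_scheme :: "('x, 'r, 'z) rspace_scheme \<Rightarrow> bool" where
  "integral_scheme X \<longleftrightarrow>
     is_scheme X \<and> pts X \<noteq> {} \<and> (\<forall>U. opn X U \<and> U \<noteq> {} \<longrightarrow> domain (rsec X U))"

definition irreducible_closed :: "'x topology \<Rightarrow> 'x set \<Rightarrow> bool" where
  "irreducible_closed T Z \<longleftrightarrow> closedin T Z \<and> Z \<noteq> {} \<and>
     (\<forall>A B. closedin T A \<and> closedin T B \<and> Z \<subseteq> A \<union> B \<longrightarrow> Z \<subseteq> A \<or> Z \<subseteq> B)"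

definition irreducible_chain :: "'x topology \<Rightarrow> nat \<Rightarrow> bool" where
  "irreducible_chain T n \<longleftrightarrow>
     (\<exists>Z. (\<forall>i\<le>n. irreducible_closed T (Z i)) \<and> (\<forall>i<n. Z i \<subset> Z (Suc i)))"

definition has_krull_dim :: "'x topology \<Rightarrow> nat \<Rightarrow> bool" where
  "has_krull_dim T n \<longleftrightarrow> irreducible_chain T n \<and> \<not> irreducible_chain T (Suc n)"

definition generic_point :: "('x, 'r, 'z) rspace_scheme \<Rightarrow> 'x" where
  "generic_point X = (SOME \<eta>. \<eta> \<in> pts X \<and> topo X closure_of {\<eta>} = pts X)"


section \<open>Projective space\<close>

type_synonym 'k mpol = "(nat \<Rightarrow>\<^sub>0 nat) \<Rightarrow>\<^sub>0 'k"

text \<open>The graded ring \<open>K[x\<^sub>0, \<dots>, x\<^sub>n]\<close>, inside the polynomials in countably many variables.\<close>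

definition coord_ring :: "nat \<Rightarrow> ('k::field) mpol ring" where
  "coord_ring n =
     \<lparr>carrier = {p. \<forall>m\<in>Poly_Mapping.keys p. Poly_Mapping.keys m \<subseteq> {..n}},
      mult = (*), one = 1, zero = 0, add = (+)\<rparr>"

definition homogeneous :: "nat \<Rightarrow> ('k::field) mpol \<Rightarrow> bool" where
  "homogeneous d p \<longleftrightarrow>
     (\<forall>m\<in>Poly_Mapping.keys p. (\<Sum>i\<in>Poly_Mapping.keys m. Poly_Mapping.lookup m i) = d)"

definition proj_pts :: "nat \<Rightarrow> ('k::field) mpol set set" where
  "proj_pts n =
     {P. primeideal P (coord_ring n) \<and>
         P = genideal (coord_ring n) {p \<in> P. \<exists>d. homogeneous d p} \<and>
         \<not> (\<forall>i\<le>n. Poly_Mapping.single (Poly_Mapping.single i 1) 1 \<in> P)}"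

definition proj_topology :: "nat \<Rightarrow> ('k::field) mpol set topology" where
  "proj_topology n = topology_generated_by
     {{P \<in> proj_pts n. f \<notin> P} | f. f \<in> carrier (coord_ring n) \<and> (\<exists>d. homogeneous d f)}"

text \<open>\<open>Proj K[x\<^sub>0, \<dots>, x\<^sub>n]\<close>. The polynomial ring being a domain, its homogeneous localizations are
  realized inside its fraction field.\<close>

definition proj_space ::
  "nat \<Rightarrow> (('k::field) mpol set, 'k mpol set \<Rightarrow> 'k mpol fract, 'k) krspace" where
  "proj_space n =
     \<lparr>topo = proj_topology n,
      rsec = (\<lambda>U. function_ring U (\<lambda>P. class_ring)
        {f \<in> extensional U.
           \<forall>P\<in>U. \<exists>V a s d. openin (proj_topology n) V \<and> P \<in> V \<and> V \<subseteq> U \<and>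
             a \<in> carrier (coord_ring n) \<and> s \<in> carrier (coord_ring n) \<and>
             homogeneous d a \<and> homogeneous d s \<and>
             (\<forall>Q\<in>V. s \<notin> Q \<and> f Q = Fract a s)}),
      rres = (\<lambda>U V f. restrict f V),
      scal = (\<lambda>k. \<lambda>P\<in>proj_pts n. Fract (Poly_Mapping.single 0 k) 1)\<rparr>"

definition K_scheme :: "('x, 'r, 'k::field, 'z) krspace_scheme \<Rightarrow> bool" where
  "K_scheme X \<longleftrightarrow> is_scheme X \<and> scal X \<in> Ring.ring_hom class_ring (rsec X (pts X))"

definition closed_immersion ::
  "('x, 'r, 'k::field, 'z) krspace_scheme \<Rightarrow> ('y, 's, 'k, 'w) krspace_scheme \<Rightarrow> ('x \<Rightarrow> 'y)
    \<Rightarrow> ('y set \<Rightarrow> 's \<Rightarrow> 'r) \<Rightarrow> bool" where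
  "closed_immersion X Y h \<phi> \<longleftrightarrow>
     local_morphism X Y h \<phi> \<and>
     (\<forall>k. \<phi> (pts Y) (scal Y k) = scal X k) \<and>
     embedding_map (topo X) (topo Y) h \<and> closedin (topo Y) (h ` pts X) \<and>
     (\<forall>V s y. opn Y V \<and> s \<in> carrier (rsec X (preim X h V)) \<and> y \<in> V \<longrightarrow>
        (\<exists>W f. opn Y W \<and> y \<in> W \<and> W \<subseteq> V \<and> f \<in> carrier (rsec Y W) \<and>
           \<phi> W f = rres X (preim X h V) (preim X h W) s))"

definition projective_over :: "('x, 'r, 'k::field, 'z) krspace_scheme \<Rightarrow> bool" where
  "projective_over X \<longleftrightarrow>
     K_scheme X \<and> (\<exists>n h \<phi>. closed_immersion X (proj_space n :: (_, _, 'k) krspace) h \<phi>)"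


section \<open>Modules over the structure sheaf\<close>

record ('x, 'r, 'm) omod =
  msec :: "'x set \<Rightarrow> ('r, 'm) module"
  mres :: "'x set \<Rightarrow> 'x set \<Rightarrow> 'm \<Rightarrow> 'm"

abbreviation mcar :: "('x, 'r, 'm) omod \<Rightarrow> 'x set \<Rightarrow> 'm set" where
  "mcar F U \<equiv> carrier (msec F U)"

definition is_omod :: "('x, 'r, 'z) rspace_scheme \<Rightarrow> ('x, 'r, 'm) omod \<Rightarrow> bool" where
  "is_omod X F \<longleftrightarrow>
     sheaf (topo X) (mcar F) (mres F) \<and>
     (\<forall>U. opn X U \<longrightarrow> module (rsec X U) (msec F U)) \<and>
     (\<forall>U V. opn X U \<and> opn X V \<and> V \<subseteq> U \<longrightarrow>
        (\<forall>s\<in>mcar F U. \<forall>t\<in>mcar F U.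
           mres F U V (s \<oplus>\<^bsub>msec F U\<^esub> t) = mres F U V s \<oplus>\<^bsub>msec F V\<^esub> mres F U V t) \<and>
        (\<forall>a\<in>carrier (rsec X U). \<forall>s\<in>mcar F U.
           mres F U V (a \<odot>\<^bsub>msec F U\<^esub> s) = rres X U V a \<odot>\<^bsub>msec F V\<^esub> mres F U V s))"

definition omod_hom ::
  "('x, 'r, 'z) rspace_scheme \<Rightarrow> ('x, 'r, 'm) omod \<Rightarrow> ('x, 'r, 'n) omod
    \<Rightarrow> ('x set \<Rightarrow> 'm \<Rightarrow> 'n) \<Rightarrow> bool" where
  "omod_hom X F G \<alpha> \<longleftrightarrow>
     (\<forall>U. opn X U \<longrightarrow> \<alpha> U \<in> module_hom (rsec X U) (msec F U) (msec G U)) \<and>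
     (\<forall>U V. opn X U \<and> opn X V \<and> V \<subseteq> U \<longrightarrow>
        (\<forall>s\<in>mcar F U. mres G U V (\<alpha> U s) = \<alpha> V (mres F U V s)))"

definition omod_iso ::
  "('x, 'r, 'z) rspace_scheme \<Rightarrow> ('x, 'r, 'm) omod \<Rightarrow> ('x, 'r, 'n) omod
    \<Rightarrow> ('x set \<Rightarrow> 'm \<Rightarrow> 'n) \<Rightarrow> bool" where
  "omod_iso X F G \<alpha> \<longleftrightarrow>
     omod_hom X F G \<alpha> \<and> (\<forall>U. opn X U \<longrightarrow> bij_betw (\<alpha> U) (mcar F U) (mcar G U))"

definition structure_sheaf :: "('x, 'r, 'z) rspace_scheme \<Rightarrow> ('x, 'r, 'r) omod" where
  "structure_sheaf X =
     \<lparr>msec = (\<lambda>U. \<lparr>carrier = carrier (rsec X U), mult = mult (rsec X U), one = one (rsec X U),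
        zero = zero (rsec X U), add = add (rsec X U), smult = mult (rsec X U)\<rparr>),
      mres = rres X\<rparr>"

definition mgerm ::
  "('x, 'r, 'z) rspace_scheme \<Rightarrow> ('x, 'r, 'm) omod \<Rightarrow> 'x \<Rightarrow> 'x set \<Rightarrow> 'm \<Rightarrow> ('x set \<times> 'm) set" where
  "mgerm X F = germ (topo X) (mcar F) (mres F)"

text \<open>The module record extends the ring record; its fields \<open>mult\<close> and \<open>one\<close> carry no meaning.\<close>

definition mstalk ::
  "('x, 'r, 'z) rspace_scheme \<Rightarrow> ('x, 'r, 'm) omod \<Rightarrow> 'x
    \<Rightarrow> (('x set \<times> 'r) set, ('x set \<times> 'm) set) module" where
  "mstalk X F x =
     \<lparr>carrier = germs (topo X) (mcar F) (mres F) x,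
      mult = undefined, one = undefined,
      zero = mgerm X F x (pts X) \<zero>\<^bsub>msec F (pts X)\<^esub>,
      add = germ_lift2 (topo X) (mres F) (mres F) (mcar F) (mres F) (\<lambda>U s t. s \<oplus>\<^bsub>msec F U\<^esub> t) x,
      smult = germ_lift2 (topo X) (rres X) (mres F) (mcar F) (mres F) (\<lambda>U a s. a \<odot>\<^bsub>msec F U\<^esub> s) x\<rparr>"

text \<open>The sheaf associated with a presheaf of modules: sections are the families of germs that are
  locally induced by sections of the presheaf.\<close>

definition sheafify ::
  "('x, 'r, 'z) rspace_scheme \<Rightarrow> ('x, 'r, 'm) omod \<Rightarrow> ('x, 'r, 'x \<Rightarrow> ('x set \<times> 'm) set) omod" where
  "sheafify X F =
     \<lparr>msec = (\<lambda>U.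
        \<lparr>carrier = {s \<in> (\<Pi>\<^sub>E x\<in>U. carrier (mstalk X F x)).
           \<forall>x\<in>U. \<exists>V t. opn X V \<and> x \<in> V \<and> V \<subseteq> U \<and> t \<in> mcar F V \<and> (\<forall>y\<in>V. s y = mgerm X F y V t)},
         mult = undefined, one = undefined,
         zero = (\<lambda>x\<in>U. \<zero>\<^bsub>mstalk X F x\<^esub>),
         add = (\<lambda>s t. \<lambda>x\<in>U. s x \<oplus>\<^bsub>mstalk X F x\<^esub> t x),
         smult = (\<lambda>a s. \<lambda>x\<in>U. rgerm X x U a \<odot>\<^bsub>mstalk X F x\<^esub> s x)\<rparr>),
      mres = (\<lambda>U V s. restrict s V)\<rparr>"

text \<open>The quotient of a module by a submodule with carrier \<open>N\<close>.\<close>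

definition quot_module :: "('r, 'm) module \<Rightarrow> 'm set \<Rightarrow> ('r, 'm set) module" where
  "quot_module M N =
     \<lparr>carrier = a_rcosets\<^bsub>M\<^esub> N,
      mult = undefined, one = undefined,
      zero = N,
      add = (\<lambda>C D. C <+>\<^bsub>M\<^esub> D),
      smult = (\<lambda>r C. \<Union>c\<in>C. N +>\<^bsub>M\<^esub> (r \<odot>\<^bsub>M\<^esub> c))\<rparr>"

definition torsion_free :: "'r ring \<Rightarrow> ('r, 'm) module \<Rightarrow> bool" where
  "torsion_free R M \<longleftrightarrow>
     (\<forall>a\<in>carrier R. \<forall>s\<in>carrier M. a \<odot>\<^bsub>M\<^esub> s = \<zero>\<^bsub>M\<^esub> \<longrightarrow> a = \<zero>\<^bsub>R\<^esub> \<or> s = \<zero>\<^bsub>M\<^esub>)"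

text \<open>The linear combination of sections \<open>s 0, \<dots>, s (n - 1)\<close> over \<open>U\<close>, with coefficients over \<open>V\<close>.\<close>

definition lin_comb ::
  "('x, 'r, 'm) omod \<Rightarrow> 'x set \<Rightarrow> 'x set \<Rightarrow> nat \<Rightarrow> (nat \<Rightarrow> 'r) \<Rightarrow> (nat \<Rightarrow> 'm) \<Rightarrow> 'm" where
  "lin_comb F U V n a s = finsum (msec F V) (\<lambda>i. a i \<odot>\<^bsub>msec F V\<^esub> mres F U V (s i)) {..<n}"

text \<open>The sections \<open>e 0, \<dots>, e (n - 1)\<close> over \<open>U\<close> define an isomorphism from the \<open>n\<close>-th power of the
  structure sheaf of \<open>U\<close> to the restriction of \<open>F\<close> to \<open>U\<close>.\<close>

definition frame ::
  "('x, 'r, 'z) rspace_scheme \<Rightarrow> ('x, 'r, 'm) omod \<Rightarrow> 'x set \<Rightarrow> nat \<Rightarrow> (nat \<Rightarrow> 'm) \<Rightarrow> bool" where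
  "frame X F U n e \<longleftrightarrow>
     e \<in> {..<n} \<rightarrow> mcar F U \<and>
     (\<forall>V. opn X V \<and> V \<subseteq> U \<longrightarrow>
        (\<forall>t\<in>mcar F V. \<exists>!a. a \<in> {..<n} \<rightarrow>\<^sub>E carrier (rsec X V) \<and> lin_comb F U V n a e = t))"

definition locally_free :: "('x, 'r, 'z) rspace_scheme \<Rightarrow> ('x, 'r, 'm) omod \<Rightarrow> bool" where
  "locally_free X F \<longleftrightarrow>
     is_omod X F \<and> (\<forall>x\<in>pts X. \<exists>U n e. opn X U \<and> x \<in> U \<and> frame X F U n e)"

definition line_bundle :: "('x, 'r, 'z) rspace_scheme \<Rightarrow> ('x, 'r, 'm) omod \<Rightarrow> bool" where
  "line_bundle X F \<longleftrightarrow>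
     is_omod X F \<and> (\<forall>x\<in>pts X. \<exists>U e. opn X U \<and> x \<in> U \<and> frame X F U 1 e)"

definition finite_type :: "('x, 'r, 'z) rspace_scheme \<Rightarrow> ('x, 'r, 'm) omod \<Rightarrow> bool" where
  "finite_type X F \<longleftrightarrow>
     (\<forall>x\<in>pts X. \<exists>U n s. opn X U \<and> x \<in> U \<and> s \<in> {..<n} \<rightarrow> mcar F U \<and>
        (\<forall>V t y. opn X V \<and> V \<subseteq> U \<and> t \<in> mcar F V \<and> y \<in> V \<longrightarrow>
           (\<exists>W a. opn X W \<and> y \<in> W \<and> W \<subseteq> V \<and> a \<in> {..<n} \<rightarrow> carrier (rsec X W) \<and>
              mres F V W t = lin_comb F U W n a s)))"

definition relations ::
  "('x, 'r, 'z) rspace_scheme \<Rightarrow> ('x, 'r, 'm) omod \<Rightarrow> 'x set \<Rightarrow> nat \<Rightarrow> (nat \<Rightarrow> 'm) \<Rightarrow> 'x set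
    \<Rightarrow> (nat \<Rightarrow> 'r) set" where
  "relations X F U n s V =
     {a \<in> {..<n} \<rightarrow>\<^sub>E carrier (rsec X V). lin_comb F U V n a s = \<zero>\<^bsub>msec F V\<^esub>}"

text \<open>Coherence as for modules over an arbitrary ringed space: finite type, and for all finitely many
  sections over an open set their sheaf of relations is of finite type.\<close>

definition coherent :: "('x, 'r, 'z) rspace_scheme \<Rightarrow> ('x, 'r, 'm) omod \<Rightarrow> bool" where
  "coherent X F \<longleftrightarrow>
     is_omod X F \<and> finite_type X F \<and>
     (\<forall>U n s. opn X U \<and> s \<in> {..<n} \<rightarrow> mcar F U \<longrightarrow>
        (\<forall>x\<in>U. \<exists>U' m b. opn X U' \<and> x \<in> U' \<and> U' \<subseteq> U \<and> b \<in> {..<m} \<rightarrow> relations X F U n s U' \<and>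
           (\<forall>V a y. opn X V \<and> V \<subseteq> U' \<and> a \<in> relations X F U n s V \<and> y \<in> V \<longrightarrow>
              (\<exists>W c. opn X W \<and> y \<in> W \<and> W \<subseteq> V \<and> c \<in> {..<m} \<rightarrow> carrier (rsec X W) \<and>
                 (\<forall>i<n. rres X V W (a i) =
                    lin_comb (structure_sheaf X) U' W m c (\<lambda>j. b j i))))))"

definition rank :: "('x, 'r, 'z) rspace_scheme \<Rightarrow> ('x, 'r, 'm) omod \<Rightarrow> nat" where
  "rank X F = vectorspace.dim (stalk X (generic_point X)) (mstalk X F (generic_point X))"

text \<open>A subsheaf is given by its sets of sections; the operations are inherited.\<close>

definition sub_omod :: "('x, 'r, 'm) omod \<Rightarrow> ('x set \<Rightarrow> 'm set) \<Rightarrow> ('x, 'r, 'm) omod" where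
  "sub_omod F F' = F\<lparr>msec := (\<lambda>U. (msec F U)\<lparr>carrier := F' U\<rparr>)\<rparr>"

definition coherent_subsheaf ::
  "('x, 'r, 'z) rspace_scheme \<Rightarrow> ('x, 'r, 'm) omod \<Rightarrow> ('x set \<Rightarrow> 'm set) \<Rightarrow> bool" where
  "coherent_subsheaf X F F' \<longleftrightarrow>
     (\<forall>U. opn X U \<longrightarrow> F' U \<subseteq> mcar F U) \<and> coherent X (sub_omod F F')"

text \<open>The quotient sheaf is torsion-free; its stalks are the quotients of the stalks.\<close>

definition saturated ::
  "('x, 'r, 'z) rspace_scheme \<Rightarrow> ('x, 'r, 'm) omod \<Rightarrow> ('x set \<Rightarrow> 'm set) \<Rightarrow> bool" where
  "saturated X F F' \<longleftrightarrow>
     (\<forall>x\<in>pts X. torsion_free (stalk X x)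
        (quot_module (mstalk X F x) {mgerm X F x U s | U s. opn X U \<and> x \<in> U \<and> s \<in> F' U}))"

definition proper_nontrivial ::
  "('x, 'r, 'z) rspace_scheme \<Rightarrow> ('x, 'r, 'm) omod \<Rightarrow> ('x set \<Rightarrow> 'm set) \<Rightarrow> bool" where
  "proper_nontrivial X F F' \<longleftrightarrow>
     (\<exists>U. opn X U \<and> F' U \<noteq> {\<zero>\<^bsub>msec F U\<^esub>}) \<and> (\<exists>U. opn X U \<and> F' U \<noteq> mcar F U)"


section \<open>Tensor products, differentials and duals\<close>

text \<open>Formal integral combinations of pairs in \<open>A \<times> B\<close> modulo the subgroup generated by \<open>rels\<close>;
  scalars act on the first component.\<close>

definition rel_group :: "'a set \<Rightarrow> 'b set \<Rightarrow> ('a \<times> 'b \<Rightarrow>\<^sub>0 int) set \<Rightarrow> ('a \<times> 'b \<Rightarrow>\<^sub>0 int) set" where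
  "rel_group A B rels = generate (free_Abelian_group (A \<times> B)) rels"

definition symbol_map ::
  "'c set \<Rightarrow> 'd set \<Rightarrow> ('c \<times> 'd \<Rightarrow>\<^sub>0 int) set \<Rightarrow> ('a \<Rightarrow> 'c) \<Rightarrow> ('b \<Rightarrow> 'd)
    \<Rightarrow> ('a \<times> 'b \<Rightarrow>\<^sub>0 int) set \<Rightarrow> ('c \<times> 'd \<Rightarrow>\<^sub>0 int) set" where
  "symbol_map A B rels f g C =
     (\<Union>c\<in>C. rel_group A B rels #>\<^bsub>free_Abelian_group (A \<times> B)\<^esub>
        frag_extend (\<lambda>(a, b). frag_of (f a, g b)) c)"

definition symbol_module ::
  "'a set \<Rightarrow> 'b set \<Rightarrow> ('a \<times> 'b \<Rightarrow>\<^sub>0 int) set \<Rightarrow> ('r \<Rightarrow> 'a \<Rightarrow> 'a)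
    \<Rightarrow> ('r, ('a \<times> 'b \<Rightarrow>\<^sub>0 int) set) module" where
  "symbol_module A B rels act =
     \<lparr>carrier = rcosets\<^bsub>free_Abelian_group (A \<times> B)\<^esub> (rel_group A B rels),
      mult = undefined, one = undefined,
      zero = rel_group A B rels,
      add = (\<lambda>C D. C <#>\<^bsub>free_Abelian_group (A \<times> B)\<^esub> D),
      smult = (\<lambda>r. symbol_map A B rels (act r) id)\<rparr>"

definition tensor_rels ::
  "'r ring \<Rightarrow> ('r, 'a) module \<Rightarrow> ('r, 'b) module \<Rightarrow> ('a \<times> 'b \<Rightarrow>\<^sub>0 int) set" where
  "tensor_rels R M N =
     {frag_of (a \<oplus>\<^bsub>M\<^esub> a', b) - frag_of (a, b) - frag_of (a', b) | a a' b.
        a \<in> carrier M \<and> a' \<in> carrier M \<and> b \<in> carrier N} \<union>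
     {frag_of (a, b \<oplus>\<^bsub>N\<^esub> b') - frag_of (a, b) - frag_of (a, b') | a b b'.
        a \<in> carrier M \<and> b \<in> carrier N \<and> b' \<in> carrier N} \<union>
     {frag_of (r \<odot>\<^bsub>M\<^esub> a, b) - frag_of (a, r \<odot>\<^bsub>N\<^esub> b) | r a b.
        r \<in> carrier R \<and> a \<in> carrier M \<and> b \<in> carrier N}"

definition tensor_presheaf ::
  "('x, 'r, 'z) rspace_scheme \<Rightarrow> ('x, 'r, 'a) omod \<Rightarrow> ('x, 'r, 'b) omod
    \<Rightarrow> ('x, 'r, ('a \<times> 'b \<Rightarrow>\<^sub>0 int) set) omod" where
  "tensor_presheaf X F G =
     \<lparr>msec = (\<lambda>U. symbol_module (mcar F U) (mcar G U) (tensor_rels (rsec X U) (msec F U) (msec G U))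
                (smult (msec F U))),
      mres = (\<lambda>U V. symbol_map (mcar F V) (mcar G V) (tensor_rels (rsec X V) (msec F V) (msec G V))
                (mres F U V) (mres G U V))\<rparr>"

type_synonym ('x, 'a, 'b) tens = "'x \<Rightarrow> ('x set \<times> ('a \<times> 'b \<Rightarrow>\<^sub>0 int) set) set"

definition tensor ::
  "('x, 'r, 'z) rspace_scheme \<Rightarrow> ('x, 'r, 'a) omod \<Rightarrow> ('x, 'r, 'b) omod
    \<Rightarrow> ('x, 'r, ('x, 'a, 'b) tens) omod" where
  "tensor X F G = sheafify X (tensor_presheaf X F G)"

text \<open>The section \<open>s \<otimes> t\<close> of the tensor product over \<open>U\<close>.\<close>

definition tsec ::
  "('x, 'r, 'z) rspace_scheme \<Rightarrow> ('x, 'r, 'a) omod \<Rightarrow> ('x, 'r, 'b) omod \<Rightarrow> 'x set \<Rightarrow> 'a \<Rightarrow> 'b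
    \<Rightarrow> ('x, 'a, 'b) tens" where
  "tsec X F G U s t =
     (\<lambda>x\<in>U. mgerm X (tensor_presheaf X F G) x U
        (rel_group (mcar F U) (mcar G U) (tensor_rels (rsec X U) (msec F U) (msec G U))
           #>\<^bsub>free_Abelian_group (mcar F U \<times> mcar G U)\<^esub> frag_of (s, t)))"

text \<open>The subsheaf \<open>F' \<otimes> G\<close> of \<open>F \<otimes> G\<close>, that is, the image of the canonical map.\<close>

definition tensor_sub ::
  "('x, 'r, 'z) rspace_scheme \<Rightarrow> ('x, 'r, 'a) omod \<Rightarrow> ('x set \<Rightarrow> 'a set) \<Rightarrow> ('x, 'r, 'b) omod
    \<Rightarrow> 'x set \<Rightarrow> ('x, 'a, 'b) tens set" where
  "tensor_sub X F F' G U =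
     {t \<in> mcar (tensor X F G) U.
        \<forall>x\<in>U. \<exists>V n s g. opn X V \<and> x \<in> V \<and> V \<subseteq> U \<and> s \<in> {..<n} \<rightarrow> F' V \<and> g \<in> {..<n} \<rightarrow> mcar G V \<and>
          mres (tensor X F G) U V t =
            finsum (msec (tensor X F G) V) (\<lambda>i::nat. tsec X F G V (s i) (g i)) {..<n}}"

text \<open>Relations between the symbols \<open>(a, b)\<close>, standing for \<open>a db\<close>, in the module of Kaehler
  differentials of the \<open>K\<close>-algebra \<open>R\<close>, where \<open>C\<close> is the image of \<open>K\<close>.\<close>

definition kaehler_rels :: "'r ring \<Rightarrow> 'r set \<Rightarrow> ('r \<times> 'r \<Rightarrow>\<^sub>0 int) set" where
  "kaehler_rels R C =
     {frag_of (a \<oplus>\<^bsub>R\<^esub> a', b) - frag_of (a, b) - frag_of (a', b) | a a' b.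
        a \<in> carrier R \<and> a' \<in> carrier R \<and> b \<in> carrier R} \<union>
     {frag_of (a, b \<oplus>\<^bsub>R\<^esub> b') - frag_of (a, b) - frag_of (a, b') | a b b'.
        a \<in> carrier R \<and> b \<in> carrier R \<and> b' \<in> carrier R} \<union>
     {frag_of (a, b \<otimes>\<^bsub>R\<^esub> b') - frag_of (a \<otimes>\<^bsub>R\<^esub> b, b') - frag_of (a \<otimes>\<^bsub>R\<^esub> b', b) | a b b'.
        a \<in> carrier R \<and> b \<in> carrier R \<and> b' \<in> carrier R} \<union>
     {frag_of (a, c) | a c. a \<in> carrier R \<and> c \<in> C}"

definition const_at :: "('x, 'r, 'k, 'z) krspace_scheme \<Rightarrow> 'x set \<Rightarrow> 'k \<Rightarrow> 'r" where
  "const_at X U k = rres X (pts X) U (scal X k)"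

definition kaehler_presheaf ::
  "('x, 'r, 'k, 'z) krspace_scheme \<Rightarrow> ('x, 'r, ('r \<times> 'r \<Rightarrow>\<^sub>0 int) set) omod" where
  "kaehler_presheaf X =
     \<lparr>msec = (\<lambda>U. symbol_module (carrier (rsec X U)) (carrier (rsec X U))
                (kaehler_rels (rsec X U) (range (const_at X U))) (mult (rsec X U))),
      mres = (\<lambda>U V. symbol_map (carrier (rsec X V)) (carrier (rsec X V))
                (kaehler_rels (rsec X V) (range (const_at X V))) (rres X U V) (rres X U V))\<rparr>"

definition differentials :: "('x, 'r, 'k, 'z) krspace_scheme \<Rightarrow> ('x, 'r, ('x, 'r, 'r) tens) omod" where
  "differentials X = sheafify X (kaehler_presheaf X)"

text \<open>The sheaf of homomorphisms to the structure sheaf. A section over \<open>U\<close> is a family of maps indexed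
  by the open subsets of \<open>U\<close>.\<close>

definition dual ::
  "('x, 'r, 'z) rspace_scheme \<Rightarrow> ('x, 'r, 'm) omod \<Rightarrow> ('x, 'r, 'x set \<Rightarrow> 'm \<Rightarrow> 'r) omod" where
  "dual X F =
     \<lparr>msec = (\<lambda>U.
        \<lparr>carrier = {\<alpha> \<in> extensional {V. opn X V \<and> V \<subseteq> U}.
           (\<forall>V. opn X V \<and> V \<subseteq> U \<longrightarrow>
              \<alpha> V \<in> extensional (mcar F V) \<and>
              \<alpha> V \<in> module_hom (rsec X V) (msec F V) (msec (structure_sheaf X) V)) \<and>
           (\<forall>V W. opn X V \<and> V \<subseteq> U \<and> opn X W \<and> W \<subseteq> V \<longrightarrow>
              (\<forall>s\<in>mcar F V. rres X V W (\<alpha> V s) = \<alpha> W (mres F V W s)))},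
         mult = undefined, one = undefined,
         zero = (\<lambda>V\<in>{V. opn X V \<and> V \<subseteq> U}. \<lambda>s\<in>mcar F V. \<zero>\<^bsub>rsec X V\<^esub>),
         add = (\<lambda>\<alpha> \<beta>. \<lambda>V\<in>{V. opn X V \<and> V \<subseteq> U}. \<lambda>s\<in>mcar F V. \<alpha> V s \<oplus>\<^bsub>rsec X V\<^esub> \<beta> V s),
         smult = (\<lambda>a \<alpha>. \<lambda>V\<in>{V. opn X V \<and> V \<subseteq> U}. \<lambda>s\<in>mcar F V. rres X U V a \<otimes>\<^bsub>rsec X V\<^esub> \<alpha> V s)\<rparr>),
      mres = (\<lambda>U V \<alpha>. restrict \<alpha> {W. opn X W \<and> W \<subseteq> V})\<rparr>"


section \<open>Smooth projective curves and degrees\<close>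

text \<open>Over a field flatness is automatic, so an integral one-dimensional scheme of finite type is smooth
  iff its differentials are locally free of rank 1. No geometric irreducibility is required.\<close>

definition smooth_projective_curve :: "('x, 'r, 'k::field, 'z) krspace_scheme \<Rightarrow> bool" where
  "smooth_projective_curve X \<longleftrightarrow>
     projective_over X \<and> integral_scheme X \<and> has_krull_dim (topo X) 1 \<and>
     line_bundle X (differentials X)"

text \<open>On a smooth curve the canonical bundle is the sheaf of differentials.\<close>

definition inverse_canonical ::
  "('x, 'r, 'k, 'z) krspace_scheme \<Rightarrow> ('x, 'r, 'x set \<Rightarrow> ('x, 'r, 'r) tens \<Rightarrow> 'r) omod" where
  "inverse_canonical X = dual X (differentials X)"

definition K_sections ::
  "('x, 'r, 'k, 'z) krspace_scheme \<Rightarrow> ('x, 'r, 'm) omod \<Rightarrow> 'x set \<Rightarrow> ('k, 'm) module" where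
  "K_sections X F U =
     \<lparr>carrier = mcar F U, mult = undefined, one = undefined, zero = \<zero>\<^bsub>msec F U\<^esub>, add = add (msec F U),
      smult = (\<lambda>k s. const_at X U k \<odot>\<^bsub>msec F U\<^esub> s)\<rparr>"

text \<open>The Euler characteristic of a coherent sheaf, from the Cech complex of a covering by two affine
  open sets. Projective curves have such coverings, and the result does not depend on the choice.\<close>

definition affine_cover :: "('x, 'r, 'z) rspace_scheme \<Rightarrow> 'x set \<times> 'x set" where
  "affine_cover X = (SOME (U, V). affine_open X U \<and> affine_open X V \<and> U \<union> V = pts X)"

definition h0 :: "('x, 'r, 'k::field, 'z) krspace_scheme \<Rightarrow> ('x, 'r, 'm) omod \<Rightarrow> nat" where
  "h0 X F = vectorspace.dim class_ring (K_sections X F (pts X))"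

definition h1 :: "('x, 'r, 'k::field, 'z) krspace_scheme \<Rightarrow> ('x, 'r, 'm) omod \<Rightarrow> nat" where
  "h1 X F = (case affine_cover X of (U, V) \<Rightarrow>
     vectorspace.dim class_ring (quot_module (K_sections X F (U \<inter> V))
       {mres F U (U \<inter> V) s \<oplus>\<^bsub>msec F (U \<inter> V)\<^esub> mres F V (U \<inter> V) t | s t.
          s \<in> mcar F U \<and> t \<in> mcar F V}))"

definition euler_char :: "('x, 'r, 'k::field, 'z) krspace_scheme \<Rightarrow> ('x, 'r, 'm) omod \<Rightarrow> int" where
  "euler_char X F = int (h0 X F) - int (h1 X F)"

definition deg :: "('x, 'r, 'k::field, 'z) krspace_scheme \<Rightarrow> ('x, 'r, 'm) omod \<Rightarrow> int" where
  "deg X F = euler_char X F - int (rank X F) * euler_char X (structure_sheaf X)"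

definition slope :: "('x, 'r, 'k::field, 'z) krspace_scheme \<Rightarrow> ('x, 'r, 'm) omod \<Rightarrow> real" where
  "slope X F = real_of_int (deg X F) / real (rank X F)"


section \<open>ADHM sheaves\<close>

record ('x, 'r, 'm, 'a, 'b) adhm =
  und :: "('x, 'r, 'm) omod"
  Phi1 :: "'x set \<Rightarrow> ('x, 'm, 'a) tens \<Rightarrow> 'm"
  Phi2 :: "'x set \<Rightarrow> ('x, 'm, 'b) tens \<Rightarrow> 'm"
  phi :: "'x set \<Rightarrow> ('x, 'm, ('x, 'a, 'b) tens) tens \<Rightarrow> 'r"
  psi :: "'x set \<Rightarrow> 'r \<Rightarrow> 'm"

text \<open>The relation is an identity of morphisms on \<open>E \<otimes> M\<^sub>1 \<otimes> M\<^sub>2\<close>, with the canonical identifications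
  reordering the factors understood. As this sheaf is locally generated by pure tensors, it is stated
  on \<open>s \<otimes> m\<^sub>1 \<otimes> m\<^sub>2\<close>.\<close>

definition adhm_sheaf ::
  "('x, 'r, 'k::field) krspace \<Rightarrow> ('x, 'r, 'a) omod \<Rightarrow> ('x, 'r, 'b) omod
    \<Rightarrow> ('x, 'r, 'm, 'a, 'b) adhm \<Rightarrow> bool" where
  "adhm_sheaf X M1 M2 \<E> \<longleftrightarrow>
     (let E = und \<E>; M = tensor X M1 M2 in
      coherent X E \<and>
      omod_hom X (tensor X E M1) E (Phi1 \<E>) \<and>
      omod_hom X (tensor X E M2) E (Phi2 \<E>) \<and>
      omod_hom X (tensor X E M) (structure_sheaf X) (phi \<E>) \<and>
      omod_hom X (structure_sheaf X) E (psi \<E>) \<and>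
      (\<forall>U. opn X U \<longrightarrow> (\<forall>s\<in>mcar E U. \<forall>m1\<in>mcar M1 U. \<forall>m2\<in>mcar M2 U.
         Phi1 \<E> U (tsec X E M1 U (Phi2 \<E> U (tsec X E M2 U s m2)) m1)
           \<ominus>\<^bsub>msec E U\<^esub> Phi2 \<E> U (tsec X E M2 U (Phi1 \<E> U (tsec X E M1 U s m1)) m2)
           \<oplus>\<^bsub>msec E U\<^esub> psi \<E> U (phi \<E> U (tsec X E M U s (tsec X M1 M2 U m1 m2)))
         = \<zero>\<^bsub>msec E U\<^esub>)))"

definition adhm_type ::
  "('x, 'r, 'k::field) krspace \<Rightarrow> ('x, 'r, 'm, 'a, 'b) adhm \<Rightarrow> nat \<times> int" where
  "adhm_type X \<E> = (rank X (und \<E>), deg X (und \<E>))"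

definition Phi_invariant ::
  "('x, 'r, 'k::field) krspace \<Rightarrow> ('x, 'r, 'a) omod \<Rightarrow> ('x, 'r, 'b) omod
    \<Rightarrow> ('x, 'r, 'm, 'a, 'b) adhm \<Rightarrow> ('x set \<Rightarrow> 'm set) \<Rightarrow> bool" where
  "Phi_invariant X M1 M2 \<E> E' \<longleftrightarrow>
     (\<forall>U. opn X U \<longrightarrow>
        Phi1 \<E> U ` tensor_sub X (und \<E>) E' M1 U \<subseteq> E' U \<and>
        Phi2 \<E> U ` tensor_sub X (und \<E>) E' M2 U \<subseteq> E' U)"

definition contains_im_psi ::
  "('x, 'r, 'k::field) krspace \<Rightarrow> ('x, 'r, 'm, 'a, 'b) adhm \<Rightarrow> ('x set \<Rightarrow> 'm set) \<Rightarrow> bool" where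
  "contains_im_psi X \<E> E' \<longleftrightarrow> (\<forall>U. opn X U \<longrightarrow> psi \<E> U ` carrier (rsec X U) \<subseteq> E' U)"

definition within_ker_phi ::
  "('x, 'r, 'k::field) krspace \<Rightarrow> ('x, 'r, 'a) omod \<Rightarrow> ('x, 'r, 'b) omod
    \<Rightarrow> ('x, 'r, 'm, 'a, 'b) adhm \<Rightarrow> ('x set \<Rightarrow> 'm set) \<Rightarrow> bool" where
  "within_ker_phi X M1 M2 \<E> E' \<longleftrightarrow>
     (\<forall>U. opn X U \<longrightarrow>
        (\<forall>t\<in>tensor_sub X (und \<E>) E' (tensor X M1 M2) U. phi \<E> U t = \<zero>\<^bsub>rsec X U\<^esub>))"

definition delta_slope ::
  "('x, 'r, 'k::field) krspace \<Rightarrow> real \<Rightarrow> ('x, 'r, 'm) omod \<Rightarrow> real" where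
  "delta_slope X \<delta> F = slope X F + \<delta> / real (rank X F)"

definition delta_stability ::
  "(real \<Rightarrow> real \<Rightarrow> bool) \<Rightarrow> ('x, 'r, 'k::field) krspace \<Rightarrow> ('x, 'r, 'a) omod \<Rightarrow> ('x, 'r, 'b) omod
    \<Rightarrow> real \<Rightarrow> ('x, 'r, 'm, 'a, 'b) adhm \<Rightarrow> bool" where
  "delta_stability cmp X M1 M2 \<delta> \<E> \<longleftrightarrow>
     adhm_sheaf X M1 M2 \<E> \<and> locally_free X (und \<E>) \<and>
     (\<exists>U. opn X U \<and> mcar (und \<E>) U \<noteq> {\<zero>\<^bsub>msec (und \<E>) U\<^esub>}) \<and>
     (\<exists>U f. opn X U \<and> f \<in> carrier (rsec X U) \<and> psi \<E> U f \<noteq> \<zero>\<^bsub>msec (und \<E>) U\<^esub>) \<and>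
     (\<forall>E'. coherent_subsheaf X (und \<E>) E' \<and> proper_nontrivial X (und \<E>) E' \<and>
        saturated X (und \<E>) E' \<and> Phi_invariant X M1 M2 \<E> E' \<longrightarrow>
        (contains_im_psi X \<E> E' \<longrightarrow>
           cmp (delta_slope X \<delta> (sub_omod (und \<E>) E')) (delta_slope X \<delta> (und \<E>))) \<and>
        (within_ker_phi X M1 M2 \<E> E' \<longrightarrow>
           cmp (slope X (sub_omod (und \<E>) E')) (delta_slope X \<delta> (und \<E>))))"

definition delta_semistable ::
  "('x, 'r, 'k::field) krspace \<Rightarrow> ('x, 'r, 'a) omod \<Rightarrow> ('x, 'r, 'b) omod
    \<Rightarrow> real \<Rightarrow> ('x, 'r, 'm, 'a, 'b) adhm \<Rightarrow> bool" where
  "delta_semistable = delta_stability (\<le>)"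

definition delta_stable ::
  "('x, 'r, 'k::field) krspace \<Rightarrow> ('x, 'r, 'a) omod \<Rightarrow> ('x, 'r, 'b) omod
    \<Rightarrow> real \<Rightarrow> ('x, 'r, 'm, 'a, 'b) adhm \<Rightarrow> bool" where
  "delta_stable = delta_stability (<)"

definition numerically_critical :: "nat \<Rightarrow> int \<Rightarrow> real set" where
  "numerically_critical r e =
     {\<delta>. \<delta> > 0 \<and> (\<exists>(r'::nat) (e'::int). 1 \<le> r' \<and> r' \<le> r - 1 \<and>
        (\<delta> = (real r * of_int e' - of_int e * real r') / real r' \<or>
         \<delta> = (of_int e * real r' - real r * of_int e') / (real r - real r')))}"

text \<open>The critical parameters lie in \<open>(1 / r!) \<int>\<close> and are unbounded, so they can be enumerated.\<close>

lemma critical_enumeration_exists: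
  assumes "r \<ge> 2"
  shows "\<exists>d :: nat \<Rightarrow> real. d 0 = 0 \<and> strict_mono d \<and> d ` {1..} = numerically_critical r e"
proof -
  define N :: nat where "N = fact r"
  have N: "N > 0" by (simp add: N_def)
  define S where "S = {k::nat. real k / real N \<in> numerically_critical r e}"
  have pos: "k > 0" if "k \<in> S" for k
    using that N by (auto simp: S_def numerically_critical_def zero_less_divide_iff)
  have quot: "\<exists>k\<in>S. \<delta> = real k / real N"
    if \<delta>: "\<delta> \<in> numerically_critical r e" for \<delta>
  proof -
    have aux: "\<exists>k\<in>S. \<delta> = real k / real N"
      if eq: "\<delta> = of_int z / real m" and m: "1 \<le> m" "m \<le> r" for z :: int and m :: nat
    proof -
      have "m dvd N" unfolding N_def using m by (simp add: dvd_fact)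
      then obtain c where c: "N = m * c" by blast
      have c0: "c > 0" using c N by (cases c) auto
      have eq2: "\<delta> = of_int (z * int c) / real N"
        using eq m c c0 by (simp add: field_simps)
      have "\<delta> > 0" using \<delta> by (simp add: numerically_critical_def)
      then have "of_int (z * int c) > (0::real)" using eq2 N by (simp add: zero_less_divide_iff)
      then have "z * int c > 0" by (simp only: of_int_0_less_iff)
      then have "\<delta> = real (nat (z * int c)) / real N" using eq2 by (simp del: of_int_mult)
      then show ?thesis using \<delta> by (auto simp: S_def)
    qed
    obtain r' :: nat and e' :: int where r': "1 \<le> r'" "r' \<le> r - 1" and
      *: "\<delta> = (real r * of_int e' - of_int e * real r') / real r' \<or>
          \<delta> = (of_int e * real r' - real r * of_int e') / (real r - real r')"
      using \<delta> by (auto simp: numerically_critical_def)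
    from * show ?thesis
    proof
      assume "\<delta> = (real r * of_int e' - of_int e * real r') / real r'"
      then show ?thesis using aux[of "int r * e' - e * int r'" r'] r' by simp
    next
      assume "\<delta> = (of_int e * real r' - real r * of_int e') / (real r - real r')"
      then show ?thesis using aux[of "e * int r' - int r * e'" "r - r'"] r' assms by (simp add: of_nat_diff)
    qed
  qed
  have inf: "infinite S"
    unfolding infinite_nat_iff_unbounded_le
  proof
    fix b :: nat
    define w where "w = \<bar>e\<bar> + int b + 1"
    define z where "z = int r * w - e"
    have "1 * w \<le> int r * w"
      using assms by (intro mult_right_mono) (auto simp: w_def)
    moreover have "w \<ge> e + int b + 1" by (simp add: w_def)
    ultimately have z: "z \<ge> int b + 1" by (simp add: z_def)
    have "real_of_int z > 0" using z by simp
    moreover have "real_of_int z = (real r * of_int w - of_int e * real 1) / real 1"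
      by (simp add: z_def)
    moreover have "1 \<le> r - 1" using assms by simp
    ultimately have "real_of_int z \<in> numerically_critical r e"
      unfolding numerically_critical_def by (intro CollectI conjI exI[of _ 1] exI[of _ w] disjI1) auto
    moreover have "real_of_int z = real (nat z * N) / real N" using z N by simp
    ultimately have "nat z * N \<in> S" unfolding S_def by (simp only: mem_Collect_eq)
    moreover have "b \<le> nat z * N"
    proof -
      have "b \<le> nat z" using z by linarith
      also have "nat z \<le> nat z * N" using N by simp
      finally show ?thesis .
    qed
    ultimately show "\<exists>n\<ge>b. n \<in> S" by blast
  qed
  define d where "d n = (case n of 0 \<Rightarrow> 0 | Suc m \<Rightarrow> real (enumerate S m) / real N)" for n
  have "strict_mono d"
  proof (rule iffD2[OF strict_mono_Suc_iff], rule allI)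
    fix n show "d n < d (Suc n)"
      using pos[OF enumerate_in_set[OF inf]] enumerate_step[OF inf] N
      by (cases n) (auto simp: d_def divide_strict_right_mono)
  qed
  moreover have "d ` {1..} = numerically_critical r e"
  proof
    show "d ` {1..} \<subseteq> numerically_critical r e"
      using enumerate_in_set[OF inf] by (auto simp: d_def S_def split: nat.split)
    show "numerically_critical r e \<subseteq> d ` {1..}"
    proof
      fix \<delta> assume "\<delta> \<in> numerically_critical r e"
      then obtain k where k: "k \<in> S" "\<delta> = real k / real N" using quot by blast
      obtain m where "enumerate S m = k" using enumerate_Ex[OF inf k(1)] by blast
      then have "\<delta> = d (Suc m)" using k by (simp add: d_def)
      then show "\<delta> \<in> d ` {1..}" by auto
    qed
  qed
  ultimately show ?thesis by (intro exI[of _ d]) (simp add: d_def)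
qed

end

theory Submission
  imports Defs "HOL-Algebra.Multiplicative_Group"
begin

text \<open>
  For fixed \<open>E'\<close> of rank \<open>r' < r\<close> and degree \<open>e'\<close> both sides of the stability inequalities are affine in
  \<open>\<delta>\<close>, and they agree exactly when \<open>\<delta>\<close> is one of the two critical values attached to \<open>(r', e')\<close>. So between
  consecutive critical parameters equality never occurs and no inequality changes sign.

  The geometric input is \<open>r' < r\<close>. The stalk of the structure sheaf at the generic point \<open>\<eta>\<close> is a field, and
  the map from the stalk of \<open>E'\<close> to that of \<open>E\<close> at \<open>\<eta>\<close> is linear and injective. If it were surjective, then near any point \<open>x\<close>
  a section \<open>s\<close> of \<open>E\<close> would satisfy \<open>b s \<in> E'\<close> for some \<open>b \<noteq> 0\<close> (clear the denominators of its
  coefficients at \<open>\<eta>\<close> with respect to local generators of \<open>E'\<close>), hence \<open>s \<in> E'\<close> by saturation, and \<open>E'\<close>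
  would not be proper.
\<close>

section \<open>Germs\<close>

text \<open>The degree of \<open>E'\<close> enters the numerics only as an integer: the critical set
  admits every integer \<open>e'\<close>, so the geometry is confined to the rank. The obstacle
  there is the passage from the generic point to an arbitrary point \<open>x\<close>: an identity
  known near \<eta> holds on a nonempty open set that may avoid \<open>x\<close>. It is carried to a
  neighbourhood of \<open>x\<close> by injectivity of restriction to nonempty open subsets, for
  functions and, through local frames, for sections of a locally free sheaf. The source of this is
  that in the spectrum of a domain the zero ideal lies in every nonempty open set, so a fraction
  that vanishes on some nonempty open set has numerator zero. For the same transfer the denominators
  have to be functions on an affine open set containing \<open>x\<close>, not merely germs at
  \<eta>. Germs are sets of representatives and stalks are records built from them, so the ring and
  module laws of the stalks are established before linear algebra is applied at \<eta>.\<close>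

lemma presheaf_closed:
  assumes "presheaf T F \<rho>" "openin T U" "openin T V" "V \<subseteq> U" "s \<in> F U"
  shows "\<rho> U V s \<in> F V"
proof -
  have "\<rho> U V \<in> F U \<rightarrow> F V" using assms(1-4) unfolding presheaf_def by simp
  then show ?thesis using assms(5) by (rule funcset_mem)
qed

lemma presheaf_comp:
  assumes "presheaf T F \<rho>" "openin T U" "openin T V" "openin T W" "W \<subseteq> V" "V \<subseteq> U" "s \<in> F U"
  shows "\<rho> V W (\<rho> U V s) = \<rho> U W s"
  using assms unfolding presheaf_def by simp

text \<open>A germ is the set of all its representatives, so this is an equality of sets. The
  inclusion \<open>*\<close> is transitivity of agreement near \<open>x\<close>: agreement on
  \<open>W\<close> and on \<open>W'\<close> combines on \<open>W \<inter> W'\<close>. It is used in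
  both directions.\<close>

lemma germ_eqI:
  assumes P: "presheaf T F \<rho>"
    and U: "openin T U" "s \<in> F U" and V: "openin T V" "t \<in> F V"
    and W: "openin T W" "x \<in> W" "W \<subseteq> U" "W \<subseteq> V" "\<rho> U W s = \<rho> V W t"
  shows "germ T F \<rho> x U s = germ T F \<rho> x V t"
proof -
  have *: "germ T F \<rho> x U s \<subseteq> germ T F \<rho> x V t"
    if U: "openin T U" "s \<in> F U" and V: "openin T V" "t \<in> F V"
    and W: "W \<subseteq> U" "W \<subseteq> V" "\<rho> U W s = \<rho> V W t"
    for U V s t
  proof
    fix z assume z: "z \<in> germ T F \<rho> x U s"
    obtain V' t' where z_eq: "z = (V', t')" by (cases z)
    from z z_eq obtain W' where V': "openin T V'" "x \<in> V'" "t' \<in> F V'"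
      and W': "openin T W'" "x \<in> W'" "W' \<subseteq> U \<inter> V'" "\<rho> U W' s = \<rho> V' W' t'"
      unfolding germ_def by blast
    let ?Z = "W \<inter> W'"
    have Z: "openin T ?Z" using \<open>openin T W\<close> W' by blast
    have "\<rho> V ?Z t = \<rho> W ?Z (\<rho> V W t)"
      using presheaf_comp[OF P V(1) \<open>openin T W\<close> Z] W V by simp
    also have "\<dots> = \<rho> U ?Z s"
      using presheaf_comp[OF P U(1) \<open>openin T W\<close> Z] W U by (metis inf_le1)
    also have "\<dots> = \<rho> W' ?Z (\<rho> U W' s)"
      using presheaf_comp[OF P U(1) W'(1) Z _ _ U(2)] W'(3) by simp
    also have "\<dots> = \<rho> V' ?Z t'"
      using presheaf_comp[OF P V'(1) W'(1) Z] W' V' by (metis inf_le2 le_inf_iff)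
    finally have "\<rho> V ?Z t = \<rho> V' ?Z t'" .
    then show "z \<in> germ T F \<rho> x V t"
      unfolding germ_def z_eq using V' Z W W' \<open>x \<in> W\<close> by blast
  qed
  show ?thesis using *[OF U V W(3-5)] *[OF V U W(4,3) W(5)[symmetric]] by blast
qed

lemma mem_germ_self:
  assumes "openin T U" "x \<in> U" "s \<in> F U"
  shows "(U, s) \<in> germ T F \<rho> x U s"
  using assms unfolding germ_def by blast

lemma germ_eqD:
  assumes "germ T F \<rho> x U s = germ T F \<rho> x V t"
    and "openin T V" "x \<in> V" "t \<in> F V"
  obtains W where "openin T W" "x \<in> W" "W \<subseteq> U" "W \<subseteq> V" "\<rho> U W s = \<rho> V W t"
proof -
  have "(V, t) \<in> germ T F \<rho> x U s"
    unfolding assms(1) using mem_germ_self assms(2-4) by fast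
  then show thesis using that unfolding germ_def by blast
qed

lemma germ_restrict:
  assumes "presheaf T F \<rho>" "openin T U" "openin T V" "x \<in> V" "V \<subseteq> U" "s \<in> F U"
  shows "germ T F \<rho> x V (\<rho> U V s) = germ T F \<rho> x U s"
  using assms
  by (intro germ_eqI[where W = V]) (auto simp: presheaf_comp presheaf_closed)

lemma germ_in_germs:
  "openin T U \<Longrightarrow> x \<in> U \<Longrightarrow> s \<in> F U \<Longrightarrow> germ T F \<rho> x U s \<in> germs T F \<rho> x"
  unfolding germs_def by blast

text \<open>Ring and module laws involve up to three germs. They are checked by moving all of them
  to one open set, where the law holds for sections. Three independent presheaves allow scalars and
  vectors to be mixed.\<close>

lemma germs_common3:
  assumes P: "presheaf T F \<rho>" "presheaf T G \<sigma>" "presheaf T H \<tau>"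
    and "A \<in> germs T F \<rho> x" "B \<in> germs T G \<sigma> x" "C \<in> germs T H \<tau> x"
  obtains W a b c where "openin T W" "x \<in> W" "a \<in> F W" "b \<in> G W" "c \<in> H W"
    "A = germ T F \<rho> x W a" "B = germ T G \<sigma> x W b" "C = germ T H \<tau> x W c"
proof -
  obtain U a where U: "openin T U" "x \<in> U" "a \<in> F U" "A = germ T F \<rho> x U a"
    using assms unfolding germs_def by blast
  obtain V b where V: "openin T V" "x \<in> V" "b \<in> G V" "B = germ T G \<sigma> x V b"
    using assms unfolding germs_def by blast
  obtain Z c where Z: "openin T Z" "x \<in> Z" "c \<in> H Z" "C = germ T H \<tau> x Z c"
    using assms unfolding germs_def by blast
  let ?W = "U \<inter> V \<inter> Z"
  have W: "openin T ?W" "x \<in> ?W" "?W \<subseteq> U" "?W \<subseteq> V" "?W \<subseteq> Z" using U V Z by auto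
  show thesis
  proof (rule that[OF W(1,2)])
    show "A = germ T F \<rho> x ?W (\<rho> U ?W a)"
      using germ_restrict[OF P(1) U(1) W(1,2,3) U(3)] U by simp
    show "B = germ T G \<sigma> x ?W (\<sigma> V ?W b)"
      using germ_restrict[OF P(2) V(1) W(1,2,4) V(3)] V by simp
    show "C = germ T H \<tau> x ?W (\<tau> Z ?W c)"
      using germ_restrict[OF P(3) Z(1) W(1,2,5) Z(3)] Z by simp
    show "\<rho> U ?W a \<in> F ?W" using presheaf_closed[OF P(1) U(1) W(1,3) U(3)] .
    show "\<sigma> V ?W b \<in> G ?W" using presheaf_closed[OF P(2) V(1) W(1,4) V(3)] .
    show "\<tau> Z ?W c \<in> H ?W" using presheaf_closed[OF P(3) Z(1) W(1,5) Z(3)] .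
  qed
qed

text \<open>Operations on classes are defined as unions over all representatives. Such a union is
  evaluated by exhibiting one pair and showing that every pair gives the same set.\<close>

lemma UN_UN_const:
  assumes "(a, s) \<in> A" "(b, t) \<in> B"
    and "\<And>a s b t. (a, s) \<in> A \<Longrightarrow> (b, t) \<in> B \<Longrightarrow> f a s b t = C"
  shows "(\<Union>(a, s)\<in>A. \<Union>(b, t)\<in>B. f a s b t) = C"
  using assms by (auto 0 3)

text \<open>Independence of representatives: other representatives agree with \<open>s\<close> and
  \<open>t\<close> on \<open>W1 \<inter> W2\<close>, and compatibility of \<open>f\<close> with
  restriction turns this into agreement of the values of \<open>f\<close>. Stalk operations are then
  computed on sections over one open set.\<close>

lemma germ_lift2_germ:
  assumes P: "presheaf T F \<rho>" "presheaf T G \<sigma>" "presheaf T H \<tau>"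
    and cl: "\<And>U s t. openin T U \<Longrightarrow> s \<in> F U \<Longrightarrow> t \<in> G U \<Longrightarrow> f U s t \<in> H U"
    and res: "\<And>U V s t. openin T U \<Longrightarrow> openin T V \<Longrightarrow> V \<subseteq> U \<Longrightarrow> s \<in> F U \<Longrightarrow> t \<in> G U \<Longrightarrow>
                \<tau> U V (f U s t) = f V (\<rho> U V s) (\<sigma> U V t)"
    and U: "openin T U" "x \<in> U" "s \<in> F U" "t \<in> G U"
  shows "germ_lift2 T \<rho> \<sigma> H \<tau> f x (germ T F \<rho> x U s) (germ T G \<sigma> x U t) = germ T H \<tau> x U (f U s t)"
proof -
  have *: "germ T H \<tau> x (U1 \<inter> V1) (f (U1 \<inter> V1) (\<rho> U1 (U1 \<inter> V1) s1) (\<sigma> V1 (U1 \<inter> V1) t1)) =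
      germ T H \<tau> x U (f U s t)"
    if "(U1, s1) \<in> germ T F \<rho> x U s" "(V1, t1) \<in> germ T G \<sigma> x U t" for U1 s1 V1 t1
  proof -
    from that(1) obtain W1 where U1: "openin T U1" "x \<in> U1" "s1 \<in> F U1"
      and W1: "openin T W1" "x \<in> W1" "W1 \<subseteq> U" "W1 \<subseteq> U1" "\<rho> U W1 s = \<rho> U1 W1 s1"
      unfolding germ_def by blast
    from that(2) obtain W2 where V1: "openin T V1" "x \<in> V1" "t1 \<in> G V1"
      and W2: "openin T W2" "x \<in> W2" "W2 \<subseteq> U" "W2 \<subseteq> V1" "\<sigma> U W2 t = \<sigma> V1 W2 t1"
      unfolding germ_def by blast
    let ?Z = "W1 \<inter> W2" and ?Y = "U1 \<inter> V1"
    have Z: "openin T ?Z" "x \<in> ?Z" and Y: "openin T ?Y" "?Z \<subseteq> ?Y" using W1 W2 U1 V1 by auto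
    have s1: "\<rho> U1 ?Y s1 \<in> F ?Y" using presheaf_closed[OF P(1) U1(1) Y(1) _ U1(3)] by simp
    have t1: "\<sigma> V1 ?Y t1 \<in> G ?Y" using presheaf_closed[OF P(2) V1(1) Y(1) _ V1(3)] by simp
    have "\<rho> U ?Z s = \<rho> U1 ?Z s1"
      using presheaf_comp[OF P(1) U(1) W1(1) Z(1) _ W1(3) U(3)]
        presheaf_comp[OF P(1) U1(1) W1(1) Z(1) _ W1(4) U1(3)] W1(5) by simp
    moreover have "\<sigma> U ?Z t = \<sigma> V1 ?Z t1"
      using presheaf_comp[OF P(2) U(1) W2(1) Z(1) _ W2(3) U(4)]
        presheaf_comp[OF P(2) V1(1) W2(1) Z(1) _ W2(4) V1(3)] W2(5) by simp
    moreover have "\<rho> ?Y ?Z (\<rho> U1 ?Y s1) = \<rho> U1 ?Z s1"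
      using presheaf_comp[OF P(1) U1(1) Y(1) Z(1) Y(2) _ U1(3)] by simp
    moreover have "\<sigma> ?Y ?Z (\<sigma> V1 ?Y t1) = \<sigma> V1 ?Z t1"
      using presheaf_comp[OF P(2) V1(1) Y(1) Z(1) Y(2) _ V1(3)] by simp
    ultimately have eq: "\<tau> ?Y ?Z (f ?Y (\<rho> U1 ?Y s1) (\<sigma> V1 ?Y t1)) = \<tau> U ?Z (f U s t)"
      using res[OF Y(1) Z(1) Y(2) s1 t1] res[OF U(1) Z(1) le_infI1[OF W1(3)] U(3,4)] by simp
    show ?thesis
      by (rule germ_eqI[OF P(3) Y(1) cl[OF Y(1) s1 t1] U(1) cl[OF U(1,3,4)] Z Y(2) _ eq])
        (use W1 in auto)
  qed
  show ?thesis
    unfolding germ_lift2_def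
    by (rule UN_UN_const[OF mem_germ_self[where F = F, OF U(1,2,3)] mem_germ_self[where F = G, OF U(1,2,4)]])
      (rule *)
qed

lemma sheaf_presheaf: "sheaf T F \<rho> \<Longrightarrow> presheaf T F \<rho>"
  unfolding sheaf_def by blast

lemma sheaf_glue:
  assumes "sheaf T F \<rho>" "\<And>U. U \<in> \<U> \<Longrightarrow> openin T U" "\<And>U. U \<in> \<U> \<Longrightarrow> s U \<in> F U"
    "\<And>U V. U \<in> \<U> \<Longrightarrow> V \<in> \<U> \<Longrightarrow> \<rho> U (U \<inter> V) (s U) = \<rho> V (U \<inter> V) (s V)"
  shows "\<exists>!t. t \<in> F (\<Union>\<U>) \<and> (\<forall>U\<in>\<U>. \<rho> (\<Union>\<U>) U t = s U)"
proof -
  have "(\<forall>U\<in>\<U>. openin T U \<and> s U \<in> F U) \<and>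
      (\<forall>U\<in>\<U>. \<forall>V\<in>\<U>. \<rho> U (U \<inter> V) (s U) = \<rho> V (U \<inter> V) (s V))"
    by (intro conjI ballI assms)
  with assms(1) show ?thesis unfolding sheaf_def by (elim conjE allE[of _ \<U>] allE[of _ s] impE) simp_all
qed

text \<open>This is the uniqueness half of gluing: \<open>s\<close> and \<open>t\<close> both glue
  the restrictions of \<open>s\<close> to all open sets on which the two agree, and by
  \<open>loc\<close> these sets cover \<open>V\<close>.\<close>

lemma sheaf_separated:
  assumes S: "sheaf T F \<rho>" and V: "openin T V" and st: "s \<in> F V" "t \<in> F V"
    and loc: "\<And>y. y \<in> V \<Longrightarrow> \<exists>W. openin T W \<and> y \<in> W \<and> W \<subseteq> V \<and> \<rho> V W s = \<rho> V W t"
  shows "s = t"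
proof -
  let ?U = "{W. openin T W \<and> W \<subseteq> V \<and> \<rho> V W s = \<rho> V W t}"
  note P = sheaf_presheaf[OF S]
  have un: "\<Union>?U = V" using loc by blast
  have "\<exists>!t'. t' \<in> F (\<Union>?U) \<and> (\<forall>U\<in>?U. \<rho> (\<Union>?U) U t' = \<rho> V U s)"
  proof (rule sheaf_glue[OF S])
    fix U W assume UW: "U \<in> ?U" "W \<in> ?U"
    have "\<rho> U (U \<inter> W) (\<rho> V U s) = \<rho> V (U \<inter> W) s"
      using UW by (intro presheaf_comp[OF P V _ _ _ _ st(1)]) auto
    moreover have "\<rho> W (U \<inter> W) (\<rho> V W s) = \<rho> V (U \<inter> W) s"
      using UW by (intro presheaf_comp[OF P V _ _ _ _ st(1)]) auto
    ultimately show "\<rho> U (U \<inter> W) (\<rho> V U s) = \<rho> W (U \<inter> W) (\<rho> V W s)" by simp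
  next
    fix U assume "U \<in> ?U"
    then show "openin T U" "\<rho> V U s \<in> F U"
      using presheaf_closed[OF P V _ _ st(1)] by blast+
  qed
  then have uniq: "\<exists>!t'. t' \<in> F V \<and> (\<forall>U\<in>?U. \<rho> V U t' = \<rho> V U s)" unfolding un .
  have "s \<in> F V \<and> (\<forall>U\<in>?U. \<rho> V U s = \<rho> V U s)" "t \<in> F V \<and> (\<forall>U\<in>?U. \<rho> V U t = \<rho> V U s)"
    using st by auto
  then show ?thesis using uniq by blast
qed

text \<open>Over the empty set the local condition for equality is vacuous. The lemma supplies
  compatibility on empty overlaps.\<close>

lemma sheaf_empty:
  assumes "sheaf T F \<rho>" "s \<in> F {}" "t \<in> F {}"
  shows "s = t"
  using sheaf_separated[OF assms(1) openin_empty assms(2,3)] by simp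


section \<open>Stalks\<close>

locale ringed =
  fixes X :: "('x, 'r, 'z) rspace_scheme"
  assumes ringed: "ringed_space X"
begin

lemma rsec_sheaf: "sheaf (topo X) (\<lambda>U. carrier (rsec X U)) (rres X)"
  using ringed unfolding ringed_space_def by blast

lemmas rsec_presheaf = sheaf_presheaf[OF rsec_sheaf]

lemma rsec_cring: "opn X U \<Longrightarrow> cring (rsec X U)"
  using ringed unfolding ringed_space_def by blast

lemma rres_hom:
  "opn X U \<Longrightarrow> opn X V \<Longrightarrow> V \<subseteq> U \<Longrightarrow> rres X U V \<in> Ring.ring_hom (rsec X U) (rsec X V)"
  using ringed unfolding ringed_space_def by blast

lemma rres_closed:
  "opn X U \<Longrightarrow> opn X V \<Longrightarrow> V \<subseteq> U \<Longrightarrow> a \<in> carrier (rsec X U) \<Longrightarrow> rres X U V a \<in> carrier (rsec X V)"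
  using presheaf_closed[OF rsec_presheaf] .

lemma rres_comp:
  "opn X U \<Longrightarrow> opn X V \<Longrightarrow> opn X W \<Longrightarrow> W \<subseteq> V \<Longrightarrow> V \<subseteq> U \<Longrightarrow> a \<in> carrier (rsec X U) \<Longrightarrow>
   rres X V W (rres X U V a) = rres X U W a"
  using presheaf_comp[OF rsec_presheaf] .

lemma rres_mult:
  "opn X U \<Longrightarrow> opn X V \<Longrightarrow> V \<subseteq> U \<Longrightarrow> a \<in> carrier (rsec X U) \<Longrightarrow> b \<in> carrier (rsec X U) \<Longrightarrow>
   rres X U V (a \<otimes>\<^bsub>rsec X U\<^esub> b) = rres X U V a \<otimes>\<^bsub>rsec X V\<^esub> rres X U V b"
  using ring_hom_mult[OF rres_hom] .

lemma rres_add: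
  "opn X U \<Longrightarrow> opn X V \<Longrightarrow> V \<subseteq> U \<Longrightarrow> a \<in> carrier (rsec X U) \<Longrightarrow> b \<in> carrier (rsec X U) \<Longrightarrow>
   rres X U V (a \<oplus>\<^bsub>rsec X U\<^esub> b) = rres X U V a \<oplus>\<^bsub>rsec X V\<^esub> rres X U V b"
  using ring_hom_add[OF rres_hom] .

lemma rres_one:
  "opn X U \<Longrightarrow> opn X V \<Longrightarrow> V \<subseteq> U \<Longrightarrow> rres X U V \<one>\<^bsub>rsec X U\<^esub> = \<one>\<^bsub>rsec X V\<^esub>"
  using ring_hom_one[OF rres_hom] .

lemma rres_zero:
  "opn X U \<Longrightarrow> opn X V \<Longrightarrow> V \<subseteq> U \<Longrightarrow> rres X U V \<zero>\<^bsub>rsec X U\<^esub> = \<zero>\<^bsub>rsec X V\<^esub>"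
  using ring_hom_zero[OF rres_hom] rsec_cring cring.axioms(1) by blast

lemma stalk_simps:
  assumes "opn X U" "x \<in> U" "a \<in> carrier (rsec X U)" "b \<in> carrier (rsec X U)"
  shows "rgerm X x U a \<otimes>\<^bsub>stalk X x\<^esub> rgerm X x U b = rgerm X x U (a \<otimes>\<^bsub>rsec X U\<^esub> b)"
    and "rgerm X x U a \<oplus>\<^bsub>stalk X x\<^esub> rgerm X x U b = rgerm X x U (a \<oplus>\<^bsub>rsec X U\<^esub> b)"
proof -
  have "monoid (rsec X V)" "abelian_monoid (rsec X V)" if "opn X V" for V
    using rsec_cring[OF that]
    by (simp_all add: cring_def ring_def abelian_group_def)
  then show "rgerm X x U a \<otimes>\<^bsub>stalk X x\<^esub> rgerm X x U b = rgerm X x U (a \<otimes>\<^bsub>rsec X U\<^esub> b)"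
    "rgerm X x U a \<oplus>\<^bsub>stalk X x\<^esub> rgerm X x U b = rgerm X x U (a \<oplus>\<^bsub>rsec X U\<^esub> b)"
    unfolding rgerm_def stalk_def monoid.simps ring.simps
    by (intro germ_lift2_germ rsec_presheaf assms;
        auto simp: rres_mult rres_add intro: monoid.m_closed abelian_monoid.a_closed)+
qed

text \<open>The stalk takes its constants from the whole space; calculations with representatives
  over \<open>U\<close> need them over \<open>U\<close>.\<close>

lemma stalk_const:
  assumes "opn X U" "x \<in> U"
  shows "\<one>\<^bsub>stalk X x\<^esub> = rgerm X x U \<one>\<^bsub>rsec X U\<^esub>" "\<zero>\<^bsub>stalk X x\<^esub> = rgerm X x U \<zero>\<^bsub>rsec X U\<^esub>"
proof -
  have U: "U \<subseteq> pts X" using assms openin_subset by blast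
  interpret P: cring "rsec X (pts X)" by (rule rsec_cring) simp
  show "\<one>\<^bsub>stalk X x\<^esub> = rgerm X x U \<one>\<^bsub>rsec X U\<^esub>"
    using germ_restrict[OF rsec_presheaf _ assms U P.one_closed] rres_one[OF _ assms(1) U]
    by (simp add: stalk_def rgerm_def)
  show "\<zero>\<^bsub>stalk X x\<^esub> = rgerm X x U \<zero>\<^bsub>rsec X U\<^esub>"
    using germ_restrict[OF rsec_presheaf _ assms U P.zero_closed] rres_zero[OF _ assms(1) U]
    by (simp add: stalk_def rgerm_def)
qed

lemma rgerm_closed:
  "opn X U \<Longrightarrow> x \<in> U \<Longrightarrow> a \<in> carrier (rsec X U) \<Longrightarrow> rgerm X x U a \<in> carrier (stalk X x)"
  unfolding stalk_def rgerm_def by (simp add: germ_in_germs)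

lemma rgerm_restrict:
  "opn X U \<Longrightarrow> opn X V \<Longrightarrow> x \<in> V \<Longrightarrow> V \<subseteq> U \<Longrightarrow> a \<in> carrier (rsec X U) \<Longrightarrow>
   rgerm X x V (rres X U V a) = rgerm X x U a"
  unfolding rgerm_def using germ_restrict[OF rsec_presheaf] .

lemma rgerm_eqD:
  assumes "rgerm X x U a = rgerm X x V b" "opn X V" "x \<in> V" "b \<in> carrier (rsec X V)"
  obtains W where "opn X W" "x \<in> W" "W \<subseteq> U" "W \<subseteq> V" "rres X U W a = rres X V W b"
  using germ_eqD[OF assms(1)[unfolded rgerm_def] assms(2-4)] .

lemma stalk_rep3:
  assumes "A \<in> carrier (stalk X x)" "B \<in> carrier (stalk X x)" "C \<in> carrier (stalk X x)"
  obtains W a b c where "opn X W" "x \<in> W"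
    "a \<in> carrier (rsec X W)" "b \<in> carrier (rsec X W)" "c \<in> carrier (rsec X W)"
    "A = rgerm X x W a" "B = rgerm X x W b" "C = rgerm X x W c"
  by (rule germs_common3[OF rsec_presheaf rsec_presheaf rsec_presheaf assms[unfolded stalk_def mstalk_def partial_object.simps]])
    (rule that[unfolded rgerm_def mgerm_def], assumption+)

lemma stalk_rep:
  assumes "A \<in> carrier (stalk X x)"
  obtains W a where "opn X W" "x \<in> W" "a \<in> carrier (rsec X W)" "A = rgerm X x W a"
  using stalk_rep3[OF assms assms assms] by metis

text \<open>Every law is inherited from a section ring: the germs are represented over a common
  neighbourhood, and \<open>stalk_simps\<close> moves the operations to sections.\<close>

lemma stalk_cring:
  assumes x: "x \<in> pts X"
  shows "cring (stalk X x)"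
proof (rule cringI)
  have one: "\<one>\<^bsub>stalk X x\<^esub> \<in> carrier (stalk X x)" and zero: "\<zero>\<^bsub>stalk X x\<^esub> \<in> carrier (stalk X x)"
    using stalk_const[of "pts X"] x rgerm_closed[of "pts X"] rsec_cring[of "pts X"]
    by (auto simp: cring.cring_simprules)
  show "abelian_group (stalk X x)"
  proof (rule abelian_groupI)
    fix A B C assume "A \<in> carrier (stalk X x)" "B \<in> carrier (stalk X x)" "C \<in> carrier (stalk X x)"
    from stalk_rep3[OF this] obtain W a b c where W: "opn X W" "x \<in> W"
      and abc: "a \<in> carrier (rsec X W)" "b \<in> carrier (rsec X W)" "c \<in> carrier (rsec X W)"
      "A = rgerm X x W a" "B = rgerm X x W b" "C = rgerm X x W c" .
    interpret cring "rsec X W" by (rule rsec_cring[OF W(1)])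
    show "A \<oplus>\<^bsub>stalk X x\<^esub> B \<oplus>\<^bsub>stalk X x\<^esub> C = A \<oplus>\<^bsub>stalk X x\<^esub> (B \<oplus>\<^bsub>stalk X x\<^esub> C)"
      using abc by (simp add: stalk_simps W a_assoc)
  next
    fix A B assume "A \<in> carrier (stalk X x)" "B \<in> carrier (stalk X x)"
    from stalk_rep3[OF this this(2)] obtain W a b where W: "opn X W" "x \<in> W"
      and ab: "a \<in> carrier (rsec X W)" "b \<in> carrier (rsec X W)"
      "A = rgerm X x W a" "B = rgerm X x W b" by metis
    interpret cring "rsec X W" by (rule rsec_cring[OF W(1)])
    show "A \<oplus>\<^bsub>stalk X x\<^esub> B = B \<oplus>\<^bsub>stalk X x\<^esub> A" "A \<oplus>\<^bsub>stalk X x\<^esub> B \<in> carrier (stalk X x)"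
      using ab by (simp_all add: stalk_simps W a_comm rgerm_closed)
  next
    fix A assume "A \<in> carrier (stalk X x)"
    from stalk_rep[OF this] obtain W a where W: "opn X W" "x \<in> W"
      and a: "a \<in> carrier (rsec X W)" "A = rgerm X x W a" .
    interpret cring "rsec X W" by (rule rsec_cring[OF W(1)])
    show "\<zero>\<^bsub>stalk X x\<^esub> \<oplus>\<^bsub>stalk X x\<^esub> A = A"
      using a by (simp add: stalk_simps W stalk_const[OF W])
    show "\<exists>B\<in>carrier (stalk X x). B \<oplus>\<^bsub>stalk X x\<^esub> A = \<zero>\<^bsub>stalk X x\<^esub>"
      using a by (intro bexI[of _ "rgerm X x W (\<ominus>\<^bsub>rsec X W\<^esub> a)"])
        (simp_all add: stalk_simps W stalk_const[OF W] l_neg rgerm_closed)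
  qed (fact zero)
  show "Group.comm_monoid (stalk X x)"
  proof (rule comm_monoidI)
    fix A B C assume "A \<in> carrier (stalk X x)" "B \<in> carrier (stalk X x)" "C \<in> carrier (stalk X x)"
    from stalk_rep3[OF this] obtain W a b c where W: "opn X W" "x \<in> W"
      and abc: "a \<in> carrier (rsec X W)" "b \<in> carrier (rsec X W)" "c \<in> carrier (rsec X W)"
      "A = rgerm X x W a" "B = rgerm X x W b" "C = rgerm X x W c" .
    interpret cring "rsec X W" by (rule rsec_cring[OF W(1)])
    show "A \<otimes>\<^bsub>stalk X x\<^esub> B \<otimes>\<^bsub>stalk X x\<^esub> C = A \<otimes>\<^bsub>stalk X x\<^esub> (B \<otimes>\<^bsub>stalk X x\<^esub> C)"
      using abc by (simp add: stalk_simps W m_assoc)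
  next
    fix A B assume "A \<in> carrier (stalk X x)" "B \<in> carrier (stalk X x)"
    from stalk_rep3[OF this this(2)] obtain W a b where W: "opn X W" "x \<in> W"
      and ab: "a \<in> carrier (rsec X W)" "b \<in> carrier (rsec X W)"
      "A = rgerm X x W a" "B = rgerm X x W b" by metis
    interpret cring "rsec X W" by (rule rsec_cring[OF W(1)])
    show "A \<otimes>\<^bsub>stalk X x\<^esub> B = B \<otimes>\<^bsub>stalk X x\<^esub> A" "A \<otimes>\<^bsub>stalk X x\<^esub> B \<in> carrier (stalk X x)"
      using ab by (simp_all add: stalk_simps W m_comm rgerm_closed)
  next
    fix A assume "A \<in> carrier (stalk X x)"
    from stalk_rep[OF this] obtain W a where W: "opn X W" "x \<in> W"
      and a: "a \<in> carrier (rsec X W)" "A = rgerm X x W a" .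
    interpret cring "rsec X W" by (rule rsec_cring[OF W(1)])
    show "\<one>\<^bsub>stalk X x\<^esub> \<otimes>\<^bsub>stalk X x\<^esub> A = A"
      using a by (simp add: stalk_simps W stalk_const[OF W])
  qed (fact one)
  fix A B C assume "A \<in> carrier (stalk X x)" "B \<in> carrier (stalk X x)" "C \<in> carrier (stalk X x)"
  from stalk_rep3[OF this] obtain W a b c where W: "opn X W" "x \<in> W"
    and abc: "a \<in> carrier (rsec X W)" "b \<in> carrier (rsec X W)" "c \<in> carrier (rsec X W)"
    "A = rgerm X x W a" "B = rgerm X x W b" "C = rgerm X x W c" .
  interpret cring "rsec X W" by (rule rsec_cring[OF W(1)])
  show "(A \<oplus>\<^bsub>stalk X x\<^esub> B) \<otimes>\<^bsub>stalk X x\<^esub> C = A \<otimes>\<^bsub>stalk X x\<^esub> C \<oplus>\<^bsub>stalk X x\<^esub> B \<otimes>\<^bsub>stalk X x\<^esub> C"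
    using abc by (simp add: stalk_simps W l_distr)
qed

end

section \<open>Sheaves of modules and their stalks\<close>

locale module_sheaf = ringed X for X :: "('x, 'r, 'z) rspace_scheme" +
  fixes F :: "('x, 'r, 'm) omod"
  assumes omod: "is_omod X F"
begin

lemma msec_sheaf: "sheaf (topo X) (mcar F) (mres F)"
  using omod unfolding is_omod_def by blast

lemmas msec_presheaf = sheaf_presheaf[OF msec_sheaf]

lemma msec_module: "opn X U \<Longrightarrow> module (rsec X U) (msec F U)"
  using omod unfolding is_omod_def by blast

lemma mres_closed:
  "opn X U \<Longrightarrow> opn X V \<Longrightarrow> V \<subseteq> U \<Longrightarrow> s \<in> mcar F U \<Longrightarrow> mres F U V s \<in> mcar F V"
  using presheaf_closed[OF msec_presheaf] .

lemma mres_comp: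
  "opn X U \<Longrightarrow> opn X V \<Longrightarrow> opn X W \<Longrightarrow> W \<subseteq> V \<Longrightarrow> V \<subseteq> U \<Longrightarrow> s \<in> mcar F U \<Longrightarrow>
   mres F V W (mres F U V s) = mres F U W s"
  using presheaf_comp[OF msec_presheaf] .

lemma mres_add:
  "opn X U \<Longrightarrow> opn X V \<Longrightarrow> V \<subseteq> U \<Longrightarrow> s \<in> mcar F U \<Longrightarrow> t \<in> mcar F U \<Longrightarrow>
   mres F U V (s \<oplus>\<^bsub>msec F U\<^esub> t) = mres F U V s \<oplus>\<^bsub>msec F V\<^esub> mres F U V t"
  using omod unfolding is_omod_def by simp

lemma mres_smult:
  "opn X U \<Longrightarrow> opn X V \<Longrightarrow> V \<subseteq> U \<Longrightarrow> a \<in> carrier (rsec X U) \<Longrightarrow> s \<in> mcar F U \<Longrightarrow>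
   mres F U V (a \<odot>\<^bsub>msec F U\<^esub> s) = rres X U V a \<odot>\<^bsub>msec F V\<^esub> mres F U V s"
  using omod unfolding is_omod_def by simp

text \<open>Zero is a multiple by the scalar zero, so compatibility of restriction with scalars
  forces it to be preserved.\<close>

lemma mres_zero:
  assumes "opn X U" "opn X V" "V \<subseteq> U"
  shows "mres F U V \<zero>\<^bsub>msec F U\<^esub> = \<zero>\<^bsub>msec F V\<^esub>"
proof -
  interpret U: module "rsec X U" "msec F U" by (rule msec_module[OF assms(1)])
  interpret V: module "rsec X V" "msec F V" by (rule msec_module[OF assms(2)])
  have "mres F U V (\<zero>\<^bsub>rsec X U\<^esub> \<odot>\<^bsub>msec F U\<^esub> \<zero>\<^bsub>msec F U\<^esub>) =
      \<zero>\<^bsub>rsec X V\<^esub> \<odot>\<^bsub>msec F V\<^esub> mres F U V \<zero>\<^bsub>msec F U\<^esub>"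
    using mres_smult[OF assms U.R.zero_closed U.M.zero_closed] by (simp only: rres_zero[OF assms])
  then show ?thesis using mres_closed[OF assms U.M.zero_closed] by simp
qed

lemma mres_finsum:
  assumes U: "opn X U" "opn X V" "V \<subseteq> U" and f: "f \<in> {..<n::nat} \<rightarrow> mcar F U"
  shows "mres F U V (finsum (msec F U) f {..<n}) = finsum (msec F V) (\<lambda>i. mres F U V (f i)) {..<n}"
  using f
proof (induction n)
  case 0
  interpret U: module "rsec X U" "msec F U" by (rule msec_module[OF U(1)])
  interpret V: module "rsec X V" "msec F V" by (rule msec_module[OF U(2)])
  show ?case by (simp add: mres_zero U)
next
  case (Suc n)
  interpret U: module "rsec X U" "msec F U" by (rule msec_module[OF U(1)])
  interpret V: module "rsec X V" "msec F V" by (rule msec_module[OF U(2)])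
  have f: "f \<in> {..<n} \<rightarrow> mcar F U" "f n \<in> mcar F U" using Suc.prems by auto
  have "(\<lambda>i. mres F U V (f i)) \<in> {..<n} \<rightarrow> mcar F V" using f(1) mres_closed[OF U] by blast
  then show ?case
    using f Suc.IH[OF f(1)]
    by (simp add: lessThan_Suc U.M.finsum_insert V.M.finsum_insert mres_add U mres_closed)
qed

lemma lin_comb_closed:
  assumes "opn X U" "opn X V" "V \<subseteq> U" "a \<in> {..<n} \<rightarrow> carrier (rsec X V)" "s \<in> {..<n} \<rightarrow> mcar F U"
  shows "lin_comb F U V n a s \<in> mcar F V"
proof -
  interpret V: module "rsec X V" "msec F V" by (rule msec_module[OF assms(2)])
  have "a i \<odot>\<^bsub>msec F V\<^esub> mres F U V (s i) \<in> mcar F V" if "i < n" for i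
    using assms that by (intro V.smult_closed mres_closed) auto
  then show ?thesis unfolding lin_comb_def by (intro V.M.finsum_closed) auto
qed

lemma mres_lin_comb:
  assumes "opn X U" "opn X V" "opn X W" "V \<subseteq> U" "W \<subseteq> V"
    and a: "a \<in> {..<n} \<rightarrow> carrier (rsec X V)" and s: "s \<in> {..<n} \<rightarrow> mcar F U"
  shows "mres F V W (lin_comb F U V n a s) = lin_comb F U W n (\<lambda>i. rres X V W (a i)) s"
proof -
  interpret V: module "rsec X V" "msec F V" by (rule msec_module[OF assms(2)])
  interpret W: module "rsec X W" "msec F W" by (rule msec_module[OF assms(3)])
  have sV: "mres F U V (s i) \<in> mcar F V" if "i < n" for i
    using assms that by (intro mres_closed) auto
  have "mres F V W (lin_comb F U V n a s) =
      finsum (msec F W) (\<lambda>i. mres F V W (a i \<odot>\<^bsub>msec F V\<^esub> mres F U V (s i))) {..<n}"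
    unfolding lin_comb_def using a sV by (intro mres_finsum assms) auto
  also have "\<dots> = lin_comb F U W n (\<lambda>i. rres X V W (a i)) s"
    unfolding lin_comb_def
  proof (rule W.M.finsum_cong')
    fix i assume "i \<in> {..<n}"
    then have ai: "a i \<in> carrier (rsec X V)" "s i \<in> mcar F U" "i < n" using a s by auto
    show "mres F V W (a i \<odot>\<^bsub>msec F V\<^esub> mres F U V (s i)) =
        rres X V W (a i) \<odot>\<^bsub>msec F W\<^esub> mres F U W (s i)"
      using ai sV mres_comp[OF assms(1,2,3,5,4) ai(2)] by (simp add: mres_smult assms)
  next
    show "(\<lambda>i. rres X V W (a i) \<odot>\<^bsub>msec F W\<^esub> mres F U W (s i)) \<in> {..<n} \<rightarrow> mcar F W"
      using a s assms(4,5)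
      by (auto intro!: W.smult_closed rres_closed[OF assms(2,3)] mres_closed[OF assms(1,3)])
  qed simp
  finally show ?thesis .
qed

lemma lin_comb_cong:
  assumes "opn X U" "opn X V" "V \<subseteq> U" "b \<in> {..<n} \<rightarrow> carrier (rsec X V)" "s \<in> {..<n} \<rightarrow> mcar F U"
    and "\<And>i. i < n \<Longrightarrow> a i = b i"
  shows "lin_comb F U V n a s = lin_comb F U V n b s"
proof -
  interpret V: module "rsec X V" "msec F V" by (rule msec_module[OF assms(2)])
  show ?thesis
    unfolding lin_comb_def using assms(4-6)
    by (intro V.M.finsum_cong') (auto intro!: V.smult_closed mres_closed[OF assms(1-3)])
qed

lemma smult_lin_comb:
  assumes "opn X U" "opn X V" "V \<subseteq> U" "a \<in> {..<n} \<rightarrow> carrier (rsec X V)" "s \<in> {..<n} \<rightarrow> mcar F U"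
    and c: "c \<in> carrier (rsec X V)"
  shows "c \<odot>\<^bsub>msec F V\<^esub> lin_comb F U V n a s = lin_comb F U V n (\<lambda>i. c \<otimes>\<^bsub>rsec X V\<^esub> a i) s"
proof -
  interpret V: module "rsec X V" "msec F V" by (rule msec_module[OF assms(2)])
  have s: "mres F U V (s i) \<in> mcar F V" if "i < n" for i
    using assms that by (intro mres_closed) auto
  have a: "a i \<in> carrier (rsec X V)" if "i < n" for i using assms that by auto
  have "c \<odot>\<^bsub>msec F V\<^esub> lin_comb F U V n a s =
      finsum (msec F V) (\<lambda>i. c \<odot>\<^bsub>msec F V\<^esub> (a i \<odot>\<^bsub>msec F V\<^esub> mres F U V (s i))) {..<n}"
    unfolding lin_comb_def using a s by (intro V.finsum_smult_ldistr c) auto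
  also have "\<dots> = lin_comb F U V n (\<lambda>i. c \<otimes>\<^bsub>rsec X V\<^esub> a i) s"
    unfolding lin_comb_def using a s c by (intro V.M.finsum_cong') (auto simp: V.smult_assoc1)
  finally show ?thesis .
qed

lemma mstalk_add:
  assumes "opn X U" "x \<in> U" "s \<in> mcar F U" "t \<in> mcar F U"
  shows "mgerm X F x U s \<oplus>\<^bsub>mstalk X F x\<^esub> mgerm X F x U t = mgerm X F x U (s \<oplus>\<^bsub>msec F U\<^esub> t)"
  unfolding mgerm_def mstalk_def ring.simps
  by (intro germ_lift2_germ msec_presheaf assms mres_add)
    (use msec_module in \<open>auto intro!: abelian_monoid.a_closed simp: module_def abelian_group_def\<close>)

lemma mstalk_smult:
  assumes "opn X U" "x \<in> U" "a \<in> carrier (rsec X U)" "s \<in> mcar F U"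
  shows "rgerm X x U a \<odot>\<^bsub>mstalk X F x\<^esub> mgerm X F x U s = mgerm X F x U (a \<odot>\<^bsub>msec F U\<^esub> s)"
  unfolding mgerm_def rgerm_def mstalk_def module.simps
  by (intro germ_lift2_germ msec_presheaf rsec_presheaf assms mres_smult)
    (use msec_module in \<open>auto intro!: module.smult_closed\<close>)

lemma mgerm_restrict:
  "opn X U \<Longrightarrow> opn X V \<Longrightarrow> x \<in> V \<Longrightarrow> V \<subseteq> U \<Longrightarrow> s \<in> mcar F U \<Longrightarrow>
   mgerm X F x V (mres F U V s) = mgerm X F x U s"
  unfolding mgerm_def using germ_restrict[OF msec_presheaf] .

lemma mgerm_eqD:
  assumes "mgerm X F x U s = mgerm X F x V t" "opn X V" "x \<in> V" "t \<in> mcar F V"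
  obtains W where "opn X W" "x \<in> W" "W \<subseteq> U" "W \<subseteq> V" "mres F U W s = mres F V W t"
  using germ_eqD[OF assms(1)[unfolded mgerm_def] assms(2-4)] .

lemma mgerm_eqI:
  "opn X U \<Longrightarrow> s \<in> mcar F U \<Longrightarrow> opn X V \<Longrightarrow> t \<in> mcar F V \<Longrightarrow> opn X W \<Longrightarrow> x \<in> W \<Longrightarrow>
   W \<subseteq> U \<Longrightarrow> W \<subseteq> V \<Longrightarrow> mres F U W s = mres F V W t \<Longrightarrow> mgerm X F x U s = mgerm X F x V t"
  unfolding mgerm_def by (rule germ_eqI[OF msec_presheaf])

lemma mstalk_zero:
  assumes "opn X U" "x \<in> U"
  shows "\<zero>\<^bsub>mstalk X F x\<^esub> = mgerm X F x U \<zero>\<^bsub>msec F U\<^esub>"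
proof -
  have U: "U \<subseteq> pts X" using assms openin_subset by blast
  interpret P: module "rsec X (pts X)" "msec F (pts X)" by (rule msec_module) simp
  show ?thesis
    using mgerm_restrict[OF _ assms U P.M.zero_closed] mres_zero[OF _ assms(1) U]
    by (simp add: mstalk_def)
qed

lemma mgerm_closed:
  "opn X U \<Longrightarrow> x \<in> U \<Longrightarrow> s \<in> mcar F U \<Longrightarrow> mgerm X F x U s \<in> carrier (mstalk X F x)"
  unfolding mstalk_def mgerm_def by (simp add: germ_in_germs)

lemma mstalk_rep3:
  assumes "A \<in> carrier (mstalk X F x)" "B \<in> carrier (mstalk X F x)" "C \<in> carrier (mstalk X F x)"
  obtains W a b c where "opn X W" "x \<in> W" "a \<in> mcar F W" "b \<in> mcar F W" "c \<in> mcar F W"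
    "A = mgerm X F x W a" "B = mgerm X F x W b" "C = mgerm X F x W c"
  by (rule germs_common3[OF msec_presheaf msec_presheaf msec_presheaf assms[unfolded stalk_def mstalk_def partial_object.simps]])
    (rule that[unfolded rgerm_def mgerm_def], assumption+)

lemma mstalk_rep:
  assumes "A \<in> carrier (mstalk X F x)"
  obtains W a where "opn X W" "x \<in> W" "a \<in> mcar F W" "A = mgerm X F x W a"
  using mstalk_rep3[OF assms assms assms] by metis

text \<open>The module laws mix both kinds of germs: distributivity over vectors needs one scalar
  and two vectors, while distributivity over scalars and associativity need two scalars and one
  vector, as in the variant that follows.\<close>

lemma mstalk_rep_smult_add:
  assumes "A \<in> carrier (stalk X x)" "B \<in> carrier (mstalk X F x)" "C \<in> carrier (mstalk X F x)"
  obtains W a b c where "opn X W" "x \<in> W" "a \<in> carrier (rsec X W)" "b \<in> mcar F W" "c \<in> mcar F W"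
    "A = rgerm X x W a" "B = mgerm X F x W b" "C = mgerm X F x W c"
  by (rule germs_common3[OF rsec_presheaf msec_presheaf msec_presheaf assms[unfolded stalk_def mstalk_def partial_object.simps]])
    (rule that[unfolded rgerm_def mgerm_def], assumption+)

lemma mstalk_rep_smult_smult:
  assumes "A \<in> carrier (stalk X x)" "B \<in> carrier (stalk X x)" "C \<in> carrier (mstalk X F x)"
  obtains W a b c where "opn X W" "x \<in> W" "a \<in> carrier (rsec X W)" "b \<in> carrier (rsec X W)" "c \<in> mcar F W"
    "A = rgerm X x W a" "B = rgerm X x W b" "C = mgerm X F x W c"
  by (rule germs_common3[OF rsec_presheaf rsec_presheaf msec_presheaf assms[unfolded stalk_def mstalk_def partial_object.simps]])
    (rule that[unfolded rgerm_def mgerm_def], assumption+)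

lemma mstalk_module:
  assumes x: "x \<in> pts X"
  shows "module (stalk X x) (mstalk X F x)"
proof (rule moduleI)
  let ?S = "stalk X x" and ?M = "mstalk X F x"
  show "cring ?S" by (rule stalk_cring[OF x])
  interpret P: module "rsec X (pts X)" "msec F (pts X)" by (rule msec_module) simp
  show "abelian_group ?M"
  proof (rule abelian_groupI)
    fix A B C assume "A \<in> carrier ?M" "B \<in> carrier ?M" "C \<in> carrier ?M"
    from mstalk_rep3[OF this] obtain W a b c where W: "opn X W" "x \<in> W"
      and abc: "a \<in> mcar F W" "b \<in> mcar F W" "c \<in> mcar F W"
      "A = mgerm X F x W a" "B = mgerm X F x W b" "C = mgerm X F x W c" .
    interpret W: module "rsec X W" "msec F W" by (rule msec_module[OF W(1)])
    show "A \<oplus>\<^bsub>?M\<^esub> B \<oplus>\<^bsub>?M\<^esub> C = A \<oplus>\<^bsub>?M\<^esub> (B \<oplus>\<^bsub>?M\<^esub> C)"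
      using abc by (simp add: mstalk_add W W.M.a_assoc)
  next
    fix A B assume "A \<in> carrier ?M" "B \<in> carrier ?M"
    from mstalk_rep3[OF this this(2)] obtain W a b where W: "opn X W" "x \<in> W"
      and ab: "a \<in> mcar F W" "b \<in> mcar F W" "A = mgerm X F x W a" "B = mgerm X F x W b" by metis
    interpret W: module "rsec X W" "msec F W" by (rule msec_module[OF W(1)])
    show "A \<oplus>\<^bsub>?M\<^esub> B = B \<oplus>\<^bsub>?M\<^esub> A" "A \<oplus>\<^bsub>?M\<^esub> B \<in> carrier ?M"
      using ab by (simp_all add: mstalk_add W W.M.a_comm mgerm_closed)
  next
    fix A assume "A \<in> carrier ?M"
    from mstalk_rep[OF this] obtain W a where W: "opn X W" "x \<in> W"
      and a: "a \<in> mcar F W" "A = mgerm X F x W a" .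
    interpret W: module "rsec X W" "msec F W" by (rule msec_module[OF W(1)])
    show "\<zero>\<^bsub>?M\<^esub> \<oplus>\<^bsub>?M\<^esub> A = A"
      using a by (simp add: mstalk_add W mstalk_zero[OF W])
    show "\<exists>B\<in>carrier ?M. B \<oplus>\<^bsub>?M\<^esub> A = \<zero>\<^bsub>?M\<^esub>"
      using a by (intro bexI[of _ "mgerm X F x W (\<ominus>\<^bsub>msec F W\<^esub> a)"])
        (simp_all add: mstalk_add W mstalk_zero[OF W] W.M.l_neg mgerm_closed)
  qed (use x mstalk_zero[of "pts X" x] mgerm_closed[of "pts X" x] P.M.zero_closed in auto)
  fix A B C
  {
    assume "A \<in> carrier ?S" "B \<in> carrier ?S" "C \<in> carrier ?M"
    from mstalk_rep_smult_smult[OF this] obtain W a b c where W: "opn X W" "x \<in> W"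
      and abc: "a \<in> carrier (rsec X W)" "b \<in> carrier (rsec X W)" "c \<in> mcar F W"
      "A = rgerm X x W a" "B = rgerm X x W b" "C = mgerm X F x W c" .
    interpret W: module "rsec X W" "msec F W" by (rule msec_module[OF W(1)])
    show "(A \<oplus>\<^bsub>?S\<^esub> B) \<odot>\<^bsub>?M\<^esub> C = A \<odot>\<^bsub>?M\<^esub> C \<oplus>\<^bsub>?M\<^esub> B \<odot>\<^bsub>?M\<^esub> C"
      "(A \<otimes>\<^bsub>?S\<^esub> B) \<odot>\<^bsub>?M\<^esub> C = A \<odot>\<^bsub>?M\<^esub> (B \<odot>\<^bsub>?M\<^esub> C)"
      using abc by (simp_all add: mstalk_add mstalk_smult stalk_simps W W.smult_l_distr W.smult_assoc1)
  next
    assume "A \<in> carrier ?S" "B \<in> carrier ?M" "C \<in> carrier ?M"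
    from mstalk_rep_smult_add[OF this] obtain W a b c where W: "opn X W" "x \<in> W"
      and abc: "a \<in> carrier (rsec X W)" "b \<in> mcar F W" "c \<in> mcar F W"
      "A = rgerm X x W a" "B = mgerm X F x W b" "C = mgerm X F x W c" .
    interpret W: module "rsec X W" "msec F W" by (rule msec_module[OF W(1)])
    show "A \<odot>\<^bsub>?M\<^esub> (B \<oplus>\<^bsub>?M\<^esub> C) = A \<odot>\<^bsub>?M\<^esub> B \<oplus>\<^bsub>?M\<^esub> A \<odot>\<^bsub>?M\<^esub> C"
      using abc by (simp add: mstalk_add mstalk_smult stalk_simps W W.smult_r_distr)
  next
    assume "A \<in> carrier ?S" "B \<in> carrier ?M"
    from mstalk_rep_smult_add[OF this this(2)] obtain W a b where W: "opn X W" "x \<in> W"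
      and abc: "a \<in> carrier (rsec X W)" "b \<in> mcar F W"
      "A = rgerm X x W a" "B = mgerm X F x W b" by metis
    interpret W: module "rsec X W" "msec F W" by (rule msec_module[OF W(1)])
    show "A \<odot>\<^bsub>?M\<^esub> B \<in> carrier ?M"
      using abc by (simp add: mstalk_smult mgerm_closed W)
  next
    assume "B \<in> carrier ?M"
    from mstalk_rep[OF this] obtain W b where W: "opn X W" "x \<in> W"
      and b: "b \<in> mcar F W" "B = mgerm X F x W b" .
    interpret W: module "rsec X W" "msec F W" by (rule msec_module[OF W(1)])
    show "\<one>\<^bsub>?S\<^esub> \<odot>\<^bsub>?M\<^esub> B = B"
      using b by (simp add: mstalk_smult stalk_const[OF W] W)
  }
qed

lemma mgerm_finsum:
  assumes U: "opn X U" "x \<in> U" and f: "f \<in> {..<n::nat} \<rightarrow> mcar F U"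
  shows "mgerm X F x U (finsum (msec F U) f {..<n}) =
    finsum (mstalk X F x) (\<lambda>i. mgerm X F x U (f i)) {..<n}"
  using f
proof (induction n)
  case 0
  interpret U: module "rsec X U" "msec F U" by (rule msec_module[OF U(1)])
  interpret S: module "stalk X x" "mstalk X F x"
    using U openin_subset by (intro mstalk_module) blast
  show ?case by (simp add: mstalk_zero[OF U])
next
  case (Suc n)
  interpret U: module "rsec X U" "msec F U" by (rule msec_module[OF U(1)])
  interpret S: module "stalk X x" "mstalk X F x"
    using U openin_subset by (intro mstalk_module) blast
  have f: "f \<in> {..<n} \<rightarrow> mcar F U" "f n \<in> mcar F U" using Suc.prems by auto
  have "(\<lambda>i. mgerm X F x U (f i)) \<in> {..<n} \<rightarrow> carrier (mstalk X F x)"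
    using f(1) mgerm_closed[OF U] by blast
  then show ?case
    using f Suc.IH[OF f(1)] mgerm_closed[OF U f(2)]
    by (simp add: lessThan_Suc U.M.finsum_insert S.M.finsum_insert mstalk_add[OF U, symmetric])
qed

end


section \<open>The spectrum of a domain\<close>

text \<open>The section of the structure sheaf of \<open>Spec A\<close> given on all of
  \<open>V\<close> by one fraction \<open>a / s\<close>. It is meaningful when \<open>s\<close> lies
  in no prime of \<open>V\<close>, and every section has this form locally.\<close>

definition frac_section :: "'r ring \<Rightarrow> 'r set set \<Rightarrow> 'r \<Rightarrow> 'r \<Rightarrow> 'r set \<Rightarrow> ('r \<times> 'r) set" where
  "frac_section A V a s = (\<lambda>P\<in>V. loc_frac A P a s)"

locale spec_domain = domain R for R :: "'r ring" (structure)

lemma zariski_prime: "openin (zariski A) V \<Longrightarrow> P \<in> V \<Longrightarrow> primeideal P A"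
  using openin_subset[of "zariski A" V] unfolding zariski_def by auto

lemma zariski_basis: "f \<in> carrier A \<Longrightarrow> openin (zariski A) {P. primeideal P A \<and> f \<notin> P}"
  unfolding zariski_def by (rule topology_generated_by_Basis) blast

lemma frac_section_restrict:
  "W \<subseteq> V \<Longrightarrow> restrict (frac_section A V a s) W = frac_section A W a s"
  unfolding frac_section_def by (auto simp: fun_eq_iff restrict_def)

lemma primeideal_zero: "primeideal P A \<Longrightarrow> \<zero>\<^bsub>A\<^esub> \<in> P"
  using additive_subgroup.zero_closed ideal.axioms(1) primeideal.axioms(1) by blast

text \<open>A basic open set given by \<open>f\<close> that contains some prime has
  \<open>f \<noteq> 0\<close>, since primes contain zero; so it contains the zero ideal, which is
  prime in a domain. Induction over the generated topology extends this to all open sets.\<close>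

lemma (in spec_domain) zariski_zero_ideal:
  assumes "openin (zariski R) V" "V \<noteq> {}"
  shows "{\<zero>} \<in> V"
proof -
  have "generate_topology_on {{P. primeideal P R \<and> f \<notin> P} | f. f \<in> carrier R} V"
    using assms(1) unfolding zariski_def openin_topology_generated_by_iff .
  then show ?thesis using assms(2)
  proof induction
    case (Basis S)
    then obtain f P where "S = {P. primeideal P R \<and> f \<notin> P}" "primeideal P R" "f \<notin> P" by blast
    then show ?case using zeroprimeideal primeideal_zero by blast
  qed blast+
qed

text \<open>The factor \<open>u\<close> in the definition of equality of fractions lies outside a
  prime ideal, hence is nonzero and cancels in a domain. Conversely \<open>u = 1\<close>
  serves.\<close>

lemma (in spec_domain) loc_frac_prime:
  assumes P: "primeideal P R" and a: "a \<in> carrier R" "s \<in> carrier R"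
  shows "loc_frac R P a s = {(b, t). b \<in> carrier R \<and> t \<in> carrier R - P \<and> a \<otimes> t = b \<otimes> s}"
proof -
  have "(\<exists>u\<in>carrier R - P. u \<otimes> (a \<otimes> t \<ominus> b \<otimes> s) = \<zero>) \<longleftrightarrow> a \<otimes> t = b \<otimes> s"
    if bt: "b \<in> carrier R" "t \<in> carrier R" for b t
  proof
    assume "\<exists>u\<in>carrier R - P. u \<otimes> (a \<otimes> t \<ominus> b \<otimes> s) = \<zero>"
    then obtain u where u: "u \<in> carrier R" "u \<notin> P" "u \<otimes> (a \<otimes> t \<ominus> b \<otimes> s) = \<zero>" by blast
    then have "u \<noteq> \<zero>" using primeideal_zero[OF P] by blast
    then have "a \<otimes> t \<ominus> b \<otimes> s = \<zero>" using integral[OF u(3)] u a bt by auto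
    then show "a \<otimes> t = b \<otimes> s" using a bt by (simp add: r_right_minus_eq)
  next
    assume "a \<otimes> t = b \<otimes> s"
    moreover have "\<one> \<in> carrier R - P"
      using P primeideal.I_notcarr[OF P] ideal.one_imp_carrier[OF primeideal.axioms(1)[OF P]] by blast
    ultimately show "\<exists>u\<in>carrier R - P. u \<otimes> (a \<otimes> t \<ominus> b \<otimes> s) = \<zero>"
      using a bt by (intro bexI[of _ \<one>]) (auto simp: r_right_minus_eq)
  qed
  then show ?thesis unfolding loc_frac_def by auto
qed

text \<open>The criterion does not mention \<open>P\<close>: all localizations of a domain at primes
  lie in one fraction field. Equality of the classes reduces to cancelling the nonzero denominators
  \<open>s\<close> and \<open>t\<close>.\<close>

lemma (in spec_domain) loc_frac_eq_iff:
  assumes P: "primeideal P R" and a: "a \<in> carrier R" "s \<in> carrier R - P"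
    and b: "b \<in> carrier R" "t \<in> carrier R - P"
  shows "loc_frac R P a s = loc_frac R P b t \<longleftrightarrow> a \<otimes> t = b \<otimes> s"
proof
  assume eq: "loc_frac R P a s = loc_frac R P b t"
  have "(b, t) \<in> loc_frac R P b t" using loc_frac_prime[OF P] b by auto
  then show "a \<otimes> t = b \<otimes> s" using loc_frac_prime[OF P] a unfolding eq[symmetric] by auto
next
  assume eq: "a \<otimes> t = b \<otimes> s"
  have nz: "s \<noteq> \<zero>" "t \<noteq> \<zero>" using a b primeideal_zero[OF P] by auto
  have "a \<otimes> v = c \<otimes> s \<longleftrightarrow> b \<otimes> v = c \<otimes> t" if cv: "c \<in> carrier R" "v \<in> carrier R" for c v
  proof -
    have "a \<otimes> v = c \<otimes> s \<longleftrightarrow> t \<otimes> (a \<otimes> v) = t \<otimes> (c \<otimes> s)" using a b cv nz by (simp add: m_lcancel)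
    also have "t \<otimes> (a \<otimes> v) = (a \<otimes> t) \<otimes> v" using a b cv by (simp add: m_ac)
    also have "\<dots> = s \<otimes> (b \<otimes> v)" unfolding eq using a b cv by (simp add: m_ac)
    also have "t \<otimes> (c \<otimes> s) = s \<otimes> (c \<otimes> t)" using a b cv by (simp add: m_ac)
    also have "s \<otimes> (b \<otimes> v) = s \<otimes> (c \<otimes> t) \<longleftrightarrow> b \<otimes> v = c \<otimes> t"
      using a b cv nz by (simp add: m_lcancel)
    finally show ?thesis .
  qed
  then show "loc_frac R P a s = loc_frac R P b t"
    using loc_frac_prime[OF P] a b by auto
qed

lemma (in spec_domain) loc_frac_memD:
  assumes P: "primeideal P R" and a: "a \<in> carrier R" "s \<in> carrier R - P"
    and "(b, t) \<in> loc_frac R P a s"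
  shows "b \<in> carrier R" "t \<in> carrier R - P" "loc_frac R P b t = loc_frac R P a s"
proof -
  show b: "b \<in> carrier R" "t \<in> carrier R - P" using assms loc_frac_prime[OF P] by auto
  have "a \<otimes> t = b \<otimes> s" using assms loc_frac_prime[OF P] by auto
  then show "loc_frac R P b t = loc_frac R P a s" using loc_frac_eq_iff[OF P a b] by simp
qed

lemma (in spec_domain) loc_frac_self:
  assumes P: "primeideal P R" and a: "a \<in> carrier R" "s \<in> carrier R - P"
  shows "(a, s) \<in> loc_frac R P a s"
  using loc_frac_prime[OF P] a by auto

lemma prime_mult_closed:
  assumes "primeideal P A" "s \<in> carrier A - P" "t \<in> carrier A - P"
  shows "s \<otimes>\<^bsub>A\<^esub> t \<in> carrier A - P"
proof -
  interpret primeideal P A by fact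
  show ?thesis using assms I_prime by auto
qed

lemma (in spec_domain) loc_frac_mult:
  assumes P: "primeideal P R" and a: "a \<in> carrier R" "s \<in> carrier R - P"
    and b: "b \<in> carrier R" "t \<in> carrier R - P"
  shows "loc_frac R P a s \<otimes>\<^bsub>localization R P\<^esub> loc_frac R P b t = loc_frac R P (a \<otimes> b) (s \<otimes> t)"
proof -
  have *: "loc_frac R P (a' \<otimes> b') (s' \<otimes> t') = loc_frac R P (a \<otimes> b) (s \<otimes> t)"
    if "(a', s') \<in> loc_frac R P a s" "(b', t') \<in> loc_frac R P b t" for a' s' b' t'
  proof -
    note 1 = loc_frac_memD[OF P a that(1)] and 2 = loc_frac_memD[OF P b that(2)]
    have "a' \<otimes> s = a \<otimes> s'" "b' \<otimes> t = b \<otimes> t'"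
      using loc_frac_eq_iff[OF P 1(1,2) a] loc_frac_eq_iff[OF P 2(1,2) b] 1 2 by auto
    moreover have "(a' \<otimes> b') \<otimes> (s \<otimes> t) = (a' \<otimes> s) \<otimes> (b' \<otimes> t)"
      "(a \<otimes> b) \<otimes> (s' \<otimes> t') = (a \<otimes> s') \<otimes> (b \<otimes> t')"
      using 1 2 a b by (simp_all add: m_ac)
    ultimately show ?thesis
      using 1 2 a b prime_mult_closed[OF P] by (subst loc_frac_eq_iff[OF P]) auto
  qed
  show ?thesis
    unfolding localization_def monoid.simps
    by (rule UN_UN_const[OF loc_frac_self[OF P a] loc_frac_self[OF P b]]) (rule *)
qed

lemma (in spec_domain) prime_one_notin: "primeideal P R \<Longrightarrow> \<one> \<in> carrier R - P"
  using primeideal.I_notcarr ideal.one_imp_carrier primeideal.axioms(1) by fastforce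

text \<open>This prepares the proof that a chart isomorphism preserves zero. The ring axioms are not
  established for the sections of \<open>Spec R\<close>, so zero is recognised by
  \<open>z + z = z\<close>, whose only solution in the target ring is zero.\<close>

lemma (in spec_domain) loc_frac_zero_add:
  assumes P: "primeideal P R"
  shows "loc_frac R P \<zero> \<one> \<oplus>\<^bsub>localization R P\<^esub> loc_frac R P \<zero> \<one> = loc_frac R P \<zero> \<one>"
proof -
  note one = prime_one_notin[OF P]
  have *: "loc_frac R P (a \<otimes> t \<oplus> b \<otimes> s) (s \<otimes> t) = loc_frac R P \<zero> \<one>"
    if "(a, s) \<in> loc_frac R P \<zero> \<one>" "(b, t) \<in> loc_frac R P \<zero> \<one>" for a s b t
  proof -
    note 1 = loc_frac_memD[OF P zero_closed one that(1)]
      and 2 = loc_frac_memD[OF P zero_closed one that(2)]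
    have "a = \<zero>" "b = \<zero>"
      using loc_frac_eq_iff[OF P 1(1,2) zero_closed one] loc_frac_eq_iff[OF P 2(1,2) zero_closed one] 1 2
      by auto
    then show ?thesis
      using 1 2 one prime_mult_closed[OF P] by (subst loc_frac_eq_iff[OF P]) auto
  qed
  show ?thesis
    unfolding localization_def ring.simps
    by (rule UN_UN_const[OF loc_frac_self[OF P zero_closed one] loc_frac_self[OF P zero_closed one]])
      (rule *)
qed

lemma (in spec_domain) frac_section_closed:
  assumes V: "openin (zariski R) V" and a: "a \<in> carrier R" "s \<in> carrier R" "\<And>P. P \<in> V \<Longrightarrow> s \<notin> P"
  shows "frac_section R V a s \<in> carrier (rsec (Spec R) V)"
proof -
  have "frac_section R V a s \<in> (\<Pi>\<^sub>E P\<in>V. carrier (localization R P))"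
    using a unfolding frac_section_def localization_def by auto
  moreover have "\<exists>W a' s'. openin (zariski R) W \<and> P \<in> W \<and> W \<subseteq> V \<and> a' \<in> carrier R \<and> s' \<in> carrier R \<and>
      (\<forall>Q\<in>W. s' \<notin> Q \<and> frac_section R V a s Q = loc_frac R Q a' s')" if "P \<in> V" for P
    using that V a by (intro exI[of _ V] exI[of _ a] exI[of _ s]) (auto simp: frac_section_def)
  ultimately show ?thesis unfolding Spec_def function_ring_def by simp
qed

lemma (in spec_domain) frac_section_mult:
  assumes V: "openin (zariski R) V" and a: "a \<in> carrier R" "s \<in> carrier R" "\<And>P. P \<in> V \<Longrightarrow> s \<notin> P"
    and b: "b \<in> carrier R" "t \<in> carrier R" "\<And>P. P \<in> V \<Longrightarrow> t \<notin> P"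
  shows "frac_section R V a s \<otimes>\<^bsub>rsec (Spec R) V\<^esub> frac_section R V b t =
    frac_section R V (a \<otimes> b) (s \<otimes> t)"
proof -
  have "loc_frac R P a s \<otimes>\<^bsub>localization R P\<^esub> loc_frac R P b t = loc_frac R P (a \<otimes> b) (s \<otimes> t)"
    if "P \<in> V" for P
    using loc_frac_mult[OF zariski_prime[OF V that]] a b that by auto
  then show ?thesis
    unfolding Spec_def function_ring_def frac_section_def by (auto simp: fun_eq_iff restrict_def)
qed

lemma Spec_one: "\<one>\<^bsub>rsec (Spec A) V\<^esub> = frac_section A V \<one>\<^bsub>A\<^esub> \<one>\<^bsub>A\<^esub>"
  unfolding Spec_def function_ring_def frac_section_def localization_def by simp

lemma Spec_zero: "\<zero>\<^bsub>rsec (Spec A) V\<^esub> = frac_section A V \<zero>\<^bsub>A\<^esub> \<one>\<^bsub>A\<^esub>"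
  unfolding Spec_def function_ring_def frac_section_def localization_def by simp

lemma (in spec_domain) Spec_zero_add:
  assumes V: "openin (zariski R) V"
  shows "\<zero>\<^bsub>rsec (Spec R) V\<^esub> \<oplus>\<^bsub>rsec (Spec R) V\<^esub> \<zero>\<^bsub>rsec (Spec R) V\<^esub> = \<zero>\<^bsub>rsec (Spec R) V\<^esub>"
proof -
  have "loc_frac R P \<zero> \<one> \<oplus>\<^bsub>localization R P\<^esub> loc_frac R P \<zero> \<one> = loc_frac R P \<zero> \<one>" if "P \<in> V" for P
    using loc_frac_zero_add[OF zariski_prime[OF V that]] .
  then show ?thesis
    unfolding Spec_zero unfolding Spec_def function_ring_def frac_section_def
    by (auto simp: fun_eq_iff restrict_def)
qed

text \<open>Equality of fractions is the same condition at every prime, so a single point of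
  \<open>V\<close> decides it. This is why \<open>V\<close> has to be nonempty.\<close>

lemma (in spec_domain) frac_section_eq_iff:
  assumes V: "openin (zariski R) V" "V \<noteq> {}"
    and a: "a \<in> carrier R" "s \<in> carrier R" "\<And>P. P \<in> V \<Longrightarrow> s \<notin> P"
    and b: "b \<in> carrier R" "t \<in> carrier R" "\<And>P. P \<in> V \<Longrightarrow> t \<notin> P"
  shows "frac_section R V a s = frac_section R V b t \<longleftrightarrow> a \<otimes> t = b \<otimes> s"
proof -
  have *: "loc_frac R P a s = loc_frac R P b t \<longleftrightarrow> a \<otimes> t = b \<otimes> s" if "P \<in> V" for P
    using loc_frac_eq_iff[OF zariski_prime[OF V(1) that]] a b that by auto
  obtain P where "P \<in> V" using V by blast
  then show ?thesis using *
    unfolding frac_section_def by (auto simp: fun_eq_iff restrict_def)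
qed

lemma Spec_section_local:
  assumes "f \<in> carrier (rsec (Spec A) V)" "P \<in> V"
  obtains W a s where "openin (zariski A) W" "P \<in> W" "W \<subseteq> V" "a \<in> carrier A" "s \<in> carrier A"
    "\<And>Q. Q \<in> W \<Longrightarrow> s \<notin> Q" "restrict f W = frac_section A W a s"
proof -
  from assms obtain W a s where W: "openin (zariski A) W" "P \<in> W" "W \<subseteq> V" "a \<in> carrier A" "s \<in> carrier A"
    "\<forall>Q\<in>W. s \<notin> Q \<and> f Q = loc_frac A Q a s"
    unfolding Spec_def function_ring_def by auto
  moreover have "restrict f W = frac_section A W a s"
    unfolding frac_section_def using W by (intro restrict_ext) auto
  ultimately show thesis using that by blast
qed

section \<open>Integral schemes\<close>

locale integral_space =
  fixes X :: "('x, 'r, 'z) rspace_scheme"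
  assumes integral: "integral_scheme X"

sublocale integral_space \<subseteq> ringed X
  using integral unfolding integral_scheme_def is_scheme_def by unfold_locales blast

context integral_space
begin

lemma rsec_domain: "opn X U \<Longrightarrow> U \<noteq> {} \<Longrightarrow> domain (rsec X U)"
  using integral unfolding integral_scheme_def by blast

lemma affine_cover_pts: "x \<in> pts X \<Longrightarrow> \<exists>U. affine_open X U \<and> x \<in> U"
  using integral unfolding integral_scheme_def is_scheme_def by blast

text \<open>The overlap is empty, and there any two sections coincide. The family to be glued is
  indexed by the open sets themselves, so \<open>U\<close> and \<open>V\<close> must be different
  sets; disjointness and \<open>U \<noteq> {}\<close> ensure this.\<close>

lemma disjoint_glue:
  assumes U: "opn X U" "opn X V" "U \<inter> V = {}" and ab: "a \<in> carrier (rsec X U)" "b \<in> carrier (rsec X V)"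
    and ne: "U \<noteq> {}"
  obtains c where "c \<in> carrier (rsec X (U \<union> V))" "rres X (U \<union> V) U c = a" "rres X (U \<union> V) V c = b"
proof -
  have "U \<noteq> V" using U ne by blast
  let ?s = "\<lambda>W. if W = U then a else b"
  have "\<exists>!t. t \<in> carrier (rsec X (\<Union>{U, V})) \<and> (\<forall>W\<in>{U, V}. rres X (\<Union>{U, V}) W t = ?s W)"
  proof (rule sheaf_glue[OF rsec_sheaf])
    fix W W' assume W: "W \<in> {U, V}" "W' \<in> {U, V}"
    show "rres X W (W \<inter> W') (?s W) = rres X W' (W \<inter> W') (?s W')"
    proof (cases "W = W'")
      case False
      then have e: "W \<inter> W' = {}" using W U by auto
      have "opn X W" "opn X W'" "?s W \<in> carrier (rsec X W)" "?s W' \<in> carrier (rsec X W')"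
        using W U ab by auto
      then have "rres X W {} (?s W) \<in> carrier (rsec X {})" "rres X W' {} (?s W') \<in> carrier (rsec X {})"
        by (simp_all only: rres_closed openin_empty empty_subsetI)
      then show ?thesis unfolding e by (rule sheaf_empty[OF rsec_sheaf])
    qed simp
  qed (use U ab in auto)
  then obtain t where "t \<in> carrier (rsec X (U \<union> V))" "rres X (U \<union> V) U t = a"
    "rres X (U \<union> V) V t = b" using \<open>U \<noteq> V\<close> by auto
  then show thesis by (rule that)
qed

text \<open>On disjoint \<open>U\<close> and \<open>V\<close> the functions with values 1, 0 and 0,
  1 would be nonzero with product zero, although the section ring of the union is a domain.\<close>

lemma opens_meet:
  assumes U: "opn X U" "U \<noteq> {}" and V: "opn X V" "V \<noteq> {}"
  shows "U \<inter> V \<noteq> {}"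
proof
  assume e: "U \<inter> V = {}"
  interpret U: domain "rsec X U" by (rule rsec_domain[OF U])
  interpret V: domain "rsec X V" by (rule rsec_domain[OF V])
  let ?W = "U \<union> V"
  have W: "opn X ?W" "?W \<noteq> {}" using U V by auto
  interpret W: domain "rsec X ?W" by (rule rsec_domain[OF W])
  obtain a where a: "a \<in> carrier (rsec X ?W)" "rres X ?W U a = \<one>\<^bsub>rsec X U\<^esub>" "rres X ?W V a = \<zero>\<^bsub>rsec X V\<^esub>"
    using disjoint_glue[OF U(1) V(1) e U.one_closed V.zero_closed U(2)] by blast
  obtain b where b: "b \<in> carrier (rsec X ?W)" "rres X ?W U b = \<zero>\<^bsub>rsec X U\<^esub>" "rres X ?W V b = \<one>\<^bsub>rsec X V\<^esub>"
    using disjoint_glue[OF U(1) V(1) e U.zero_closed V.one_closed U(2)] by blast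
  have UW: "U \<subseteq> ?W" "V \<subseteq> ?W" by auto
  have "a \<otimes>\<^bsub>rsec X ?W\<^esub> b = \<zero>\<^bsub>rsec X ?W\<^esub>"
  proof (rule sheaf_separated[OF rsec_sheaf W(1)])
    have "rres X ?W U (a \<otimes>\<^bsub>rsec X ?W\<^esub> b) = rres X ?W U \<zero>\<^bsub>rsec X ?W\<^esub>"
      "rres X ?W V (a \<otimes>\<^bsub>rsec X ?W\<^esub> b) = rres X ?W V \<zero>\<^bsub>rsec X ?W\<^esub>"
      using a b U V UW W by (simp_all add: rres_mult rres_zero)
    then show "\<exists>Z. opn X Z \<and> y \<in> Z \<and> Z \<subseteq> ?W \<and>
        rres X ?W Z (a \<otimes>\<^bsub>rsec X ?W\<^esub> b) = rres X ?W Z \<zero>\<^bsub>rsec X ?W\<^esub>" if "y \<in> ?W" for y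
      using that U V UW by (metis UnE)
  qed (use a b in auto)
  then have "a = \<zero>\<^bsub>rsec X ?W\<^esub> \<or> b = \<zero>\<^bsub>rsec X ?W\<^esub>" using W.integral a b by blast
  then show False
    using a b rres_zero[OF W(1) U(1) UW(1)] rres_zero[OF W(1) V(1) UW(2)] by auto
qed

end

section \<open>Functions on an affine chart as fractions\<close>

locale affine_chart = integral_space X for X :: "('x, 'r, 'z) rspace_scheme" +
  fixes U :: "'x set" and h :: "'x \<Rightarrow> 'r set" and \<phi> :: "'r set set \<Rightarrow> ('r set \<Rightarrow> ('r \<times> 'r) set) \<Rightarrow> 'r"
  assumes chart_open: "opn X U" and chart_nonempty: "U \<noteq> {}"
    and chart_iso: "rspace_iso (open_subspace X U) (Spec (rsec X U)) h \<phi>"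

sublocale affine_chart \<subseteq> A: spec_domain "rsec X U"
  using rsec_domain[OF chart_open chart_nonempty] unfolding spec_domain_def .

context affine_chart
begin

abbreviation chart_preim :: "'r set set \<Rightarrow> 'x set" where
  "chart_preim V \<equiv> {x \<in> U. h x \<in> V}"

abbreviation Z :: "'r set topology" where
  "Z \<equiv> zariski (rsec X U)"

lemma chart_subset: "U \<subseteq> pts X"
  using chart_open openin_subset by blast

lemma chart_preim_eq: "preim (open_subspace X U) h V = chart_preim V"
  unfolding preim_def open_subspace_def using chart_subset by auto

lemma chart_homeo: "homeomorphic_map (subtopology (topo X) U) Z h"
  using chart_iso unfolding rspace_iso_def open_subspace_def Spec_def by simp

lemma chart_topspace: "topspace (subtopology (topo X) U) = U"
  using chart_subset by auto

lemma chart_openin: "openin (subtopology (topo X) U) W \<longleftrightarrow> opn X W \<and> W \<subseteq> U"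
  using openin_open_subtopology[OF chart_open] .

lemma chart_preim_open:
  assumes "openin Z V"
  shows "opn X (chart_preim V)"
  using openin_continuous_map_preimage[OF homeomorphic_imp_continuous_map[OF chart_homeo] assms]
  unfolding chart_topspace chart_openin by blast

lemma chart_image: "h ` U = topspace Z"
  using homeomorphic_imp_surjective_map[OF chart_homeo] unfolding chart_topspace .

lemma chart_preim_nonempty:
  assumes "openin Z V" "V \<noteq> {}"
  shows "chart_preim V \<noteq> {}"
proof -
  obtain P where "P \<in> V" using assms(2) by blast
  moreover have "P \<in> h ` U" using \<open>P \<in> V\<close> openin_subset[OF assms(1)] chart_image by auto
  ultimately show ?thesis by auto
qed

lemma chart_image_open:
  assumes "opn X W" "W \<subseteq> U"
  shows "openin Z (h ` W)"
  using homeomorphic_imp_open_map[OF chart_homeo] assms chart_openin unfolding open_map_def by blast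

lemma chart_preim_image:
  assumes "W \<subseteq> U"
  shows "chart_preim (h ` W) = W"
  using homeomorphic_imp_injective_map[OF chart_homeo] assms unfolding chart_topspace
  by (auto dest: inj_onD)

lemma chart_ring_iso:
  assumes "openin Z V"
  shows "\<phi> V \<in> ring_iso (rsec (Spec (rsec X U)) V) (rsec X (chart_preim V))"
  using chart_iso assms unfolding rspace_iso_def chart_preim_eq
  by (simp add: Spec_def open_subspace_def)

lemma chart_res:
  assumes "openin Z V" "openin Z W" "W \<subseteq> V" "f \<in> carrier (rsec (Spec (rsec X U)) V)"
  shows "rres X (chart_preim V) (chart_preim W) (\<phi> V f) = \<phi> W (restrict f W)"
  using chart_iso assms unfolding rspace_iso_def rspace_morphism_def chart_preim_eq
  by (simp add: Spec_def open_subspace_def)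

lemma chart_hom:
  assumes V: "openin Z V"
  shows "f \<in> carrier (rsec (Spec (rsec X U)) V) \<Longrightarrow> \<phi> V f \<in> carrier (rsec X (chart_preim V))"
    and "f \<in> carrier (rsec (Spec (rsec X U)) V) \<Longrightarrow> g \<in> carrier (rsec (Spec (rsec X U)) V) \<Longrightarrow>
      \<phi> V (f \<otimes>\<^bsub>rsec (Spec (rsec X U)) V\<^esub> g) = \<phi> V f \<otimes>\<^bsub>rsec X (chart_preim V)\<^esub> \<phi> V g"
    and "\<phi> V (frac_section (rsec X U) V \<one>\<^bsub>rsec X U\<^esub> \<one>\<^bsub>rsec X U\<^esub>) = \<one>\<^bsub>rsec X (chart_preim V)\<^esub>"
    and "\<phi> V (frac_section (rsec X U) V \<zero>\<^bsub>rsec X U\<^esub> \<one>\<^bsub>rsec X U\<^esub>) = \<zero>\<^bsub>rsec X (chart_preim V)\<^esub>"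
    and "inj_on (\<phi> V) (carrier (rsec (Spec (rsec X U)) V))"
    and "c \<in> carrier (rsec X (chart_preim V)) \<Longrightarrow> \<exists>f\<in>carrier (rsec (Spec (rsec X U)) V). \<phi> V f = c"
proof -
  have h: "\<phi> V \<in> Ring.ring_hom (rsec (Spec (rsec X U)) V) (rsec X (chart_preim V))"
    and b: "bij_betw (\<phi> V) (carrier (rsec (Spec (rsec X U)) V)) (carrier (rsec X (chart_preim V)))"
    using chart_ring_iso[OF V] unfolding ring_iso_def by auto
  show cl: "\<phi> V f \<in> carrier (rsec X (chart_preim V))" if "f \<in> carrier (rsec (Spec (rsec X U)) V)" for f
    using ring_hom_closed[OF h] that .
  show "f \<in> carrier (rsec (Spec (rsec X U)) V) \<Longrightarrow> g \<in> carrier (rsec (Spec (rsec X U)) V) \<Longrightarrow>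
      \<phi> V (f \<otimes>\<^bsub>rsec (Spec (rsec X U)) V\<^esub> g) = \<phi> V f \<otimes>\<^bsub>rsec X (chart_preim V)\<^esub> \<phi> V g"
    using ring_hom_mult[OF h] .
  show "\<phi> V (frac_section (rsec X U) V \<one>\<^bsub>rsec X U\<^esub> \<one>\<^bsub>rsec X U\<^esub>) = \<one>\<^bsub>rsec X (chart_preim V)\<^esub>"
    using ring_hom_one[OF h] unfolding Spec_one .
  show "inj_on (\<phi> V) (carrier (rsec (Spec (rsec X U)) V))" using b by (rule bij_betw_imp_inj_on)
  show "c \<in> carrier (rsec X (chart_preim V)) \<Longrightarrow> \<exists>f\<in>carrier (rsec (Spec (rsec X U)) V). \<phi> V f = c"
    unfolding bij_betw_imp_surj_on[OF b, symmetric] by auto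
  interpret C: cring "rsec X (chart_preim V)" by (rule rsec_cring[OF chart_preim_open[OF V]])
  let ?z = "frac_section (rsec X U) V \<zero>\<^bsub>rsec X U\<^esub> \<one>\<^bsub>rsec X U\<^esub>"
  have z: "?z \<in> carrier (rsec (Spec (rsec X U)) V)"
    using A.prime_one_notin zariski_prime[OF V] by (intro A.frac_section_closed[OF V]) auto
  have "\<phi> V ?z \<oplus>\<^bsub>rsec X (chart_preim V)\<^esub> \<phi> V ?z = \<phi> V ?z"
    using ring_hom_add[OF h z z] A.Spec_zero_add[OF V] unfolding Spec_zero by simp
  then show "\<phi> V ?z = \<zero>\<^bsub>rsec X (chart_preim V)\<^esub>" using cl[OF z] by simp
qed

lemma one_notin: "openin Z V \<Longrightarrow> P \<in> V \<Longrightarrow> \<one>\<^bsub>rsec X U\<^esub> \<notin> P"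
  using A.prime_one_notin zariski_prime by blast

text \<open>Sections on a spectrum are locally fractions by construction, and the chart carries this
  to \<open>X\<close>. The image of \<open>W\<close> under \<open>h\<close> is open, and its
  preimage in \<open>U\<close> is \<open>W\<close> again because \<open>h\<close> is
  injective.\<close>

lemma chart_section_local:
  assumes W: "opn X W" "W \<subseteq> U" and c: "c \<in> carrier (rsec X W)" and x: "x \<in> W"
  obtains V a s where "openin Z V" "h x \<in> V" "chart_preim V \<subseteq> W"
    "a \<in> carrier (rsec X U)" "s \<in> carrier (rsec X U)" "\<forall>Q\<in>V. s \<notin> Q"
    "rres X W (chart_preim V) c = \<phi> V (frac_section (rsec X U) V a s)"
proof -
  let ?V = "h ` W"
  have V: "openin Z ?V" "chart_preim ?V = W"
    using chart_image_open[OF W] chart_preim_image[OF W(2)] by auto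
  obtain f where f: "f \<in> carrier (rsec (Spec (rsec X U)) ?V)" "\<phi> ?V f = c"
    using chart_hom(6)[OF V(1)] c unfolding V(2) by blast
  obtain V' a s where V': "openin Z V'" "h x \<in> V'" "V' \<subseteq> ?V" "a \<in> carrier (rsec X U)"
    "s \<in> carrier (rsec X U)" "\<And>Q. Q \<in> V' \<Longrightarrow> s \<notin> Q"
    "restrict f V' = frac_section (rsec X U) V' a s"
    using Spec_section_local[OF f(1) imageI[OF x]] by metis
  show thesis
  proof (rule that[OF V'(1,2) _ V'(4,5)])
    show "\<forall>Q\<in>V'. s \<notin> Q" using V'(6) by blast
    show "chart_preim V' \<subseteq> W" using V'(3) V(2) by blast
    show "rres X W (chart_preim V') c = \<phi> V' (frac_section (rsec X U) V' a s)"
      using chart_res[OF V(1) V'(1,3) f(1)] unfolding V(2) f(2) V'(7) .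
  qed
qed

text \<open>\<open>\<phi> V\<close> is injective, and over a domain a fraction vanishes exactly when
  its numerator does. Over the empty set every section is zero, so \<open>V\<close> must be
  nonempty.\<close>

lemma chart_frac_eq_zero_iff:
  assumes V: "openin Z V" "V \<noteq> {}" and a: "a \<in> carrier (rsec X U)" "s \<in> carrier (rsec X U)" "\<And>Q. Q \<in> V \<Longrightarrow> s \<notin> Q"
  shows "\<phi> V (frac_section (rsec X U) V a s) = \<zero>\<^bsub>rsec X (chart_preim V)\<^esub> \<longleftrightarrow> a = \<zero>\<^bsub>rsec X U\<^esub>"
proof -
  let ?z = "frac_section (rsec X U) V \<zero>\<^bsub>rsec X U\<^esub> \<one>\<^bsub>rsec X U\<^esub>"
  have cl: "?z \<in> carrier (rsec (Spec (rsec X U)) V)"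
    "frac_section (rsec X U) V a s \<in> carrier (rsec (Spec (rsec X U)) V)"
    using a one_notin[OF V(1)] by (auto intro!: A.frac_section_closed[OF V(1)])
  have "\<phi> V (frac_section (rsec X U) V a s) = \<zero>\<^bsub>rsec X (chart_preim V)\<^esub> \<longleftrightarrow>
      frac_section (rsec X U) V a s = ?z"
    unfolding chart_hom(4)[OF V(1), symmetric] using inj_on_eq_iff[OF chart_hom(5)[OF V(1)] cl(2,1)] .
  also have "\<dots> \<longleftrightarrow> a \<otimes>\<^bsub>rsec X U\<^esub> \<one>\<^bsub>rsec X U\<^esub> = \<zero>\<^bsub>rsec X U\<^esub> \<otimes>\<^bsub>rsec X U\<^esub> s"
    using a one_notin[OF V(1)] by (intro A.frac_section_eq_iff[OF V]) auto
  finally show ?thesis using a by simp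
qed

lemma chart_frac_restrict:
  assumes V: "openin Z V" and W: "openin Z W" "W \<subseteq> V"
    and a: "a \<in> carrier (rsec X U)" "s \<in> carrier (rsec X U)" "\<And>Q. Q \<in> V \<Longrightarrow> s \<notin> Q"
  shows "rres X (chart_preim V) (chart_preim W) (\<phi> V (frac_section (rsec X U) V a s)) =
    \<phi> W (frac_section (rsec X U) W a s)"
  using chart_res[OF V W A.frac_section_closed[OF V a]] frac_section_restrict[OF W(2)] by simp

text \<open>Near any \<open>y\<close> the section is a fraction \<open>a / s\<close>. Its
  restriction to an open set inside \<open>W\<close> vanishes, which forces \<open>a = 0\<close>, so
  it also vanishes near \<open>y\<close>; locality then gives the claim.\<close>

lemma chart_res_inj:
  assumes V: "opn X V" "V \<subseteq> U" and W: "opn X W" "W \<subseteq> V" "W \<noteq> {}" and f: "f \<in> carrier (rsec X V)"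
    and zero: "rres X V W f = \<zero>\<^bsub>rsec X W\<^esub>"
  shows "f = \<zero>\<^bsub>rsec X V\<^esub>"
proof (rule sheaf_separated[OF rsec_sheaf V(1) f])
  interpret V: cring "rsec X V" by (rule rsec_cring[OF V(1)])
  show "\<zero>\<^bsub>rsec X V\<^esub> \<in> carrier (rsec X V)" by simp
  fix y assume y: "y \<in> V"
  obtain V' a s where V'0: "openin Z V'" "h y \<in> V'" "chart_preim V' \<subseteq> V"
    "a \<in> carrier (rsec X U)" "s \<in> carrier (rsec X U)" "\<forall>Q\<in>V'. s \<notin> Q"
    and eq: "rres X V (chart_preim V') f = \<phi> V' (frac_section (rsec X U) V' a s)"
    using chart_section_local[OF V f y] .
  note V' = V'0(1-5) bspec[OF V'0(6)]
  note V'o = chart_preim_open[OF V'(1)]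
  have WU: "W \<subseteq> U" using W V by blast
  \<comment> \<open>The zero ideal lies in both sets, so they overlap even when \<open>y\<close> is
    not in \<open>W\<close>.\<close>
  let ?Y = "V' \<inter> h ` W"
  have Y: "openin Z ?Y" using V' chart_image_open[OF W(1) WU] by blast
  have "{\<zero>\<^bsub>rsec X U\<^esub>} \<in> V'" using A.zariski_zero_ideal[OF V'(1)] V'(2) by blast
  moreover have "{\<zero>\<^bsub>rsec X U\<^esub>} \<in> h ` W"
    using A.zariski_zero_ideal[OF chart_image_open[OF W(1) WU]] W(3) by blast
  ultimately have Yne: "?Y \<noteq> {}" by blast
  have YW: "chart_preim ?Y \<subseteq> W" using chart_preim_image[OF WU] by blast
  have YV': "chart_preim ?Y \<subseteq> chart_preim V'" by blast
  note Yo = chart_preim_open[OF Y]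
  have "\<phi> ?Y (frac_section (rsec X U) ?Y a s) =
      rres X (chart_preim V') (chart_preim ?Y) (rres X V (chart_preim V') f)"
    unfolding eq by (rule chart_frac_restrict[OF V'(1) Y _ V'(4-6), symmetric]) auto
  also have "\<dots> = rres X V (chart_preim ?Y) f"
    by (rule rres_comp[OF V(1) V'o Yo YV' V'(3) f])
  also have "\<dots> = rres X W (chart_preim ?Y) (rres X V W f)"
    by (rule rres_comp[OF V(1) W(1) Yo YW W(2) f, symmetric])
  also have "\<dots> = \<zero>\<^bsub>rsec X (chart_preim ?Y)\<^esub>"
    unfolding zero by (rule rres_zero[OF W(1) Yo YW])
  finally have "\<phi> ?Y (frac_section (rsec X U) ?Y a s) = \<zero>\<^bsub>rsec X (chart_preim ?Y)\<^esub>" .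
  moreover have "\<And>Q. Q \<in> ?Y \<Longrightarrow> s \<notin> Q" using V'(6) by blast
  ultimately have a0: "a = \<zero>\<^bsub>rsec X U\<^esub>" using chart_frac_eq_zero_iff[OF Y Yne V'(4,5)] by blast
  have "V' \<noteq> {}" using V'(2) by blast
  then have "\<phi> V' (frac_section (rsec X U) V' a s) = \<zero>\<^bsub>rsec X (chart_preim V')\<^esub>"
    using chart_frac_eq_zero_iff[OF V'(1) _ V'(4-6)] a0 by blast
  then have "rres X V (chart_preim V') f = rres X V (chart_preim V') \<zero>\<^bsub>rsec X V\<^esub>"
    unfolding eq using rres_zero[OF V(1) V'o V'(3)] by simp
  then show "\<exists>W. opn X W \<and> y \<in> W \<and> W \<subseteq> V \<and> rres X V W f = rres X V W \<zero>\<^bsub>rsec X V\<^esub>"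
    using V'o V' y V by (intro exI[of _ "chart_preim V'"]) blast
qed

text \<open>Where \<open>c\<close> is \<open>a / s\<close>, the inverse is \<open>s / a\<close> on
  the open set of primes that avoid \<open>a\<close>. Injectivity of restriction gives
  \<open>a \<noteq> 0\<close>; hence the zero ideal lies in that set, which is therefore
  nonempty.\<close>

lemma chart_local_inverse:
  assumes W: "opn X W" "W \<subseteq> U" and c: "c \<in> carrier (rsec X W)" "c \<noteq> \<zero>\<^bsub>rsec X W\<^esub>"
    and ne: "W \<noteq> {}"
  obtains W' c' where "opn X W'" "W' \<subseteq> W" "W' \<noteq> {}" "c' \<in> carrier (rsec X W')"
    "rres X W W' c \<otimes>\<^bsub>rsec X W'\<^esub> c' = \<one>\<^bsub>rsec X W'\<^esub>"
proof -
  obtain x where x: "x \<in> W" using ne by blast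
  obtain V a s where V0: "openin Z V" "h x \<in> V" "chart_preim V \<subseteq> W"
    "a \<in> carrier (rsec X U)" "s \<in> carrier (rsec X U)" "\<forall>Q\<in>V. s \<notin> Q"
    and eq: "rres X W (chart_preim V) c = \<phi> V (frac_section (rsec X U) V a s)"
    using chart_section_local[OF W c(1) x] .
  note V = V0(1-5) bspec[OF V0(6)]
  have Vne: "V \<noteq> {}" using V(2) by blast
  note Vo = chart_preim_open[OF V(1)]
  have "\<phi> V (frac_section (rsec X U) V a s) \<noteq> \<zero>\<^bsub>rsec X (chart_preim V)\<^esub>"
    using chart_res_inj[OF W Vo V(3) chart_preim_nonempty[OF V(1) Vne] c(1)] c(2) unfolding eq by blast
  then have a: "a \<noteq> \<zero>\<^bsub>rsec X U\<^esub>" using chart_frac_eq_zero_iff[OF V(1) Vne V(4-6)] by blast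
  let ?Y = "V \<inter> {P. primeideal P (rsec X U) \<and> a \<notin> P}"
  have Y: "openin Z ?Y" using V(1) zariski_basis[OF V(4)] by blast
  have "{\<zero>\<^bsub>rsec X U\<^esub>} \<in> ?Y"
    using A.zariski_zero_ideal[OF V(1) Vne] A.zeroprimeideal a by blast
  then have Yne: "?Y \<noteq> {}" by blast
  note Yo = chart_preim_open[OF Y]
  have YV: "?Y \<subseteq> V" by blast
  have nin: "s \<notin> Q" "a \<notin> Q" if "Q \<in> ?Y" for Q using V(6)[of Q] that by simp_all
  let ?f = "frac_section (rsec X U) ?Y a s" and ?g = "frac_section (rsec X U) ?Y s a"
  have fg: "?f \<in> carrier (rsec (Spec (rsec X U)) ?Y)" "?g \<in> carrier (rsec (Spec (rsec X U)) ?Y)"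
    by (rule A.frac_section_closed[OF Y V(4,5) nin(1)], assumption,
        rule A.frac_section_closed[OF Y V(5,4) nin(2)], assumption)
  have "?f \<otimes>\<^bsub>rsec (Spec (rsec X U)) ?Y\<^esub> ?g =
      frac_section (rsec X U) ?Y (a \<otimes>\<^bsub>rsec X U\<^esub> s) (s \<otimes>\<^bsub>rsec X U\<^esub> a)"
    by (rule A.frac_section_mult[OF Y V(4,5) nin(1) V(5,4) nin(2)])
  also have "\<dots> = frac_section (rsec X U) ?Y \<one>\<^bsub>rsec X U\<^esub> \<one>\<^bsub>rsec X U\<^esub>"
  proof (subst A.frac_section_eq_iff[OF Y Yne])
    show "s \<otimes>\<^bsub>rsec X U\<^esub> a \<notin> P" if "P \<in> ?Y" for P
      using prime_mult_closed[of P "rsec X U" s a] nin[OF that] V that by auto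
    show "\<one>\<^bsub>rsec X U\<^esub> \<notin> P" if "P \<in> ?Y" for P using one_notin[OF Y that] .
  qed (use V in \<open>auto simp: A.m_comm\<close>)
  finally have "\<phi> ?Y ?f \<otimes>\<^bsub>rsec X (chart_preim ?Y)\<^esub> \<phi> ?Y ?g = \<one>\<^bsub>rsec X (chart_preim ?Y)\<^esub>"
    using chart_hom(2)[OF Y fg] chart_hom(3)[OF Y] by simp
  moreover have "rres X W (chart_preim ?Y) c = \<phi> ?Y ?f"
  proof -
    have "chart_preim ?Y \<subseteq> chart_preim V" by blast
    from rres_comp[OF W(1) Vo Yo this V(3) c(1)] show ?thesis
      unfolding eq using chart_frac_restrict[OF V(1) Y YV V(4-6)] by (rule trans[OF sym])
  qed
  ultimately show thesis
    using that[OF Yo _ chart_preim_nonempty[OF Y Yne] chart_hom(1)[OF Y fg(2)]] V(3) by auto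
qed

text \<open>The local description \<open>c = a / s\<close> becomes an equation free of denominators:
  \<open>s / 1\<close> times \<open>a / s\<close> is \<open>a / 1\<close>, and both
  \<open>s / 1\<close> and \<open>a / 1\<close> extend to the whole chart.\<close>

lemma chart_fraction:
  assumes W: "opn X W" "W \<subseteq> U" "W \<noteq> {}" and c: "c \<in> carrier (rsec X W)"
  obtains W' a b where "opn X W'" "W' \<subseteq> W" "W' \<noteq> {}" "a \<in> carrier (rsec X U)" "b \<in> carrier (rsec X U)"
    "b \<noteq> \<zero>\<^bsub>rsec X U\<^esub>" "rres X U W' b \<otimes>\<^bsub>rsec X W'\<^esub> rres X W W' c = rres X U W' a"
proof -
  obtain x where x: "x \<in> W" using W(3) by blast
  obtain V a s where V0: "openin Z V" "h x \<in> V" "chart_preim V \<subseteq> W"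
    "a \<in> carrier (rsec X U)" "s \<in> carrier (rsec X U)" "\<forall>Q\<in>V. s \<notin> Q"
    and eq: "rres X W (chart_preim V) c = \<phi> V (frac_section (rsec X U) V a s)"
    using chart_section_local[OF W(1,2) c x] .
  note V = V0(1-5) bspec[OF V0(6)]
  have Vne: "V \<noteq> {}" using V(2) by blast
  note Vo = chart_preim_open[OF V(1)]
  let ?T = "topspace Z" and ?one = "\<one>\<^bsub>rsec X U\<^esub>"
  have T: "openin Z ?T" by simp
  have PT: "chart_preim ?T = U" using chart_image by blast
  have VT: "V \<subseteq> ?T" using openin_subset[OF V(1)] .
  have Tne: "?T \<noteq> {}" using Vne VT by blast
  \<comment> \<open>The isomorphism of the chart is arbitrary, so over the whole spectrum
    \<open>\<phi>\<close> need not send \<open>b / 1\<close> to \<open>b\<close>. Numerator and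
    denominator are therefore the images of \<open>a / 1\<close> and \<open>s / 1\<close>, which are
    functions on \<open>U\<close>.\<close>
  have sec: "\<phi> ?T (frac_section (rsec X U) ?T b ?one) \<in> carrier (rsec X U)"
    "rres X U (chart_preim V) (\<phi> ?T (frac_section (rsec X U) ?T b ?one)) =
      \<phi> V (frac_section (rsec X U) V b ?one)" if b: "b \<in> carrier (rsec X U)" for b
    using chart_hom(1)[OF T A.frac_section_closed[OF T b A.one_closed one_notin[OF T]]]
      chart_frac_restrict[OF T V(1) VT b A.one_closed one_notin[OF T]]
    unfolding PT by auto
  have s0: "s \<noteq> \<zero>\<^bsub>rsec X U\<^esub>" using V(6)[OF A.zariski_zero_ideal[OF V(1) Vne]] by blast
  have "\<phi> V (frac_section (rsec X U) V s ?one) \<otimes>\<^bsub>rsec X (chart_preim V)\<^esub> \<phi> V (frac_section (rsec X U) V a s) =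
      \<phi> V (frac_section (rsec X U) V (s \<otimes>\<^bsub>rsec X U\<^esub> a) (?one \<otimes>\<^bsub>rsec X U\<^esub> s))"
    using V one_notin[OF V(1)]
    by (subst chart_hom(2)[OF V(1), symmetric])
      (auto intro!: A.frac_section_closed[OF V(1)] simp: A.frac_section_mult[OF V(1)])
  also have "frac_section (rsec X U) V (s \<otimes>\<^bsub>rsec X U\<^esub> a) (?one \<otimes>\<^bsub>rsec X U\<^esub> s) =
      frac_section (rsec X U) V a ?one"
    using V one_notin[OF V(1)]
    by (subst A.frac_section_eq_iff[OF V(1) Vne]) (auto simp: A.m_comm)
  finally show thesis
    using that[OF Vo V(3) chart_preim_nonempty[OF V(1) Vne] sec(1)[OF V(4)] sec(1)[OF V(5)]]
      sec(2)[OF V(4)] sec(2)[OF V(5)] eq s0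
      chart_frac_eq_zero_iff[OF T Tne V(5) A.one_closed one_notin[OF T]] unfolding PT by simp
qed

text \<open>Denominator and numerators are functions on the whole chart, although the coefficients
  exist only on \<open>W\<close>; so they still make sense at points of the chart outside
  \<open>W\<close>.\<close>

lemma chart_common_denominator:
  assumes W: "opn X W" "W \<subseteq> U" "W \<noteq> {}" and c: "c \<in> {..<n::nat} \<rightarrow> carrier (rsec X W)"
  shows "\<exists>W' a b. opn X W' \<and> W' \<subseteq> W \<and> W' \<noteq> {} \<and> a \<in> {..<n} \<rightarrow> carrier (rsec X U) \<and>
    b \<in> carrier (rsec X U) \<and> b \<noteq> \<zero>\<^bsub>rsec X U\<^esub> \<and>
    (\<forall>i<n. rres X U W' b \<otimes>\<^bsub>rsec X W'\<^esub> rres X W W' (c i) = rres X U W' (a i))"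
  using c
proof (induction n)
  case 0
  show ?case using W A.one_not_zero by (intro exI[of _ W] exI[of _ "\<lambda>_. undefined"] exI[of _ "\<one>\<^bsub>rsec X U\<^esub>"]) auto
next
  case (Suc n)
  have c': "c \<in> {..<n} \<rightarrow> carrier (rsec X W)" using Suc.prems by auto
  from Suc.IH[OF c'] obtain W1 a1 b1 where 10: "opn X W1" "W1 \<subseteq> W" "W1 \<noteq> {}" "a1 \<in> {..<n} \<rightarrow> carrier (rsec X U)"
    "b1 \<in> carrier (rsec X U)" "b1 \<noteq> \<zero>\<^bsub>rsec X U\<^esub>"
    "\<forall>i<n. rres X U W1 b1 \<otimes>\<^bsub>rsec X W1\<^esub> rres X W W1 (c i) = rres X U W1 (a1 i)"
    by (elim exE conjE) (rule that, assumption+)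
  note 1 = 10(1-6) 10(7)[rule_format]
  have cn: "c n \<in> carrier (rsec X W)" using Suc.prems by auto
  obtain W2 a2 b2 where 2: "opn X W2" "W2 \<subseteq> W" "W2 \<noteq> {}" "a2 \<in> carrier (rsec X U)"
    "b2 \<in> carrier (rsec X U)" "b2 \<noteq> \<zero>\<^bsub>rsec X U\<^esub>"
    "rres X U W2 b2 \<otimes>\<^bsub>rsec X W2\<^esub> rres X W W2 (c n) = rres X U W2 a2"
    using chart_fraction[OF W cn] by metis
  let ?V = "W1 \<inter> W2"
  let ?R = "rsec X ?V" and ?r = "rres X U ?V"
  \<comment> \<open>For the denominator \<open>b1 b2\<close> the earlier numerators are multiplied
    by \<open>b2\<close> and the new one by \<open>b1\<close>. The product is nonzero because the
    section ring is a domain.\<close>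
  let ?a = "\<lambda>i. if i < n then b2 \<otimes>\<^bsub>rsec X U\<^esub> a1 i else b1 \<otimes>\<^bsub>rsec X U\<^esub> a2"
  have V: "opn X ?V" "?V \<noteq> {}" "?V \<subseteq> U" "?V \<subseteq> W" using 1 2 W opens_meet by auto
  interpret V: cring ?R by (rule rsec_cring[OF V(1)])
  have r: "?r x \<in> carrier ?R" if "x \<in> carrier (rsec X U)" for x
    using rres_closed[OF chart_open V(1,3) that] .
  have rc: "rres X W ?V (c i) \<in> carrier ?R" if "i < Suc n" for i
    using rres_closed[OF W(1) V(1,4)] Suc.prems that by auto
  have W12: "W1 \<subseteq> U" "W2 \<subseteq> U" using 1 2 W by auto
  have down: "?r b \<otimes>\<^bsub>?R\<^esub> rres X W ?V c' = ?r a'"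
    if "opn X Y" "?V \<subseteq> Y" "Y \<subseteq> W" "b \<in> carrier (rsec X U)" "a' \<in> carrier (rsec X U)" "c' \<in> carrier (rsec X W)"
      "rres X U Y b \<otimes>\<^bsub>rsec X Y\<^esub> rres X W Y c' = rres X U Y a'" for Y b a' c'
  proof -
    have YU: "Y \<subseteq> U" using that W by blast
    have "rres X Y ?V (rres X U Y b \<otimes>\<^bsub>rsec X Y\<^esub> rres X W Y c') = ?r b \<otimes>\<^bsub>?R\<^esub> rres X W ?V c'"
      using that YU W chart_open V
      by (subst rres_mult) (auto intro: rres_closed simp: rres_comp)
    moreover have "rres X Y ?V (rres X U Y a') = ?r a'"
      using that YU chart_open V by (intro rres_comp) auto
    ultimately show ?thesis using that(7) by simp
  qed
  have e1: "?r b1 \<otimes>\<^bsub>?R\<^esub> rres X W ?V (c i) = ?r (a1 i)" if "i < n" for i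
    using that 1(4) c' by (intro down[OF 1(1) _ 1(2,5) _ _ 1(7)[OF that]]) (auto simp: Pi_iff)
  have e2: "?r b2 \<otimes>\<^bsub>?R\<^esub> rres X W ?V (c n) = ?r a2"
    using down[OF 2(1) _ 2(2,5,4) cn 2(7)] by auto
  have "?r (b1 \<otimes>\<^bsub>rsec X U\<^esub> b2) \<otimes>\<^bsub>?R\<^esub> rres X W ?V (c i) = ?r (?a i)" if i: "i < Suc n" for i
  proof (cases "i < n")
    case True
    have a1: "a1 i \<in> carrier (rsec X U)" using 1(4) True by auto
    have "?r (b1 \<otimes>\<^bsub>rsec X U\<^esub> b2) \<otimes>\<^bsub>?R\<^esub> rres X W ?V (c i) =
        ?r b2 \<otimes>\<^bsub>?R\<^esub> (?r b1 \<otimes>\<^bsub>?R\<^esub> rres X W ?V (c i))"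
      using 1(5) 2(5) r rc[OF i] by (simp add: rres_mult[OF chart_open V(1,3)] V.m_ac)
    then show ?thesis using True a1 2(5) e1[OF True] by (simp add: rres_mult[OF chart_open V(1,3)])
  next
    case False
    then have i': "i = n" using i by simp
    have "?r (b1 \<otimes>\<^bsub>rsec X U\<^esub> b2) \<otimes>\<^bsub>?R\<^esub> rres X W ?V (c n) =
        ?r b1 \<otimes>\<^bsub>?R\<^esub> (?r b2 \<otimes>\<^bsub>?R\<^esub> rres X W ?V (c n))"
      using 1(5) 2(5) r rc[of n] by (simp add: rres_mult[OF chart_open V(1,3)] V.m_ac)
    then show ?thesis using i' 1(5) 2(4) e2 by (simp add: rres_mult[OF chart_open V(1,3)])
  qed
  moreover have "b1 \<otimes>\<^bsub>rsec X U\<^esub> b2 \<noteq> \<zero>\<^bsub>rsec X U\<^esub>" using 1 2 A.integral by blast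
  moreover have "?a \<in> {..<Suc n} \<rightarrow> carrier (rsec X U)"
    using funcset_mem[OF 1(4)] 1(5) 2(4,5) by (simp add: Pi_iff)
  ultimately show ?case
    using V A.m_closed[OF 1(5) 2(5)]
    by (intro exI[of _ ?V] exI[of _ ?a] exI[of _ "b1 \<otimes>\<^bsub>rsec X U\<^esub> b2"] conjI allI impI) assumption+
qed

end

section \<open>Injectivity of restriction, the generic point and the function field\<close>

context integral_space
begin

lemma affine_chartE:
  assumes "x \<in> pts X"
  obtains U h \<phi> where "affine_chart X U h \<phi>" "x \<in> U"
proof -
  obtain U where U: "affine_open X U" "x \<in> U" using affine_cover_pts[OF assms] by blast
  then obtain h \<phi> where "rspace_iso (open_subspace X U) (Spec (rsec X U)) h \<phi>"
    unfolding affine_open_def by blast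
  then have "affine_chart X U h \<phi>"
    using U integral unfolding affine_open_def
    by (auto simp: affine_chart_def affine_chart_axioms_def integral_space_def)
  then show thesis using that U by blast
qed

text \<open>It suffices to argue in a chart around each point of \<open>V\<close>. Since nonempty
  open sets meet, \<open>W\<close> meets the chart, and vanishing on \<open>W\<close> becomes
  vanishing on a nonempty open subset of the chart.\<close>

lemma rres_inj:
  assumes V: "opn X V" and W: "opn X W" "W \<subseteq> V" "W \<noteq> {}" and f: "f \<in> carrier (rsec X V)"
    and zero: "rres X V W f = \<zero>\<^bsub>rsec X W\<^esub>"
  shows "f = \<zero>\<^bsub>rsec X V\<^esub>"
proof (rule sheaf_separated[OF rsec_sheaf V f])
  interpret V: cring "rsec X V" by (rule rsec_cring[OF V])
  show "\<zero>\<^bsub>rsec X V\<^esub> \<in> carrier (rsec X V)" by simp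
  fix y assume y: "y \<in> V"
  then have "y \<in> pts X" using openin_subset[OF V] by blast
  then obtain U h \<phi> where "affine_chart X U h \<phi>" and yU: "y \<in> U" by (rule affine_chartE)
  then interpret affine_chart X U h \<phi> by simp
  let ?V = "V \<inter> U" and ?W = "W \<inter> U"
  have o: "opn X ?V" "opn X ?W" "?W \<noteq> {}" "?W \<subseteq> ?V" "?V \<subseteq> U" "?V \<subseteq> V" "?W \<subseteq> W"
    using V W chart_open chart_nonempty opens_meet by auto
  have "rres X ?V ?W (rres X V ?V f) = rres X W ?W (rres X V W f)"
    using rres_comp[OF V o(1,2,4,6) f] rres_comp[OF V W(1) o(2,7) W(2) f] by simp
  also have "\<dots> = \<zero>\<^bsub>rsec X ?W\<^esub>" unfolding zero by (rule rres_zero[OF W(1) o(2,7)])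
  finally have "rres X V ?V f = \<zero>\<^bsub>rsec X ?V\<^esub>"
    by (rule chart_res_inj[OF o(1,5,2,4,3) rres_closed[OF V o(1,6) f]])
  then have "rres X V ?V f = rres X V ?V \<zero>\<^bsub>rsec X V\<^esub>" using rres_zero[OF V o(1,6)] by simp
  then show "\<exists>W. opn X W \<and> y \<in> W \<and> W \<subseteq> V \<and> rres X V W f = rres X V W \<zero>\<^bsub>rsec X V\<^esub>"
    using o y yU by blast
qed

lemma rres_eqI:
  assumes V: "opn X V" and W: "opn X W" "W \<subseteq> V" "W \<noteq> {}"
    and f: "f \<in> carrier (rsec X V)" and g: "g \<in> carrier (rsec X V)"
    and eq: "rres X V W f = rres X V W g"
  shows "f = g"
proof -
  interpret V: cring "rsec X V" by (rule rsec_cring[OF V])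
  interpret W: cring "rsec X W" by (rule rsec_cring[OF W(1)])
  let ?c = "f \<ominus>\<^bsub>rsec X V\<^esub> g"
  have c: "?c \<in> carrier (rsec X V)" using f g by simp
  have "?c \<oplus>\<^bsub>rsec X V\<^esub> g = f" using f g by (simp add: V.minus_eq V.a_assoc V.l_neg)
  then have "rres X V W ?c \<oplus>\<^bsub>rsec X W\<^esub> rres X V W g = rres X V W g"
    using rres_add[OF V W(1,2) c g] eq by simp
  then have "rres X V W ?c = \<zero>\<^bsub>rsec X W\<^esub>"
    using rres_closed[OF V W(1,2) c] rres_closed[OF V W(1,2) g] by simp
  then have "?c = \<zero>\<^bsub>rsec X V\<^esub>" by (rule rres_inj[OF V W c])
  then show ?thesis using f g by simp
qed

text \<open>The point of one chart that corresponds to the zero ideal works. A nonempty open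
  \<open>V\<close> meets the chart, the image of the overlap is a nonempty Zariski open set and
  contains the zero ideal, and injectivity of \<open>h\<close> puts the point itself into
  \<open>V\<close>.\<close>

lemma generic_point_exists:
  "\<exists>\<eta>. \<eta> \<in> pts X \<and> topo X closure_of {\<eta>} = pts X"
proof -
  obtain x where "x \<in> pts X" using integral unfolding integral_scheme_def by blast
  then obtain U h \<phi> where "affine_chart X U h \<phi>" by (rule affine_chartE)
  then interpret affine_chart X U h \<phi> .
  have zero_mem: "{\<zero>\<^bsub>rsec X U\<^esub>} \<in> h ` W" if "opn X W" "W \<subseteq> U" "W \<noteq> {}" for W
    using A.zariski_zero_ideal[OF chart_image_open[OF that(1,2)]] that(3) by blast
  obtain \<eta> where \<eta>: "\<eta> \<in> U" "h \<eta> = {\<zero>\<^bsub>rsec X U\<^esub>}"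
    using zero_mem[OF chart_open subset_refl chart_nonempty] by (metis imageE)
  have "\<eta> \<in> V" if V: "opn X V" "V \<noteq> {}" for V
  proof -
    have "V \<inter> U \<noteq> {}" using opens_meet[OF V chart_open chart_nonempty] .
    then have "{\<zero>\<^bsub>rsec X U\<^esub>} \<in> h ` (V \<inter> U)"
      using zero_mem[of "V \<inter> U"] openin_Int[OF V(1) chart_open] by blast
    then have "\<eta> \<in> chart_preim (h ` (V \<inter> U))" using \<eta> by simp
    then show ?thesis using chart_preim_image[of "V \<inter> U"] by blast
  qed
  moreover have "\<eta> \<in> pts X" using \<eta> chart_subset by blast
  ultimately show ?thesis
    by (intro exI[of _ \<eta>]) (auto simp: closure_of_def)
qed

text \<open>Density is used in this form: shrinking to a nonempty open set never loses the generic
  point.\<close>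

lemma generic_point_mem:
  assumes "opn X V" "V \<noteq> {}"
  shows "generic_point X \<in> V"
proof -
  have "topo X closure_of {generic_point X} = pts X"
    using someI_ex[OF generic_point_exists] unfolding generic_point_def by blast
  moreover obtain y where "y \<in> V" using assms by blast
  moreover have "y \<in> pts X" using \<open>y \<in> V\<close> openin_subset[OF assms(1)] by blast
  ultimately have "y \<in> topo X closure_of {generic_point X}" by simp
  then show ?thesis using assms(1) \<open>y \<in> V\<close> unfolding in_closure_of by blast
qed

lemma generic_point_pts: "generic_point X \<in> pts X"
  using integral unfolding integral_scheme_def by (intro generic_point_mem) auto

text \<open>A nonzero germ comes from a nonzero function on an open subset of a chart, which becomes
  invertible on a smaller nonempty open set; that set still contains \<eta>, so the inverse has a
  germ there.\<close>

lemma generic_stalk_field: "field (stalk X (generic_point X))"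
proof -
  let ?\<eta> = "generic_point X"
  interpret S: cring "stalk X ?\<eta>" by (rule stalk_cring[OF generic_point_pts])
  have ne: "V \<noteq> {}" if "?\<eta> \<in> V" for V using that by blast
  show ?thesis
  proof (rule S.cring_fieldI2)
    show "\<zero>\<^bsub>stalk X ?\<eta>\<^esub> \<noteq> \<one>\<^bsub>stalk X ?\<eta>\<^esub>"
    proof
      interpret P: cring "rsec X (pts X)" by (rule rsec_cring) simp
      assume "\<zero>\<^bsub>stalk X ?\<eta>\<^esub> = \<one>\<^bsub>stalk X ?\<eta>\<^esub>"
      then have "rgerm X ?\<eta> (pts X) \<zero>\<^bsub>rsec X (pts X)\<^esub> = rgerm X ?\<eta> (pts X) \<one>\<^bsub>rsec X (pts X)\<^esub>"
        unfolding stalk_def by simp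
      then obtain W where W: "opn X W" "?\<eta> \<in> W" "W \<subseteq> pts X"
        "rres X (pts X) W \<zero>\<^bsub>rsec X (pts X)\<^esub> = rres X (pts X) W \<one>\<^bsub>rsec X (pts X)\<^esub>"
        by (rule rgerm_eqD[OF _ openin_topspace generic_point_pts P.one_closed])
      interpret W: domain "rsec X W" by (rule rsec_domain[OF W(1) ne[OF W(2)]])
      show False using W by (simp add: rres_zero rres_one)
    qed
    fix A assume A: "A \<in> carrier (stalk X ?\<eta>)" "A \<noteq> \<zero>\<^bsub>stalk X ?\<eta>\<^esub>"
    obtain V a where V: "opn X V" "?\<eta> \<in> V" and a: "a \<in> carrier (rsec X V)" "A = rgerm X ?\<eta> V a"
      using stalk_rep[OF A(1)] .
    obtain U h \<phi> where "affine_chart X U h \<phi>" and \<eta>U: "?\<eta> \<in> U"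
      using affine_chartE[OF generic_point_pts] .
    then interpret affine_chart X U h \<phi> by simp
    let ?W = "V \<inter> U"
    have W: "opn X ?W" "?\<eta> \<in> ?W" "?W \<subseteq> V" "?W \<subseteq> U" using V chart_open \<eta>U by auto
    let ?a = "rres X V ?W a"
    have ac: "?a \<in> carrier (rsec X ?W)" by (rule rres_closed[OF V(1) W(1,3) a(1)])
    have Aa: "A = rgerm X ?\<eta> ?W ?a" using rgerm_restrict[OF V(1) W(1,2,3) a(1)] a(2) by simp
    have nz: "?a \<noteq> \<zero>\<^bsub>rsec X ?W\<^esub>" 
    proof
      assume "?a = \<zero>\<^bsub>rsec X ?W\<^esub>"
      then show False using A(2) unfolding Aa stalk_const(2)[OF W(1,2)] by simp
    qed
    obtain W' b where W': "opn X W'" "W' \<subseteq> ?W" "W' \<noteq> {}" "b \<in> carrier (rsec X W')"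
      "rres X ?W W' ?a \<otimes>\<^bsub>rsec X W'\<^esub> b = \<one>\<^bsub>rsec X W'\<^esub>"
      using chart_local_inverse[OF W(1,4) ac nz ne[OF W(2)]] .
    have \<eta>: "?\<eta> \<in> W'" by (rule generic_point_mem[OF W'(1,3)])
    have "A \<otimes>\<^bsub>stalk X ?\<eta>\<^esub> rgerm X ?\<eta> W' b = \<one>\<^bsub>stalk X ?\<eta>\<^esub>"
      using stalk_simps(1)[OF W'(1) \<eta> rres_closed[OF W(1) W'(1,2) ac] W'(4)]
        rgerm_restrict[OF W(1) W'(1) \<eta> W'(2) ac] W'(5) stalk_const(1)[OF W'(1) \<eta>] Aa by simp
    then show "\<exists>B\<in>carrier (stalk X ?\<eta>). A \<otimes>\<^bsub>stalk X ?\<eta>\<^esub> B = \<one>\<^bsub>stalk X ?\<eta>\<^esub>"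
      using rgerm_closed[OF W'(1) \<eta> W'(4)] by blast
  qed
qed

end


section \<open>Modules over a field\<close>

lemma (in module) submodule_finsum:
  assumes N: "submodule R N M" and f: "f \<in> {..<n::nat} \<rightarrow> N"
  shows "finsum M f {..<n} \<in> N"
  using f
proof (induction n)
  case 0
  show ?case using submodule.zero_closed[OF N] by simp
next
  case (Suc n)
  have sub: "N \<subseteq> carrier M" by (rule submodule.subset[OF N])
  have f: "f \<in> {..<n} \<rightarrow> N" "f n \<in> N" using Suc.prems by auto
  then have "f \<in> {..<n} \<rightarrow> carrier M" "f n \<in> carrier M" using sub by auto
  then show ?case
    using submodule.m_closed[OF N f(2) Suc.IH[OF f(1)]] by (simp add: lessThan_Suc M.finsum_insert)
qed

text \<open>A basis of \<open>V\<close> has an independent image with as many elements. If this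
  number were at least the dimension of \<open>W\<close>, the image would be a basis of
  \<open>W\<close>, and \<open>T\<close> would be onto, against \<open>ns\<close>.\<close>

lemma (in linear_map) injective_dim_less:
  assumes inj: "inj_on T (carrier V)" and fd: "V.fin_dim" "W.fin_dim"
    and ns: "T ` carrier V \<noteq> carrier W"
  shows "V.dim < W.dim"
proof -
  obtain B where B: "finite B" "V.basis B" using V.finite_basis_exists[OF fd(1)] by blast
  have BV: "B \<subseteq> carrier V" using B(2) unfolding V.basis_def by blast
  have sub: "submodule K imT W" using im_is_submodule .
  have im: "imT = T ` carrier V" unfolding im_def ..
  \<comment> \<open>The image of a basis is a basis when the map is bijective, so the range is first
    taken as a vector space of its own. Independence is then transferred from the range to
    \<open>W\<close>.\<close>
  have vs: "vectorspace K (W.vs imT)" by (rule W.subspace_is_vs[OF imT_is_subspace])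
  have "T \<in> module_hom K V (W.vs imT)" unfolding module_hom_def im by auto
  then have "linear_map K V (W.vs imT) T"
    using vs V.vectorspace_axioms
    by (auto simp: linear_map_def mod_hom_def mod_hom_axioms_def vectorspace_def)
  then interpret I: linear_map K V "W.vs imT" T .
  have "I.W.basis (T ` B)"
    by (rule I.linear_inj_image_is_basis[OF inj _ B(2) fd(1)]) (simp add: im)
  then have TB: "T ` B \<subseteq> imT" and li: "\<not> I.W.module.lin_dep (T ` B)"
    unfolding I.W.basis_def by auto
  have li: "\<not> W.module.lin_dep (T ` B)" using li W.module.span_li_not_depend(2)[OF TB sub] by simp
  have TBW: "T ` B \<subseteq> carrier W" using BV by auto
  have card: "card (T ` B) = V.dim"
    using card_image[OF inj_on_subset[OF inj BV]] V.dim_basis[OF B] by simp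
  show ?thesis
  proof (rule ccontr)
    assume "\<not> ?thesis"
    then have "W.basis (T ` B)"
      using card B(1) by (intro W.dim_li_is_basis[OF fd(2) _ TBW li]) auto
    then have "carrier W \<subseteq> imT"
      using W.module.span_is_subset[OF TB sub] unfolding W.basis_def by auto
    then show False using ns unfolding im by auto
  qed
qed


section \<open>Coherent subsheaves of a locally free sheaf\<close>

locale integral_module = integral_space X + module_sheaf X F
  for X :: "('x, 'r, 'z) rspace_scheme" and F :: "('x, 'r, 'm) omod"
begin

lemma generic_vectorspace:
  "vectorspace (stalk X (generic_point X)) (mstalk X F (generic_point X))"
  unfolding vectorspace_def using mstalk_module[OF generic_point_pts] generic_stalk_field by blast

text \<open>The germs at \<eta> of local generators span: a section near \<eta> is a combination of
  them after shrinking around \<eta>, and taking germs commutes with finite sums and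
  scalars.\<close>

lemma generic_fin_dim:
  assumes ft: "finite_type X F"
  shows "vectorspace.fin_dim (stalk X (generic_point X)) (mstalk X F (generic_point X))"
proof -
  let ?\<eta> = "generic_point X"
  interpret vectorspace "stalk X ?\<eta>" "mstalk X F ?\<eta>" by (rule generic_vectorspace)
  obtain U n s where U: "opn X U" "?\<eta> \<in> U" "s \<in> {..<n} \<rightarrow> mcar F U"
    and gen: "\<forall>V t y. opn X V \<and> V \<subseteq> U \<and> t \<in> mcar F V \<and> y \<in> V \<longrightarrow>
           (\<exists>W a. opn X W \<and> y \<in> W \<and> W \<subseteq> V \<and> a \<in> {..<n} \<rightarrow> carrier (rsec X W) \<and>
              mres F V W t = lin_comb F U W n a s)"
    using ft[unfolded finite_type_def, rule_format, OF generic_point_pts]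
    by (elim exE conjE) (rule that, assumption+)
  let ?G = "(\<lambda>i. mgerm X F ?\<eta> U (s i)) ` {..<n}"
  have G: "?G \<subseteq> carrier (mstalk X F ?\<eta>)" using U by (auto intro!: mgerm_closed)
  have "A \<in> span ?G" if A: "A \<in> carrier (mstalk X F ?\<eta>)" for A
  proof -
    obtain V t where V: "opn X V" "?\<eta> \<in> V" "t \<in> mcar F V" "A = mgerm X F ?\<eta> V t"
      using mstalk_rep[OF A] .
    let ?V = "V \<inter> U"
    have VU: "opn X ?V" "?\<eta> \<in> ?V" "?V \<subseteq> U" "?V \<subseteq> V" using V U by auto
    have t: "mres F V ?V t \<in> mcar F ?V" by (rule mres_closed[OF V(1) VU(1,4) V(3)])
    obtain W a where W: "opn X W" "?\<eta> \<in> W" "W \<subseteq> ?V" "a \<in> {..<n} \<rightarrow> carrier (rsec X W)"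
      "mres F ?V W (mres F V ?V t) = lin_comb F U W n a s"
      using gen[rule_format, OF conjI[OF VU(1) conjI[OF VU(3) conjI[OF t VU(2)]]]]
      by (elim exE conjE) (rule that, assumption+)
    have WU: "W \<subseteq> U" using W(3) by blast
    interpret W: module "rsec X W" "msec F W" by (rule msec_module[OF W(1)])
    have sW: "mres F U W (s i) \<in> mcar F W" "a i \<in> carrier (rsec X W)" "s i \<in> mcar F U" if "i < n" for i
      using U(3) W(4) that by (auto intro!: mres_closed[OF U(1) W(1) WU])
    have "A = mgerm X F ?\<eta> W (mres F ?V W (mres F V ?V t))"
      using mgerm_restrict[OF VU(1) W(1,2,3) t] mgerm_restrict[OF V(1) VU(1,2,4) V(3)] V(4) by simp
    also have "\<dots> = finsum (mstalk X F ?\<eta>) (\<lambda>i. mgerm X F ?\<eta> W (a i \<odot>\<^bsub>msec F W\<^esub> mres F U W (s i))) {..<n}"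
      unfolding W(5) lin_comb_def using sW by (intro mgerm_finsum W) auto
    also have "\<dots> \<in> span ?G"
    proof (rule submodule_finsum[OF span_is_submodule[OF G]], rule Pi_I)
      fix i assume "i \<in> {..<n}"
      then have i: "i < n" by simp
      have "mgerm X F ?\<eta> W (a i \<odot>\<^bsub>msec F W\<^esub> mres F U W (s i)) =
          rgerm X ?\<eta> W (a i) \<odot>\<^bsub>mstalk X F ?\<eta>\<^esub> mgerm X F ?\<eta> U (s i)"
        using mstalk_smult[OF W(1,2) sW(2)[OF i] sW(1)[OF i]]
          mgerm_restrict[OF U(1) W(1,2) WU sW(3)[OF i]] by simp
      moreover have "mgerm X F ?\<eta> U (s i) \<in> span ?G" using in_own_span[OF G] i by blast
      ultimately show "mgerm X F ?\<eta> W (a i \<odot>\<^bsub>msec F W\<^esub> mres F U W (s i)) \<in> span ?G"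
        using submodule.smult_closed[OF span_is_submodule[OF G] rgerm_closed[OF W(1,2) sW(2)[OF i]]]
        by simp
    qed
    finally show ?thesis .
  qed
  then have "span ?G = carrier (mstalk X F ?\<eta>)" using span_is_subset2[OF G] by blast
  then show ?thesis unfolding fin_dim_def using G by (intro exI[of _ ?G]) simp
qed

text \<open>Around each point the two sections are compared in a frame. On the overlap with
  \<open>W\<close> their coordinates agree by uniqueness of coordinates, hence they agree already
  before restriction, by injectivity for functions.\<close>

lemma mres_eqI:
  assumes lf: "locally_free X F" and V: "opn X V" and W: "opn X W" "W \<subseteq> V" "W \<noteq> {}"
    and s: "s \<in> mcar F V" and t: "t \<in> mcar F V"
    and eq: "mres F V W s = mres F V W t"
  shows "s = t"
proof (rule sheaf_separated[OF msec_sheaf V s t])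
  fix y assume y: "y \<in> V"
  then have "y \<in> pts X" using openin_subset[OF V] by blast
  then obtain U n e where U: "opn X U" "y \<in> U" and fr: "frame X F U n e"
    using lf unfolding locally_free_def by blast
  let ?V = "V \<inter> U" and ?W = "W \<inter> U"
  have o: "opn X ?V" "opn X ?W" "?W \<noteq> {}" "?W \<subseteq> ?V" "?V \<subseteq> U" "?V \<subseteq> V" "?W \<subseteq> W" "?W \<subseteq> U"
    using V W U opens_meet[OF W(1,3) U(1)] by auto
  have e: "e \<in> {..<n} \<rightarrow> mcar F U" using fr unfolding frame_def by blast
  have coord: "\<exists>!a. a \<in> {..<n} \<rightarrow>\<^sub>E carrier (rsec X Y) \<and> lin_comb F U Y n a e = u"
    if "opn X Y" "Y \<subseteq> U" "u \<in> mcar F Y" for Y u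
    using fr that unfolding frame_def by simp
  have sV: "mres F V ?V s \<in> mcar F ?V" and tV: "mres F V ?V t \<in> mcar F ?V"
    using mres_closed[OF V o(1,6)] s t by auto
  obtain a where a: "a \<in> {..<n} \<rightarrow>\<^sub>E carrier (rsec X ?V)" "lin_comb F U ?V n a e = mres F V ?V s"
    using ex1_implies_ex[OF coord[OF o(1,5) sV]] by (elim exE conjE)
  obtain b where b: "b \<in> {..<n} \<rightarrow>\<^sub>E carrier (rsec X ?V)" "lin_comb F U ?V n b e = mres F V ?V t"
    using ex1_implies_ex[OF coord[OF o(1,5) tV]] by (elim exE conjE)
  \<comment> \<open>Uniqueness of coordinates holds among extensional families, so restricted
    coordinates are made extensional before they are compared.\<close>
  let ?r = "\<lambda>a. \<lambda>i\<in>{..<n}. rres X ?V ?W (a i)"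
  have r: "?r c \<in> {..<n} \<rightarrow>\<^sub>E carrier (rsec X ?W)" "lin_comb F U ?W n (?r c) e = mres F ?V ?W (lin_comb F U ?V n c e)"
    if c: "c \<in> {..<n} \<rightarrow>\<^sub>E carrier (rsec X ?V)" for c
  proof -
    have c': "c \<in> {..<n} \<rightarrow> carrier (rsec X ?V)" using c by (simp add: PiE_def)
    have rc: "rres X ?V ?W (c i) \<in> carrier (rsec X ?W)" if "i < n" for i
      using rres_closed[OF o(1,2,4)] c' that by auto
    then show "?r c \<in> {..<n} \<rightarrow>\<^sub>E carrier (rsec X ?W)" by auto
    have "lin_comb F U ?W n (?r c) e = lin_comb F U ?W n (\<lambda>i. rres X ?V ?W (c i)) e"
      using rc by (intro lin_comb_cong[OF U(1) o(2,8) _ e]) auto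
    then show "lin_comb F U ?W n (?r c) e = mres F ?V ?W (lin_comb F U ?V n c e)"
      using mres_lin_comb[OF U(1) o(1,2,5,4) c' e] by simp
  qed
  have res: "mres F ?V ?W (mres F V ?V u) = mres F W ?W (mres F V W u)" if "u \<in> mcar F V" for u
    using mres_comp[OF V o(1,2,4,6) that] mres_comp[OF V W(1) o(2,7) W(2) that] by simp
  have tW: "mres F W ?W (mres F V W t) \<in> mcar F ?W"
    using mres_closed[OF W(1) o(2,7) mres_closed[OF V W(1,2) t]] .
  have lc: "lin_comb F U ?W n (?r a) e = mres F W ?W (mres F V W t)"
    "lin_comb F U ?W n (?r b) e = mres F W ?W (mres F V W t)"
    using r(2)[OF a(1)] r(2)[OF b(1)] a(2) b(2) res[OF s] res[OF t] eq by simp_all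
  have "?r a = ?r b"
    using the1_equality[OF coord[OF o(2,8) tW], of "?r a", OF conjI[OF r(1)[OF a(1)] lc(1)]]
      the1_equality[OF coord[OF o(2,8) tW], of "?r b", OF conjI[OF r(1)[OF b(1)] lc(2)]]
    by (rule trans[OF sym])
  have "a = b"
  proof (rule PiE_ext[OF a(1) b(1)])
    fix i assume i: "i \<in> {..<n}"
    then have "rres X ?V ?W (a i) = rres X ?V ?W (b i)" using fun_cong[OF \<open>?r a = ?r b\<close>, of i] by simp
    then show "a i = b i"
      using PiE_mem[OF a(1) i] PiE_mem[OF b(1) i] by (rule rres_eqI[OF o(1,2,4,3), rotated -1])
  qed
  then have "mres F V ?V s = mres F V ?V t" using a(2) b(2) by simp
  then show "\<exists>W. opn X W \<and> y \<in> W \<and> W \<subseteq> V \<and> mres F V W s = mres F V W t"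
    using o y U by blast
qed

end

section \<open>Germs of a subsheaf\<close>

lemma sub_omod_simps:
  "carrier (msec (sub_omod F F') U) = F' U"
  "add (msec (sub_omod F F') U) = add (msec F U)"
  "zero (msec (sub_omod F F') U) = zero (msec F U)"
  "smult (msec (sub_omod F F') U) = smult (msec F U)"
  "mres (sub_omod F F') = mres F"
  unfolding sub_omod_def by simp_all

text \<open>A germ of the subsheaf consists of representatives in \<open>F'\<close> only, while the
  germ of the same section in \<open>F\<close> may have more. The inclusion of stalks is thus not
  the identity on sets; the union is over equal germs.\<close>

definition germ_inclusion ::
  "('x, 'r, 'z) rspace_scheme \<Rightarrow> ('x, 'r, 'm) omod \<Rightarrow> 'x \<Rightarrow> ('x set \<times> 'm) set \<Rightarrow> ('x set \<times> 'm) set" where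
  "germ_inclusion X F x A = (\<Union>(U, s)\<in>A. mgerm X F x U s)"

locale integral_submodule = integral_module X F
  for X :: "('x, 'r, 'z) rspace_scheme" and F :: "('x, 'r, 'm) omod" +
  fixes F' :: "'x set \<Rightarrow> 'm set"
  assumes coherent_sub: "coherent_subsheaf X F F'"

sublocale integral_submodule \<subseteq> S: integral_module X "sub_omod F F'"
  using coherent_sub unfolding coherent_subsheaf_def coherent_def by unfold_locales blast

context integral_submodule
begin

lemma sub_carrier: "opn X U \<Longrightarrow> s \<in> F' U \<Longrightarrow> s \<in> mcar F U"
  using coherent_sub unfolding coherent_subsheaf_def by blast

text \<open>A finite sum depends on the carrier of its record, so the two sums are compared by
  induction instead of by unfolding \<open>sub_omod\<close>.\<close>

lemma sub_finsum:
  assumes U: "opn X U" and f: "f \<in> {..<n::nat} \<rightarrow> F' U"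
  shows "finsum (msec (sub_omod F F') U) f {..<n} = finsum (msec F U) f {..<n}"
  using f
proof (induction n)
  case 0
  interpret U: module "rsec X U" "msec F U" by (rule msec_module[OF U])
  interpret U': module "rsec X U" "msec (sub_omod F F') U" by (rule S.msec_module[OF U])
  show ?case by (simp add: sub_omod_simps)
next
  case (Suc n)
  interpret U: module "rsec X U" "msec F U" by (rule msec_module[OF U])
  interpret U': module "rsec X U" "msec (sub_omod F F') U" by (rule S.msec_module[OF U])
  have f: "f \<in> {..<n} \<rightarrow> F' U" "f n \<in> F' U" using Suc.prems by auto
  have "f \<in> {..<n} \<rightarrow> mcar F U" "f n \<in> mcar F U" using f sub_carrier[OF U] by auto
  then show ?case
    using f Suc.IH[OF f(1)]
    by (simp add: lessThan_Suc U.M.finsum_insert U'.M.finsum_insert sub_omod_simps)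
qed

lemma sub_lin_comb:
  assumes "opn X U" "opn X V" "V \<subseteq> U" "a \<in> {..<n} \<rightarrow> carrier (rsec X V)" "s \<in> {..<n} \<rightarrow> F' U"
  shows "lin_comb (sub_omod F F') U V n a s = lin_comb F U V n a s"
proof -
  interpret V': module "rsec X V" "msec (sub_omod F F') V" by (rule S.msec_module[OF assms(2)])
  have "a i \<odot>\<^bsub>msec F V\<^esub> mres F U V (s i) \<in> F' V" if "i < n" for i
    using V'.smult_closed[of "a i" "mres F U V (s i)"] S.mres_closed[OF assms(1-3), of "s i"] assms(4,5) that
    by (auto simp: sub_omod_simps Pi_iff)
  then show ?thesis
    unfolding lin_comb_def sub_omod_simps by (intro sub_finsum[OF assms(2)]) auto
qed

lemma germ_inclusion_mgerm:
  assumes U: "opn X U" "x \<in> U" "s \<in> F' U"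
  shows "germ_inclusion X F x (mgerm X (sub_omod F F') x U s) = mgerm X F x U s"
proof -
  let ?A = "mgerm X (sub_omod F F') x U s"
  have self: "(U, s) \<in> ?A"
    unfolding mgerm_def using mem_germ_self[OF U(1,2), of s "mcar (sub_omod F F')"] U(3)
    by (simp add: sub_omod_simps)
  have *: "mgerm X F x V t = mgerm X F x U s" if Vt: "(V, t) \<in> ?A" for V t
  proof -
    obtain W where V: "opn X V" "t \<in> F' V"
      and W: "opn X W" "x \<in> W" "W \<subseteq> U" "W \<subseteq> V" "mres F U W s = mres F V W t"
      using Vt unfolding mgerm_def germ_def sub_omod_simps by blast
    show ?thesis
      using mgerm_eqI[OF V(1) sub_carrier[OF V] U(1) sub_carrier[OF U(1,3)] W(1,2,4,3) W(5)[symmetric]] .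
  qed
  then have "(\<Union>(V, t)\<in>?A. mgerm X F x V t) = (\<Union>p\<in>?A. mgerm X F x U s)"
    by (intro SUP_cong) auto
  then show ?thesis unfolding germ_inclusion_def using self by auto
qed

lemma germ_inclusion_hom:
  assumes x: "x \<in> pts X"
  shows "mod_hom (stalk X x) (mstalk X (sub_omod F F') x) (mstalk X F x) (germ_inclusion X F x)"
proof -
  let ?M = "mstalk X (sub_omod F F') x"
  have "germ_inclusion X F x \<in> module_hom (stalk X x) ?M (mstalk X F x)"
    unfolding module_hom_def
  proof (intro CollectI conjI allI impI Pi_I)
    fix A assume "A \<in> carrier ?M"
    then obtain U s where U: "opn X U" "x \<in> U" "s \<in> mcar (sub_omod F F') U"
      "A = mgerm X (sub_omod F F') x U s" by (rule S.mstalk_rep)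
    then have s: "s \<in> F' U" by (simp add: sub_omod_simps)
    show "germ_inclusion X F x A \<in> carrier (mstalk X F x)"
      using germ_inclusion_mgerm[OF U(1,2) s] mgerm_closed[OF U(1,2) sub_carrier[OF U(1) s]] U(4) by simp
  next
    fix A B assume "A \<in> carrier ?M \<and> B \<in> carrier ?M"
    then have "A \<in> carrier ?M" "B \<in> carrier ?M" by auto
    from S.mstalk_rep3[OF this this(2)] obtain U s t where U: "opn X U" "x \<in> U"
      and st: "s \<in> mcar (sub_omod F F') U" "t \<in> mcar (sub_omod F F') U"
      "A = mgerm X (sub_omod F F') x U s" "B = mgerm X (sub_omod F F') x U t" by metis
    have s: "s \<in> F' U" "t \<in> F' U" using st by (simp_all add: sub_omod_simps)
    interpret U': module "rsec X U" "msec (sub_omod F F') U" by (rule S.msec_module[OF U(1)])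
    have "s \<oplus>\<^bsub>msec F U\<^esub> t \<in> F' U" using U'.M.a_closed[OF st(1,2)] by (simp add: sub_omod_simps)
    then show "germ_inclusion X F x (A \<oplus>\<^bsub>?M\<^esub> B) =
        germ_inclusion X F x A \<oplus>\<^bsub>mstalk X F x\<^esub> germ_inclusion X F x B"
      using S.mstalk_add[OF U st(1,2)] mstalk_add[OF U sub_carrier[OF U(1) s(1)] sub_carrier[OF U(1) s(2)]]
      by (simp add: st(3,4) germ_inclusion_mgerm[OF U] s sub_omod_simps)
  next
    fix a A assume "a \<in> carrier (stalk X x) \<and> A \<in> carrier ?M"
    then have "a \<in> carrier (stalk X x)" "A \<in> carrier ?M" by auto
    from S.mstalk_rep_smult_add[OF this this(2)] obtain U b s where U: "opn X U" "x \<in> U"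
      and st: "b \<in> carrier (rsec X U)" "s \<in> mcar (sub_omod F F') U"
      "a = rgerm X x U b" "A = mgerm X (sub_omod F F') x U s" by metis
    have s: "s \<in> F' U" using st by (simp add: sub_omod_simps)
    interpret U': module "rsec X U" "msec (sub_omod F F') U" by (rule S.msec_module[OF U(1)])
    have "b \<odot>\<^bsub>msec F U\<^esub> s \<in> F' U" using U'.smult_closed[OF st(1,2)] by (simp add: sub_omod_simps)
    then show "germ_inclusion X F x (a \<odot>\<^bsub>?M\<^esub> A) = a \<odot>\<^bsub>mstalk X F x\<^esub> germ_inclusion X F x A"
      using S.mstalk_smult[OF U st(1,2)] mstalk_smult[OF U st(1) sub_carrier[OF U(1) s]]
      by (simp add: st(3,4) germ_inclusion_mgerm[OF U] s sub_omod_simps)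
  qed
  then show ?thesis
    using S.mstalk_module[OF x] mstalk_module[OF x] by (simp add: mod_hom_def mod_hom_axioms_def)
qed

text \<open>Germs with the same image agree on some neighbourhood \<open>W\<close> as sections of
  \<open>F\<close>. As the restriction maps are inherited, the same equation holds in the
  subsheaf.\<close>

lemma germ_inclusion_inj: "inj_on (germ_inclusion X F x) (carrier (mstalk X (sub_omod F F') x))"
proof (rule inj_onI)
  fix A B assume AB: "A \<in> carrier (mstalk X (sub_omod F F') x)" "B \<in> carrier (mstalk X (sub_omod F F') x)"
    and eq: "germ_inclusion X F x A = germ_inclusion X F x B"
  obtain U s where U: "opn X U" "x \<in> U" "s \<in> mcar (sub_omod F F') U" "A = mgerm X (sub_omod F F') x U s"
    using S.mstalk_rep[OF AB(1)] .
  obtain V t where V: "opn X V" "x \<in> V" "t \<in> mcar (sub_omod F F') V" "B = mgerm X (sub_omod F F') x V t"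
    using S.mstalk_rep[OF AB(2)] .
  have s: "s \<in> F' U" "t \<in> F' V" using U V by (simp_all add: sub_omod_simps)
  have "mgerm X F x U s = mgerm X F x V t"
    using eq unfolding U(4) V(4) germ_inclusion_mgerm[OF U(1,2) s(1)] germ_inclusion_mgerm[OF V(1,2) s(2)] .
  then obtain W where "opn X W" "x \<in> W" "W \<subseteq> U" "W \<subseteq> V" "mres F U W s = mres F V W t"
    using mgerm_eqD[OF _ V(1,2) sub_carrier[OF V(1) s(2)]] by metis
  then show "A = B"
    unfolding U(4) V(4) using S.mgerm_eqI[OF U(1,3) V(1,3)] by (simp add: sub_omod_simps)
qed

text \<open>This is the set by which \<open>saturated\<close> divides the stalk of
  \<open>F\<close>.\<close>

definition sub_germs :: "'x \<Rightarrow> ('x set \<times> 'm) set set" where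
  "sub_germs x = {mgerm X F x U s | U s. opn X U \<and> x \<in> U \<and> s \<in> F' U}"

text \<open>As the image of a linear map the set is a submodule, and surjectivity of the inclusion
  at \<eta> becomes a statement about germs.\<close>

lemma sub_germs_image: "sub_germs x = germ_inclusion X F x ` carrier (mstalk X (sub_omod F F') x)"
proof (intro equalityI subsetI)
  fix A assume "A \<in> sub_germs x"
  then obtain U s where U: "opn X U" "x \<in> U" "s \<in> F' U" "A = mgerm X F x U s"
    unfolding sub_germs_def by blast
  have "mgerm X (sub_omod F F') x U s \<in> carrier (mstalk X (sub_omod F F') x)"
    using S.mgerm_closed[OF U(1,2)] U(3) by (simp add: sub_omod_simps)
  then show "A \<in> germ_inclusion X F x ` carrier (mstalk X (sub_omod F F') x)"
    using germ_inclusion_mgerm[OF U(1-3)] U(4) by (metis imageI)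
next
  fix A assume "A \<in> germ_inclusion X F x ` carrier (mstalk X (sub_omod F F') x)"
  then obtain B where B: "B \<in> carrier (mstalk X (sub_omod F F') x)" "A = germ_inclusion X F x B" by blast
  obtain U s where U: "opn X U" "x \<in> U" "s \<in> mcar (sub_omod F F') U" "B = mgerm X (sub_omod F F') x U s"
    using S.mstalk_rep[OF B(1)] .
  have "s \<in> F' U" using U by (simp add: sub_omod_simps)
  then show "A \<in> sub_germs x"
    using germ_inclusion_mgerm[OF U(1,2)] U B(2) unfolding sub_germs_def by auto
qed

lemma sub_germs_submodule:
  assumes "x \<in> pts X"
  shows "submodule (stalk X x) (sub_germs x) (mstalk X F x)"
proof -
  interpret mod_hom "stalk X x" "mstalk X (sub_omod F F') x" "mstalk X F x" "germ_inclusion X F x"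
    by (rule germ_inclusion_hom[OF assms])
  show ?thesis using im_is_submodule unfolding im_def sub_germs_image .
qed

text \<open>If \<open>a C\<close> lies in the submodule, then \<open>a\<close> annihilates the coset
  of \<open>C\<close>. Torsion-freeness makes this coset trivial, and \<open>C\<close> is one of its
  elements.\<close>

lemma saturatedD:
  assumes sat: "saturated X F F'" and x: "x \<in> pts X"
    and a: "a \<in> carrier (stalk X x)" "a \<noteq> \<zero>\<^bsub>stalk X x\<^esub>" and C: "C \<in> carrier (mstalk X F x)"
    and aC: "a \<odot>\<^bsub>mstalk X F x\<^esub> C \<in> sub_germs x"
  shows "C \<in> sub_germs x"
proof -
  let ?N = "sub_germs x"
  interpret M: module "stalk X x" "mstalk X F x" by (rule mstalk_module[OF x])
  interpret N: submodule "stalk X x" ?N "mstalk X F x" by (rule sub_germs_submodule[OF x])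
  have coset: "?N +>\<^bsub>mstalk X F x\<^esub> m = (\<lambda>n. n \<oplus>\<^bsub>mstalk X F x\<^esub> m) ` ?N" for m
    unfolding a_r_coset_def r_coset_def by auto
  \<comment> \<open>Scalar multiplication on the quotient is a union of cosets, and each of them has
    to be identified with \<open>?N\<close>. The negative of \<open>m\<close> lies in
    \<open>?N\<close> as a multiple by minus one.\<close>
  have coset_N: "?N +>\<^bsub>mstalk X F x\<^esub> m = ?N" if m: "m \<in> ?N" for m
  proof (intro equalityI subsetI)
    fix n assume n: "n \<in> ?N"
    have mc: "m \<in> carrier (mstalk X F x)" "n \<in> carrier (mstalk X F x)" using m n N.subset by auto
    have "\<ominus>\<^bsub>mstalk X F x\<^esub> m = (\<ominus>\<^bsub>stalk X x\<^esub> \<one>\<^bsub>stalk X x\<^esub>) \<odot>\<^bsub>mstalk X F x\<^esub> m"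
      using mc M.smult_l_minus[OF M.R.one_closed mc(1)] by simp
    then have "\<ominus>\<^bsub>mstalk X F x\<^esub> m \<in> ?N" using m by (simp add: N.smult_closed)
    then have "n \<oplus>\<^bsub>mstalk X F x\<^esub> \<ominus>\<^bsub>mstalk X F x\<^esub> m \<in> ?N" using n by simp
    moreover have "n = (n \<oplus>\<^bsub>mstalk X F x\<^esub> \<ominus>\<^bsub>mstalk X F x\<^esub> m) \<oplus>\<^bsub>mstalk X F x\<^esub> m"
      using mc by (simp add: M.M.a_assoc M.M.l_neg)
    ultimately show "n \<in> ?N +>\<^bsub>mstalk X F x\<^esub> m" unfolding coset by (rule image_eqI[rotated])
  qed (use m in \<open>auto simp: coset\<close>)
  let ?D = "?N +>\<^bsub>mstalk X F x\<^esub> C"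
  have CD: "C \<in> ?D" using C N.zero_closed M.M.l_zero[OF C] unfolding coset by (metis image_eqI)
  have "a \<odot>\<^bsub>mstalk X F x\<^esub> c \<in> ?N" if c: "c \<in> ?D" for c
  proof -
    obtain n where n: "n \<in> ?N" "c = n \<oplus>\<^bsub>mstalk X F x\<^esub> C" using c unfolding coset by (rule imageE)
    have nc: "n \<in> carrier (mstalk X F x)" using n N.subset by blast
    have "a \<odot>\<^bsub>mstalk X F x\<^esub> c = a \<odot>\<^bsub>mstalk X F x\<^esub> n \<oplus>\<^bsub>mstalk X F x\<^esub> a \<odot>\<^bsub>mstalk X F x\<^esub> C"
      unfolding n(2) by (rule M.smult_r_distr[OF a(1) nc C])
    then show ?thesis using N.m_closed[OF N.smult_closed[OF a(1) n(1)] aC] by simp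
  qed
  then have "(\<Union>c\<in>?D. ?N +>\<^bsub>mstalk X F x\<^esub> (a \<odot>\<^bsub>mstalk X F x\<^esub> c)) = (\<Union>c\<in>?D. ?N)"
    using coset_N by (intro SUP_cong) auto
  then have zero: "(\<Union>c\<in>?D. ?N +>\<^bsub>mstalk X F x\<^esub> (a \<odot>\<^bsub>mstalk X F x\<^esub> c)) = ?N" using CD by auto
  have D: "?D \<in> a_rcosets\<^bsub>mstalk X F x\<^esub> ?N"
    using C unfolding A_RCOSETS_def' by blast
  have "torsion_free (stalk X x) (quot_module (mstalk X F x) ?N)"
    using sat x unfolding saturated_def sub_germs_def by blast
  then have "\<forall>a\<in>carrier (stalk X x). \<forall>C\<in>a_rcosets\<^bsub>mstalk X F x\<^esub> ?N.
      (\<Union>c\<in>C. ?N +>\<^bsub>mstalk X F x\<^esub> (a \<odot>\<^bsub>mstalk X F x\<^esub> c)) = ?N \<longrightarrow> a = \<zero>\<^bsub>stalk X x\<^esub> \<or> C = ?N"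
    unfolding torsion_free_def quot_module_def by simp
  from bspec[OF bspec[OF this a(1)] D] have "?D = ?N" using zero a(2) by simp
  then show ?thesis using CD by simp
qed

text \<open>\<open>U0\<close> carries generators of the subsheaf around \<open>x\<close>, and
  \<open>U1\<close> is a chart around \<open>x\<close>; \<eta> lies in both. A relation is found
  near \<eta>, but it is arranged to involve only data defined on the neighbourhood
  \<open>?Q\<close> of \<open>x\<close>, so that it can be extended to \<open>?Q\<close>.\<close>

lemma mgerm_in_sub_germs:
  assumes lf: "locally_free X F" and sat: "saturated X F F'"
    and gen: "carrier (mstalk X F (generic_point X)) \<subseteq> sub_germs (generic_point X)"
    and V: "opn X V" "x \<in> V" and s: "s \<in> mcar F V"
  shows "mgerm X F x V s \<in> sub_germs x"
proof -
  let ?\<eta> = "generic_point X"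
  have x: "x \<in> pts X" using V openin_subset by blast
  have "finite_type X (sub_omod F F')"
    using coherent_sub unfolding coherent_subsheaf_def coherent_def by blast
  from this[unfolded finite_type_def, rule_format, OF x]
  obtain U0 n g where U0: "opn X U0" "x \<in> U0" "g \<in> {..<n} \<rightarrow> mcar (sub_omod F F') U0"
    and ft: "\<forall>V t y. opn X V \<and> V \<subseteq> U0 \<and> t \<in> mcar (sub_omod F F') V \<and> y \<in> V \<longrightarrow>
           (\<exists>W a. opn X W \<and> y \<in> W \<and> W \<subseteq> V \<and> a \<in> {..<n} \<rightarrow> carrier (rsec X W) \<and>
              mres (sub_omod F F') V W t = lin_comb (sub_omod F F') U0 W n a g)"
    by (elim exE conjE) (rule that, assumption+)
  have g': "g \<in> {..<n} \<rightarrow> F' U0" using U0(3) by (simp add: sub_omod_simps)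
  have g: "g \<in> {..<n} \<rightarrow> mcar F U0" using g' sub_carrier[OF U0(1)] by blast
  obtain U1 h \<phi> where "affine_chart X U1 h \<phi>" and xU1: "x \<in> U1"
    using affine_chartE[OF x] .
  then interpret U1: affine_chart X U1 h \<phi> by simp
  let ?Q = "V \<inter> U0 \<inter> U1"
  have Q: "opn X ?Q" "x \<in> ?Q" "?Q \<subseteq> V" "?Q \<subseteq> U0" "?Q \<subseteq> U1"
    using V U0 U1.chart_open xU1 by auto
  have \<eta>Q: "?\<eta> \<in> ?Q" using generic_point_mem[OF Q(1)] Q(2) by blast
  have \<eta>V: "?\<eta> \<in> V" using \<eta>Q by blast
  have "mgerm X F ?\<eta> V s \<in> sub_germs ?\<eta>" using gen mgerm_closed[OF V(1) \<eta>V s] by blast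
  then obtain U' s' where U': "opn X U'" "?\<eta> \<in> U'" "s' \<in> F' U'" and "mgerm X F ?\<eta> U' s' = mgerm X F ?\<eta> V s"
    unfolding sub_germs_def by auto
  then obtain W1 where W1: "opn X W1" "?\<eta> \<in> W1" "W1 \<subseteq> U'" "W1 \<subseteq> V" "mres F U' W1 s' = mres F V W1 s"
    using mgerm_eqD[OF _ V(1) \<eta>V s] by metis
  let ?W = "W1 \<inter> ?Q"
  have W: "opn X ?W" "?\<eta> \<in> ?W" "?W \<subseteq> U0" "?W \<subseteq> U'" "?W \<subseteq> V" "?W \<subseteq> W1"
    using W1 Q \<eta>Q by auto
  have s'W: "mres F U' ?W s' = mres F V ?W s"
    using mres_comp[OF U'(1) W1(1) W(1,6) W1(3) sub_carrier[OF U'(1,3)]]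
      mres_comp[OF V(1) W1(1) W(1,6) W1(4) s] W1(5) by simp
  have "mres F V ?W s \<in> mcar (sub_omod F F') ?W"
    using S.mres_closed[OF U'(1) W(1,4), of s'] U'(3) unfolding sub_omod_simps s'W by simp
  \<comment> \<open>The generators were chosen around \<open>x\<close>, but they generate near every
    point of \<open>U0\<close>; here this is applied at \<eta>.\<close>
  from ft[rule_format, OF conjI[OF W(1) conjI[OF W(3) conjI[OF this W(2)]]]]
  obtain W2 a where W2: "opn X W2" "?\<eta> \<in> W2" "W2 \<subseteq> ?W" "a \<in> {..<n} \<rightarrow> carrier (rsec X W2)"
    "mres (sub_omod F F') ?W W2 (mres F V ?W s) = lin_comb (sub_omod F F') U0 W2 n a g"
    by (elim exE conjE) (rule that, assumption+)
  have W2s: "W2 \<subseteq> U0" "W2 \<subseteq> U1" "W2 \<subseteq> V" "W2 \<noteq> {}" using W2 by auto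
  have s2: "mres F V W2 s = lin_comb F U0 W2 n a g"
    using W2(5) mres_comp[OF V(1) W(1) W2(1,3) W(5) s] sub_lin_comb[OF U0(1) W2(1) W2s(1) W2(4) g']
    by (simp add: sub_omod_simps)
  \<comment> \<open>The coefficients \<open>a\<close> exist only on \<open>W2\<close>, which may
    avoid \<open>x\<close>, whereas \<open>b\<close> and \<open>a'\<close> are functions on
    \<open>U1\<close>, which contains \<open>x\<close>.\<close>
  from U1.chart_common_denominator[OF W2(1) W2s(2,4) W2(4)]
  obtain W3 a' b where W3: "opn X W3" "W3 \<subseteq> W2" "W3 \<noteq> {}" "a' \<in> {..<n} \<rightarrow> carrier (rsec X U1)"
    "b \<in> carrier (rsec X U1)" "b \<noteq> \<zero>\<^bsub>rsec X U1\<^esub>"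
    "\<forall>i<n. rres X U1 W3 b \<otimes>\<^bsub>rsec X W3\<^esub> rres X W2 W3 (a i) = rres X U1 W3 (a' i)"
    by (elim exE conjE) (rule that, assumption+)
  have W3s: "W3 \<subseteq> ?Q" "W3 \<subseteq> U0" "W3 \<subseteq> U1" "W3 \<subseteq> V" using W3(2) W2(3) by auto
  let ?b = "rres X U1 ?Q b" and ?s = "mres F V ?Q s" and ?a = "\<lambda>i. rres X U1 ?Q (a' i)"
  have b: "?b \<in> carrier (rsec X ?Q)" by (rule rres_closed[OF U1.chart_open Q(1,5) W3(5)])
  have sQ: "?s \<in> mcar F ?Q" by (rule mres_closed[OF V(1) Q(1,3) s])
  have aQ: "?a \<in> {..<n} \<rightarrow> carrier (rsec X ?Q)"
    using W3(4) by (auto intro!: rres_closed[OF U1.chart_open Q(1,5)])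
  have aW3: "(\<lambda>i. rres X W2 W3 (a i)) \<in> {..<n} \<rightarrow> carrier (rsec X W3)"
    using W2(4) by (auto intro!: rres_closed[OF W2(1) W3(1,2)])
  have a'W3: "(\<lambda>i. rres X ?Q W3 (?a i)) \<in> {..<n} \<rightarrow> carrier (rsec X W3)"
    using aQ by (auto intro!: rres_closed[OF Q(1) W3(1) W3s(1)])
  have bW3: "rres X ?Q W3 ?b = rres X U1 W3 b"
    by (rule rres_comp[OF U1.chart_open Q(1) W3(1) W3s(1) Q(5) W3(5)])
  interpret Q: module "rsec X ?Q" "msec F ?Q" by (rule msec_module[OF Q(1)])
  \<comment> \<open>Both sides are sections over \<open>?Q\<close>. It is enough to compare them on
    \<open>W3\<close>, where the equation is \<open>s2\<close> multiplied by the common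
    denominator.\<close>
  have "?b \<odot>\<^bsub>msec F ?Q\<^esub> ?s = lin_comb F U0 ?Q n ?a g"
  proof (rule mres_eqI[OF lf Q(1) W3(1) W3s(1) W3(3)])
    show "?b \<odot>\<^bsub>msec F ?Q\<^esub> ?s \<in> mcar F ?Q" using b sQ by simp
    show "lin_comb F U0 ?Q n ?a g \<in> mcar F ?Q" by (rule lin_comb_closed[OF U0(1) Q(1,4) aQ g])
    have "mres F ?Q W3 (?b \<odot>\<^bsub>msec F ?Q\<^esub> ?s) = rres X ?Q W3 ?b \<odot>\<^bsub>msec F W3\<^esub> mres F ?Q W3 ?s"
      by (rule mres_smult[OF Q(1) W3(1) W3s(1) b sQ])
    also have "mres F ?Q W3 ?s = mres F W2 W3 (mres F V W2 s)"
      using mres_comp[OF V(1) Q(1) W3(1) W3s(1) Q(3) s] mres_comp[OF V(1) W2(1) W3(1,2) W2s(3) s] by simp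
    also have "\<dots> = lin_comb F U0 W3 n (\<lambda>i. rres X W2 W3 (a i)) g"
      unfolding s2 by (rule mres_lin_comb[OF U0(1) W2(1) W3(1) W2s(1) W3(2) W2(4) g])
    also have "rres X ?Q W3 ?b \<odot>\<^bsub>msec F W3\<^esub> \<dots> =
        lin_comb F U0 W3 n (\<lambda>i. rres X ?Q W3 ?b \<otimes>\<^bsub>rsec X W3\<^esub> rres X W2 W3 (a i)) g"
      by (rule smult_lin_comb[OF U0(1) W3(1) W3s(2) aW3 g rres_closed[OF Q(1) W3(1) W3s(1) b]])
    also have "\<dots> = lin_comb F U0 W3 n (\<lambda>i. rres X ?Q W3 (?a i)) g"
    proof (rule lin_comb_cong[OF U0(1) W3(1) W3s(2) a'W3 g])
      fix i assume i: "i < n"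
      then have "a' i \<in> carrier (rsec X U1)" using W3(4) by auto
      from rres_comp[OF U1.chart_open Q(1) W3(1) W3s(1) Q(5) this]
      show "rres X ?Q W3 ?b \<otimes>\<^bsub>rsec X W3\<^esub> rres X W2 W3 (a i) = rres X ?Q W3 (?a i)"
        using W3(7) i bW3 by simp
    qed
    also have "\<dots> = mres F ?Q W3 (lin_comb F U0 ?Q n ?a g)"
      by (rule mres_lin_comb[OF U0(1) Q(1) W3(1) Q(4) W3s(1) aQ g, symmetric])
    finally show "mres F ?Q W3 (?b \<odot>\<^bsub>msec F ?Q\<^esub> ?s) = mres F ?Q W3 (lin_comb F U0 ?Q n ?a g)" .
  qed
  moreover have "lin_comb F U0 ?Q n ?a g \<in> F' ?Q"
    using S.lin_comb_closed[OF U0(1) Q(1,4) aQ U0(3)] sub_lin_comb[OF U0(1) Q(1,4) aQ g']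
    by (simp add: sub_omod_simps)
  ultimately have "?b \<odot>\<^bsub>msec F ?Q\<^esub> ?s \<in> F' ?Q" by simp
  then have "rgerm X x ?Q ?b \<odot>\<^bsub>mstalk X F x\<^esub> mgerm X F x ?Q ?s \<in> sub_germs x"
    unfolding mstalk_smult[OF Q(1,2) b sQ] sub_germs_def using Q(1,2) by blast
  then have "mgerm X F x ?Q ?s \<in> sub_germs x"
  proof (rule saturatedD[OF sat x rgerm_closed[OF Q(1,2) b] _ mgerm_closed[OF Q(1,2) sQ], rotated])
    \<comment> \<open>A zero germ at \<open>x\<close> would make \<open>b\<close> vanish on a
      nonempty open set, hence on all of \<open>U1\<close>, by injectivity of restriction.\<close>
    show "rgerm X x ?Q ?b \<noteq> \<zero>\<^bsub>stalk X x\<^esub>"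
    proof
      assume "rgerm X x ?Q ?b = \<zero>\<^bsub>stalk X x\<^esub>"
      then have "rgerm X x U1 b = rgerm X x U1 \<zero>\<^bsub>rsec X U1\<^esub>"
        using rgerm_restrict[OF U1.chart_open Q(1,2,5) W3(5)] stalk_const(2)[OF U1.chart_open xU1] by simp
      then obtain Y where Y: "opn X Y" "x \<in> Y" "Y \<subseteq> U1" "rres X U1 Y b = rres X U1 Y \<zero>\<^bsub>rsec X U1\<^esub>"
        using rgerm_eqD[OF _ U1.chart_open xU1 U1.A.zero_closed] by metis
      have "b = \<zero>\<^bsub>rsec X U1\<^esub>"
        using Y by (intro rres_eqI[OF U1.chart_open Y(1,3) _ W3(5) U1.A.zero_closed Y(4)]) blast
      then show False using W3(6) by simp
    qed
  qed
  then show ?thesis using mgerm_restrict[OF V(1) Q(1,2,3) s] by simp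
qed

text \<open>Germs in the subsheaf at every point mean that \<open>s\<close> restricts into
  \<open>F'\<close> locally. These pieces are glued in the sheaf \<open>F'\<close>, and
  separatedness of \<open>F\<close> identifies the result with \<open>s\<close>.\<close>

lemma generically_equal_imp_equal:
  assumes lf: "locally_free X F" and sat: "saturated X F F'"
    and gen: "carrier (mstalk X F (generic_point X)) \<subseteq> sub_germs (generic_point X)"
    and V: "opn X V"
  shows "F' V = mcar F V"
proof (intro equalityI subsetI)
  fix s assume s: "s \<in> mcar F V"
  let ?U = "{W. opn X W \<and> W \<subseteq> V \<and> mres F V W s \<in> F' W}"
  have "\<exists>W\<in>?U. x \<in> W" if x: "x \<in> V" for x
  proof -
    obtain U t where U: "opn X U" "x \<in> U" "t \<in> F' U" "mgerm X F x U t = mgerm X F x V s"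
      using mgerm_in_sub_germs[OF lf sat gen V x s] unfolding sub_germs_def by auto
    obtain W where W: "opn X W" "x \<in> W" "W \<subseteq> U" "W \<subseteq> V" "mres F U W t = mres F V W s"
      using mgerm_eqD[OF U(4) V x s] .
    have "mres F V W s \<in> F' W"
      using S.mres_closed[OF U(1) W(1,3), of t] U(3) unfolding sub_omod_simps W(5) by simp
    then show ?thesis using W by blast
  qed
  then have un: "\<Union>?U = V" by blast
  have sh: "sheaf (topo X) F' (mres F)"
    using S.msec_sheaf by (simp add: sub_omod_simps)
  have "\<exists>!t. t \<in> F' (\<Union>?U) \<and> (\<forall>U\<in>?U. mres F (\<Union>?U) U t = mres F V U s)"
  proof (rule sheaf_glue[OF sh])
    fix U W assume "U \<in> ?U" "W \<in> ?U"
    then have UW: "opn X U" "U \<subseteq> V" "opn X W" "W \<subseteq> V" "opn X (U \<inter> W)" by auto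
    show "mres F U (U \<inter> W) (mres F V U s) = mres F W (U \<inter> W) (mres F V W s)"
      using mres_comp[OF V UW(1,5) _ UW(2) s] mres_comp[OF V UW(3,5) _ UW(4) s] by simp
  qed simp_all
  then obtain t where t: "t \<in> F' V" "\<And>U. U \<in> ?U \<Longrightarrow> mres F V U t = mres F V U s"
    unfolding un by (auto dest: ex1_implies_ex)
  have "t = s"
  proof (rule sheaf_separated[OF msec_sheaf V sub_carrier[OF V t(1)] s])
    fix y assume "y \<in> V"
    then obtain W where "W \<in> ?U" "y \<in> W" using un by blast
    then show "\<exists>W. opn X W \<and> y \<in> W \<and> W \<subseteq> V \<and> mres F V W t = mres F V W s"
      using t(2) by blast
  qed
  then show "s \<in> F' V" using t(1) by simp
qed (rule sub_carrier[OF V])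

text \<open>Finite type of both sheaves makes the generic stalks finite-dimensional, so the two
  ranks are genuine dimensions and the comparison for injective maps that are not onto
  applies.\<close>

theorem rank_less:
  assumes lf: "locally_free X F" and ft: "finite_type X F" and sat: "saturated X F F'"
    and proper: "proper_nontrivial X F F'"
  shows "rank X (sub_omod F F') < rank X F"
proof -
  let ?\<eta> = "generic_point X"
  have "linear_map (stalk X ?\<eta>) (mstalk X (sub_omod F F') ?\<eta>) (mstalk X F ?\<eta>) (germ_inclusion X F ?\<eta>)"
    unfolding linear_map_def
    using generic_vectorspace S.generic_vectorspace germ_inclusion_hom[OF generic_point_pts] by blast
  then interpret linear_map "stalk X ?\<eta>" "mstalk X (sub_omod F F') ?\<eta>" "mstalk X F ?\<eta>" "germ_inclusion X F ?\<eta>" .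
  have ft': "finite_type X (sub_omod F F')"
    using coherent_sub unfolding coherent_subsheaf_def coherent_def by blast
  show ?thesis
    unfolding rank_def
  proof (rule injective_dim_less[OF germ_inclusion_inj S.generic_fin_dim[OF ft'] generic_fin_dim[OF ft]])
    show "germ_inclusion X F ?\<eta> ` carrier (mstalk X (sub_omod F F') ?\<eta>) \<noteq> carrier (mstalk X F ?\<eta>)"
    proof
      assume "germ_inclusion X F ?\<eta> ` carrier (mstalk X (sub_omod F F') ?\<eta>) = carrier (mstalk X F ?\<eta>)"
      then have "carrier (mstalk X F ?\<eta>) \<subseteq> sub_germs ?\<eta>" unfolding sub_germs_image by simp
      then have "F' V = mcar F V" if "opn X V" for V
        using generically_equal_imp_equal[OF lf sat _ that] by blast
      then show False using proper unfolding proper_nontrivial_def by blast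
    qed
  qed
qed

end


section \<open>Critical parameters\<close>

text \<open>For \<open>r' = 0\<close> both slopes of the subsheaf are the junk value 0; equality then means \<open>\<delta> = - e\<close>, which is
  the critical value for rank 1 and degree 0. So only \<open>r' < r\<close> is needed.\<close>

lemma sub_slope_eq_imp_critical:
  fixes e e' :: int and \<delta> :: real
  assumes r: "r \<ge> 2" "r' < r" and \<delta>: "\<delta> > 0"
    and eq: "of_int e' / real r' = of_int e / real r + \<delta> / real r"
  shows "\<delta> \<in> numerically_critical r e"
proof (cases "r' = 0")
  case True
  have "\<delta> = (real r * of_int 0 - of_int e * real 1) / real 1"
    using eq r True by (simp add: field_simps)
  then show ?thesis
    unfolding numerically_critical_def using r \<delta>
    by (intro CollectI conjI exI[of _ 1] exI[of _ 0] disjI1) auto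
next
  case False
  have "\<delta> = (real r * of_int e' - of_int e * real r') / real r'"
    using eq r False by (simp add: field_simps)
  then show ?thesis
    unfolding numerically_critical_def using r \<delta> False
    by (intro CollectI conjI exI[of _ r'] exI[of _ e'] disjI1) auto
qed

text \<open>Here \<delta> occurs on both sides, divided by \<open>r'\<close> and by
  \<open>r\<close>. Solving for it leaves the denominator \<open>r - r'\<close>, positive by the
  rank bound, and yields the second family of critical values; \<open>r' = 0\<close> falls back to
  the first.\<close>

lemma sub_delta_slope_eq_imp_critical:
  fixes e e' :: int and \<delta> :: real
  assumes r: "r \<ge> 2" "r' < r" and \<delta>: "\<delta> > 0"
    and eq: "of_int e' / real r' + \<delta> / real r' = of_int e / real r + \<delta> / real r"
  shows "\<delta> \<in> numerically_critical r e"
proof (cases "r' = 0")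
  case True
  then show ?thesis using sub_slope_eq_imp_critical[OF r \<delta>, of 0] eq by simp
next
  case False
  have "\<delta> * (real r - real r') = of_int e * real r' - real r * of_int e'"
    using eq r False by (simp add: field_simps)
  then have "\<delta> = (of_int e * real r' - real r * of_int e') / (real r - real r')"
    using r by (simp add: field_simps)
  then show ?thesis
    unfolding numerically_critical_def using r \<delta> False
    by (intro CollectI conjI exI[of _ r'] exI[of _ e'] disjI2) auto
qed

text \<open>The difference of the two sides is continuous without zeros between \<delta> and
  \<delta>', so the intermediate value theorem fixes its sign. Stating the interval with
  \<open>min\<close> and \<open>max\<close> keeps the lemma symmetric in the two parameters.\<close>

lemma affine_less_const:
  fixes a b c c' \<delta> \<delta>' :: real
  assumes nz: "\<And>t. min \<delta> \<delta>' \<le> t \<Longrightarrow> t \<le> max \<delta> \<delta>' \<Longrightarrow> a + t * b \<noteq> c + t * c'"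
  shows "a + \<delta> * b < c + \<delta> * c' \<longleftrightarrow> a + \<delta>' * b < c + \<delta>' * c'"
proof -
  have *: "a + v * b < c + v * c'"
    if lt: "a + u * b < c + u * c'" and nz: "\<And>t. min u v \<le> t \<Longrightarrow> t \<le> max u v \<Longrightarrow> a + t * b \<noteq> c + t * c'" for u v
  proof (rule ccontr)
    assume ge: "\<not> a + v * b < c + v * c'"
    let ?f = "\<lambda>t. a + t * b - (c + t * c')"
    have cont: "continuous_on A ?f" for A by (intro continuous_intros)
    have "\<exists>t. min u v \<le> t \<and> t \<le> max u v \<and> ?f t = 0"
    proof (cases "u \<le> v")
      case True
      then show ?thesis using IVT'[of ?f u 0 v] cont lt ge by auto
    next
      case False
      then show ?thesis using IVT2'[of ?f u 0 v] cont lt ge by auto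
    qed
    then show False using nz by auto
  qed
  show ?thesis using *[of \<delta> \<delta>'] *[of \<delta>' \<delta>] nz by (auto simp: min.commute max.commute)
qed

text \<open>By strict monotonicity a critical value in the gap would be \<open>d k\<close> with
  \<open>n < k < Suc n\<close>.\<close>

lemma gap_not_critical:
  assumes "strict_mono d" "d ` {1..} = numerically_critical r e" "d n < \<delta>" "\<delta> < d (Suc n)"
  shows "\<delta> \<notin> numerically_critical r e"
proof
  assume "\<delta> \<in> numerically_critical r e"
  then obtain k where k: "\<delta> = d k" using assms(2) by auto
  then have "n < k" "k < Suc n" using assms strict_mono_less[OF assms(1)] by auto
  then show False by simp
qed


section \<open>Stability between consecutive critical parameters\<close>

text \<open>The curve contributes integrality, and the ADHM structure contributes coherence of the
  underlying sheaf, hence finite type.\<close>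

lemma adhm_sub_rank_less:
  assumes X: "smooth_projective_curve X"
    and \<E>: "adhm_sheaf X M1 M2 \<E>" "locally_free X (und \<E>)"
    and E': "coherent_subsheaf X (und \<E>) E'" "proper_nontrivial X (und \<E>) E'" "saturated X (und \<E>) E'"
  shows "rank X (sub_omod (und \<E>) E') < rank X (und \<E>)"
proof -
  have coh: "coherent X (und \<E>)" using \<E>(1) unfolding adhm_sheaf_def Let_def by blast
  have om: "is_omod X (und \<E>)" "finite_type X (und \<E>)" using coh unfolding coherent_def by auto
  have int: "integral_scheme X" using X unfolding smooth_projective_curve_def by blast
  then interpret integral_space X by (rule integral_space.intro)
  interpret integral_submodule X "und \<E>" E'
    using om E' by unfold_locales
  show ?thesis by (rule rank_less[OF \<E>(2) om(2) E'(3,2)])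
qed

text \<open>Both the comparison and the parameter may change. The first claim of the theorem changes
  the comparison at fixed \<delta>, the second changes \<delta> for the strict comparison.\<close>

lemma delta_stability_cong:
  assumes "\<And>E'. adhm_sheaf X M1 M2 \<E> \<Longrightarrow> locally_free X (und \<E>) \<Longrightarrow>
      coherent_subsheaf X (und \<E>) E' \<Longrightarrow> proper_nontrivial X (und \<E>) E' \<Longrightarrow> saturated X (und \<E>) E' \<Longrightarrow>
      cmp (delta_slope X \<delta> (sub_omod (und \<E>) E')) (delta_slope X \<delta> (und \<E>)) =
        cmp' (delta_slope X \<delta>' (sub_omod (und \<E>) E')) (delta_slope X \<delta>' (und \<E>)) \<and>
      cmp (slope X (sub_omod (und \<E>) E')) (delta_slope X \<delta> (und \<E>)) =
        cmp' (slope X (sub_omod (und \<E>) E')) (delta_slope X \<delta>' (und \<E>))"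
  shows "delta_stability cmp X M1 M2 \<delta> \<E> \<longleftrightarrow> delta_stability cmp' X M1 M2 \<delta>' \<E>"
  unfolding delta_stability_def using assms by (intro conj_cong refl all_cong) auto

text \<open>A ring homomorphism between fields is injective, so \<open>\<iota>\<close> expresses
  that \<open>K\<close> contains the complex numbers. The enumeration is a variable determined by
  its properties; one exists by \<open>critical_enumeration_exists\<close>.\<close>

theorem lemma4p4:
  fixes X :: "('x, 'r, 'k::field) krspace"
    and \<iota> :: "complex \<Rightarrow> 'k"
    and M1 :: "('x, 'r, 'a) omod" and M2 :: "('x, 'r, 'b) omod"
    and \<theta> :: "'x set \<Rightarrow> ('x, 'a, 'b) tens \<Rightarrow> 'x set \<Rightarrow> ('x, 'r, 'r) tens \<Rightarrow> 'r"
    and r :: nat and e :: int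
    and d :: "nat \<Rightarrow> real"
  assumes "\<iota> \<in> Ring.ring_hom class_ring class_ring"
    and "smooth_projective_curve X"
    and "line_bundle X M1" and "line_bundle X M2"
    and "omod_iso X (tensor X M1 M2) (inverse_canonical X) \<theta>"
    and "r \<ge> 2"
    and "d 0 = 0" and "strict_mono d" and "d ` {1..} = numerically_critical r e"
  shows "(\<forall>n \<delta>. d n < \<delta> \<and> \<delta> < d (Suc n) \<longrightarrow>
           (\<forall>\<E> :: ('x, 'r, 'm, 'a, 'b) adhm.
              adhm_sheaf X M1 M2 \<E> \<and> adhm_type X \<E> = (r, e) \<longrightarrow>
              (delta_semistable X M1 M2 \<delta> \<E> \<longleftrightarrow> delta_stable X M1 M2 \<delta> \<E>))) \<and>
         (\<forall>n \<delta> \<delta>'. d n < \<delta> \<and> \<delta> < d (Suc n) \<and> d n < \<delta>' \<and> \<delta>' < d (Suc n) \<longrightarrow>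
           {\<E> :: ('x, 'r, 'm, 'a, 'b) adhm.
              adhm_sheaf X M1 M2 \<E> \<and> adhm_type X \<E> = (r, e) \<and> delta_stable X M1 M2 \<delta> \<E>} =
           {\<E>. adhm_sheaf X M1 M2 \<E> \<and> adhm_type X \<E> = (r, e) \<and> delta_stable X M1 M2 \<delta>' \<E>})"
proof -
  have pos: "\<delta> > 0" if "d n < \<delta>" for n \<delta>
    using that strict_mono_less_eq[OF \<open>strict_mono d\<close>, of 0 n] \<open>d 0 = 0\<close> by auto
  have ne: "delta_slope X \<delta> (sub_omod (und \<E>) E') \<noteq> delta_slope X \<delta> (und \<E>)"
    "slope X (sub_omod (und \<E>) E') \<noteq> delta_slope X \<delta> (und \<E>)"
    if gap: "d n < \<delta>" "\<delta> < d (Suc n)" and type: "adhm_type X \<E> = (r, e)"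
      and E': "adhm_sheaf X M1 M2 \<E>" "locally_free X (und \<E>)" "coherent_subsheaf X (und \<E>) E'"
        "proper_nontrivial X (und \<E>) E'" "saturated X (und \<E>) E'"
    for n \<delta> and \<E> :: "('x, 'r, 'm, 'a, 'b) adhm" and E'
  proof -
    have type: "rank X (und \<E>) = r" "Defs.deg X (und \<E>) = e" using type by (auto simp: adhm_type_def)
    have less: "rank X (sub_omod (und \<E>) E') < r"
      using adhm_sub_rank_less[OF assms(2) E'] type by simp
    have nc: "\<delta> \<notin> numerically_critical r e" by (rule gap_not_critical[OF assms(8,9) gap])
    show "delta_slope X \<delta> (sub_omod (und \<E>) E') \<noteq> delta_slope X \<delta> (und \<E>)"
      using sub_delta_slope_eq_imp_critical[OF assms(6) less pos[OF gap(1)]] nc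
      unfolding delta_slope_def slope_def type by blast
    show "slope X (sub_omod (und \<E>) E') \<noteq> delta_slope X \<delta> (und \<E>)"
      using sub_slope_eq_imp_critical[OF assms(6) less pos[OF gap(1)]] nc
      unfolding delta_slope_def slope_def type by blast
  qed
  have part1: "delta_semistable X M1 M2 \<delta> \<E> \<longleftrightarrow> delta_stable X M1 M2 \<delta> \<E>"
    if "d n < \<delta>" "\<delta> < d (Suc n)" "adhm_type X \<E> = (r, e)"
    for n \<delta> and \<E> :: "('x, 'r, 'm, 'a, 'b) adhm"
    unfolding delta_semistable_def delta_stable_def
    \<comment> \<open>\<open>\<le>\<close> and \<open><\<close> differ only in the case of equality,
      which \<open>ne\<close> excludes.\<close>
    by (rule delta_stability_cong) (use ne[OF that] in \<open>auto simp: less_le\<close>)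
  have part2: "delta_stable X M1 M2 \<delta> \<E> \<longleftrightarrow> delta_stable X M1 M2 \<delta>' \<E>"
    if gap: "d n < \<delta>" "\<delta> < d (Suc n)" "d n < \<delta>'" "\<delta>' < d (Suc n)" and type: "adhm_type X \<E> = (r, e)"
    for n \<delta> \<delta>' and \<E> :: "('x, 'r, 'm, 'a, 'b) adhm"
    unfolding delta_stable_def
  proof (rule delta_stability_cong)
    fix E' assume E': "adhm_sheaf X M1 M2 \<E>" "locally_free X (und \<E>)" "coherent_subsheaf X (und \<E>) E'"
        "proper_nontrivial X (und \<E>) E'" "saturated X (und \<E>) E'"
    let ?E' = "sub_omod (und \<E>) E'"
    \<comment> \<open>The gap is an interval, so every parameter between \<delta> and \<delta>' is
      again noncritical.\<close>
    have btw: "d n < t" "t < d (Suc n)" if "min \<delta> \<delta>' \<le> t" "t \<le> max \<delta> \<delta>'" for t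
      using that gap by auto
    have "slope X ?E' + \<delta> * (1 / real (rank X ?E')) < slope X (und \<E>) + \<delta> * (1 / real (rank X (und \<E>))) \<longleftrightarrow>
        slope X ?E' + \<delta>' * (1 / real (rank X ?E')) < slope X (und \<E>) + \<delta>' * (1 / real (rank X (und \<E>)))"
      using ne(1)[OF btw type E'] by (intro affine_less_const) (simp add: delta_slope_def)
    \<comment> \<open>For subsheaves in the kernel of \<open>phi\<close> the parameter enters only
      on the side of the whole sheaf, hence the coefficient 0.\<close>
    moreover have "slope X ?E' + \<delta> * 0 < slope X (und \<E>) + \<delta> * (1 / real (rank X (und \<E>))) \<longleftrightarrow>
        slope X ?E' + \<delta>' * 0 < slope X (und \<E>) + \<delta>' * (1 / real (rank X (und \<E>)))"
      using ne(2)[OF btw type E'] by (intro affine_less_const) (simp add: delta_slope_def)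
    ultimately show "(delta_slope X \<delta> ?E' < delta_slope X \<delta> (und \<E>)) =
        (delta_slope X \<delta>' ?E' < delta_slope X \<delta>' (und \<E>)) \<and>
      (slope X ?E' < delta_slope X \<delta> (und \<E>)) = (slope X ?E' < delta_slope X \<delta>' (und \<E>))"
      by (simp add: delta_slope_def)
  qed
  show ?thesis using part1 part2 by blast
qed

end
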